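(* For every $M$, \[ N^2 \left(\mathrm{E}_M [ D(p(\cdot \mid M),\hat{p}_{\mathrm{MSVS1}}(\cdot \mid Y) ) ] - \mathrm{E}_M [ D(p(\cdot \mid M),\hat{p}_{\mathrm{SVS}}(\cdot \mid Y) ) ] \right) \to \frac{\gamma (\gamma-2p^2-2p+4)}{2\, \mathrm{tr} (M^{\top} M)} \] as $N \to \infty$. Therefore, if $p \geq 2$ and $0 < \gamma < p^2+p$, then the Bayesian predictive density with respect to $\pi_{\mathrm{MSVS1}}$ asymptotically dominates that with respect to $\pi_{\mathrm{SVS}}$ under the Kullback--Leibler loss.
   Context: Observe $Y \sim \mathrm{N}_{n,p}(M, I_n, N^{-1} I_p)$ and predict $\widetilde Y \sim \mathrm{N}_{n,p}(M, I_n, I_p)$, with unknown $M\in\mathbb{R}^{n\times p}$ and $n-p-1>0$. A predictive density $\hat p(\widetilde Y \mid Y)$ is evaluated by the Kullback--Leibler loss $D(p(\cdot\mid M),\hat p(\cdot\mid Y)) = \int p(\widetilde Y\mid M)\log \frac{p(\widetilde Y\mid M)}{\hat p(\widetilde Y\mid Y)}\,\mathrm{d}\widetilde Y$. The Bayesian predictive density based on a prior $\pi$ is $\hat p_\pi(\widetilde Y\mid Y)=\int p(\widetilde Y\mid M)\pi(M\mid Y)\,\mathrm{d}M$. Priors: $\pi_{\mathrm{SVS}}(M)=\det(M^{\top}M)^{-(n-p-1)/2}$ and $\pi_{\mathrm{MSVS1}}(M)=\pi_{\mathrm{SVS}}(M)\|M\|_{\mathrm{F}}^{-\gamma}$ with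 $\gamma\ge 0$ (posterior proper for $0\le\gamma<p^2+p$); $\hat p_{\mathrm{SVS}}$, $\hat p_{\mathrm{MSVS1}}$ are the corresponding Bayesian predictive densities.
   Formalization: The result is stated for M of full column rank (det MᵀM ≠ 0) and 0 ≤ γ < p²+p (proper posterior), not every M: at M = 0 the right-hand side is undefined, and at nonzero rank-deficient M with γ > 0 the limit formula fails since the SVS prior is singular there. *)

theory Defs
  imports "HOL-Analysis.Analysis"
begin

text \<open>Matrices in R^{n x p} are rendered as real^'p^'n (rows indexed by 'n,
columns by 'p); n = CARD('n), p = CARD('p).\<close>

definition frob :: "real^'p^'n \<Rightarrow> real" where
  "frob M = sqrt (\<Sum>i\<in>UNIV. \<Sum>j\<in>UNIV. (M$i$j)^2)"

definition mat_trace :: "real^'k^'k \<Rightarrow> real" where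
  "mat_trace A = (\<Sum>i\<in>UNIV. A$i$i)"

definition matnorm_dens :: "real \<Rightarrow> real^'p^'n \<Rightarrow> real^'p^'n \<Rightarrow> real" where
  "matnorm_dens s M X =
     (2 * pi * s) powr (- real (CARD('n) * CARD('p)) / 2)
     * exp (- (\<Sum>i\<in>UNIV. \<Sum>j\<in>UNIV. (X$i$j - M$i$j)^2) / (2 * s))"

definition prior_SVS :: "real^'p^'n \<Rightarrow> real" where
  "prior_SVS M = det (transpose M ** M) powr (- (real CARD('n) - real CARD('p) - 1) / 2)"

definition prior_MSVS1 :: "real \<Rightarrow> real^'p^'n \<Rightarrow> real" where
  "prior_MSVS1 \<gamma> M = prior_SVS M * frob M powr (- \<gamma>)"

text \<open>Bayesian predictive density p_pi(Yt | Y) with Y ~ N(M, I_n, N^{-1} I_p)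
and Yt ~ N(M, I_n, I_p): integral of p(Yt|M) against the posterior pi(M|Y).\<close>
definition bayes_pred ::
  "(real^'p^'n \<Rightarrow> real) \<Rightarrow> real \<Rightarrow> real^'p^'n \<Rightarrow> real^'p^'n \<Rightarrow> real" where
  "bayes_pred prior N Y Yt =
     (LINT M|lborel. matnorm_dens 1 M Yt * (matnorm_dens (1/N) M Y * prior M))
     / (LINT M|lborel. matnorm_dens (1/N) M Y * prior M)"

definition KL_loss :: "real^'p^'n \<Rightarrow> (real^'p^'n \<Rightarrow> real) \<Rightarrow> real" where
  "KL_loss M q = (LINT Yt|lborel. matnorm_dens 1 M Yt * ln (matnorm_dens 1 M Yt / q Yt))"

definition KL_risk :: "(real^'p^'n \<Rightarrow> real) \<Rightarrow> real \<Rightarrow> real^'p^'n \<Rightarrow> real" where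
  "KL_risk prior N M = (LINT Y|lborel. matnorm_dens (1/N) M Y * KL_loss M (bayes_pred prior N Y))"

end

theory Submission
  imports Defs "HOL-Probability.Distributions" "HOL-Real_Asymp.Real_Asymp"
begin

text \<open>
  Write \<open>m(y; s)\<close> for the marginal density of \<open>y\<close> under the prior \<open>\<pi>\<close> and noise variance \<open>s\<close>.
  Completing the square in the product of the two Gaussian densities shows that the predictive
  density is a Gaussian independent of \<open>\<pi>\<close> times \<open>m(w; 1/(N+1)) / m(y; 1/N)\<close>, where
  \<open>w = (N y + y') / (N + 1)\<close> has law \<open>N(M, 1/(N+1))\<close>. Hence the risk of \<open>\<pi>\<close> equals
  \<open>G(1/N) - G(1/(N+1))\<close> up to a term independent of \<open>\<pi>\<close>, with \<open>G(s)\<close> the mean of \<open>ln m(Y; s)\<close>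
  for \<open>Y\<close> of law \<open>N(M, s)\<close>.

  With \<open>s = t\<^sup>2\<close>, \<open>G\<close> is the Gaussian mean in \<open>z\<close> of the logarithm of the Gaussian mean in \<open>z'\<close> of
  \<open>\<pi>(M + t (z + z'))\<close>. Cutting \<open>z\<close> and \<open>z'\<close> off to a cube of side of order \<open>sqrt N\<close> changes \<open>G\<close> by
  \<open>o(N\<^sup>-\<^sup>2)\<close> and leaves an even function of \<open>t\<close> that only sees \<open>\<pi>\<close> near \<open>M\<close>, where it is \<open>C\<^sup>2\<close>.
  Applying the mean value theorem twice and dominated convergence to the second derivative gives
  \<open>N\<^sup>2 (G(1/N) - G(1/(N+1))) \<longlonglongrightarrow> \<Delta>\<pi>/\<pi> - \<bar>\<nabla>\<pi>\<bar>\<^sup>2 / (2 \<pi>\<^sup>2)\<close> at \<open>M\<close>. In the difference of the two priors only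
  the radial derivative of the SVS prior survives, and it is known because that prior is homogeneous.

  The priors are integrable against Gaussians because the Gram determinant factors into squared
  distances of each column to the span of the previous ones, and these distances can be integrated
  out one column at a time.
\<close>

section \<open>Gaussian integrals on Euclidean spaces\<close>

text \<open>The obstacle is that the priors are singular on the matrices of deficient rank, which
  rules out an expansion over the whole space. The cube of half-side \<open>R\<close> with
  \<open>2 * t * DIM('a) * R \<le> r\<close> keeps \<open>M + t (z + z')\<close> in a ball of radius
  \<open>r\<close> about \<open>M\<close>; since \<open>t\<close> is about
  \<open>1 / sqrt N\<close>, this permits \<open>R\<close> of order \<open>sqrt N\<close>, which
  makes the discarded Gaussian mass negligible.

  Because \<open>N^2 * (1/N - 1/(N+1))\<close> tends to 1, the limit is the derivative of
  \<open>G\<close> in \<open>s\<close> at 0, that is, half of the second derivative in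
  \<open>t\<close>. The Laplacian has coefficient 1 and not 1/2 because \<open>z + z'\<close> has
  covariance twice the identity: noise and posterior spread contribute equally.

  For the factor \<open>norm x powr (- \<gamma>)\<close> the dimension \<open>n p\<close> enters
  through its Laplacian and is offset by the degree \<open>- p (n - p - 1)\<close> of the SVS prior;
  what remains is \<open>p^2 + p\<close>. The same number \<open>n p - p (n - p - 1)\<close> is the
  exponent at which the product of the two factors ceases to be integrable at the origin.\<close>

definition gauss :: "real \<Rightarrow> 'a::euclidean_space \<Rightarrow> real" where
  "gauss s x = (2 * pi * s) powr (- (real DIM('a) / 2)) * exp (- (norm x)\<^sup>2 / (2 * s))"

lemma gauss_pos: "s > 0 \<Longrightarrow> gauss s x > 0"
  by (simp add: gauss_def)

lemma gauss_nonneg [simp]: "0 \<le> gauss s x"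
  by (simp add: gauss_def)

lemma gauss_minus [simp]: "gauss s (- x) = gauss s x"
  by (simp add: gauss_def)

lemma continuous_on_gauss [continuous_intros]:
  "continuous_on S f \<Longrightarrow> continuous_on S (\<lambda>x. gauss s (f x))"
  unfolding gauss_def divide_inverse by (intro continuous_intros)

lemma borel_measurable_gauss [measurable]:
  "f \<in> borel_measurable N \<Longrightarrow> (\<lambda>x. gauss s (f x)) \<in> borel_measurable N"
  by (rule borel_measurable_continuous_on[where f = "gauss s"]) (auto intro: continuous_intros)

lemma norm_sq_eq_sum_Basis: "(norm (x::'a::euclidean_space))\<^sup>2 = (\<Sum>b\<in>Basis. (x \<bullet> b)\<^sup>2)"
  by (subst power2_norm_eq_inner, subst euclidean_inner) (simp add: power2_eq_square)

lemma gauss_eq_prod: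
  assumes "s > 0"
  shows "gauss s (x::'a::euclidean_space) = (\<Prod>b\<in>Basis. normal_density 0 (sqrt s) (x \<bullet> b))"
proof -
  have "(\<Prod>b\<in>Basis. normal_density 0 (sqrt s) (x \<bullet> b))
      = (1 / sqrt (2 * pi * s)) ^ DIM('a) * exp (\<Sum>b\<in>Basis. - (x \<bullet> b)\<^sup>2 / (2 * s))"
    using assms by (simp add: normal_density_def prod.distrib exp_sum prod_dividef power_one_over)
  also have "(\<Sum>b\<in>Basis. - (x \<bullet> b)\<^sup>2 / (2 * s)) = - (norm x)\<^sup>2 / (2 * s)"
    by (simp add: norm_sq_eq_sum_Basis sum_negf sum_divide_distrib)
  also have "(1 / sqrt (2 * pi * s)) ^ DIM('a) = (2 * pi * s) powr (- (real DIM('a) / 2))"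
  proof -
    have "sqrt (2 * pi * s) ^ DIM('a) = ((2 * pi * s) powr (1/2)) ^ DIM('a)"
      using assms by (subst powr_half_sqrt) auto
    also have "\<dots> = (2 * pi * s) powr (real DIM('a) / 2)"
      using assms by (subst powr_power) auto
    finally show ?thesis by (simp add: power_one_over powr_minus_divide)
  qed
  finally show ?thesis by (simp add: gauss_def)
qed

lemma has_bochner_integral_gauss:
  assumes "s > 0"
  shows "has_bochner_integral lborel (gauss s :: 'a::euclidean_space \<Rightarrow> real) 1"
proof (rule has_bochner_integral_nn_integral)
  have "(\<integral>\<^sup>+x. ennreal (gauss s (x::'a)) \<partial>lborel)
      = (\<integral>\<^sup>+x. (\<Prod>b\<in>Basis. ennreal (normal_density 0 (sqrt s) (x \<bullet> b))) \<partial>(lborel :: 'a measure))"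
    using assms by (simp add: gauss_eq_prod prod_ennreal)
  also have "\<dots> = 1"
    using assms by (subst nn_integral_lborel_prod) (simp_all add: nn_integral_eq_integral)
  finally show "(\<integral>\<^sup>+x. ennreal (gauss s (x::'a)) \<partial>lborel) = ennreal 1" by simp
qed (use assms in simp_all)

lemma integrable_gauss: "s > 0 \<Longrightarrow> integrable lborel (gauss s :: 'a::euclidean_space \<Rightarrow> real)"
  and integral_gauss: "s > 0 \<Longrightarrow> integral\<^sup>L lborel (gauss s :: 'a::euclidean_space \<Rightarrow> real) = 1"
  using has_bochner_integral_gauss[of s, where 'a='a] by (auto simp: has_bochner_integral_iff)

lemma integrable_exp_norm_sq:
  assumes "a > 0"
  shows "integrable lborel (\<lambda>x::'a::euclidean_space. exp (- a * norm x ^ 2))"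
proof -
  have "integrable lborel (\<lambda>x::'a. (2 * pi * (1 / (2 * a))) powr (real DIM('a) / 2) * gauss (1 / (2 * a)) x)"
    by (intro integrable_mult_right integrable_gauss) (use assms in auto)
  also have "(\<lambda>x::'a. (2 * pi * (1 / (2 * a))) powr (real DIM('a) / 2) * gauss (1 / (2 * a)) x)
      = (\<lambda>x. exp (- a * norm x ^ 2))"
    using assms by (auto simp: gauss_def fun_eq_iff powr_minus field_simps)
  finally show ?thesis .
qed

text \<open>A single term of the exponential series of \<open>c * u\<close> is at most its sum, all
  terms being nonnegative.\<close>

lemma power_le_exp:
  assumes "c > 0" "(u::real) \<ge> 0"
  shows "u ^ k \<le> fact k / c ^ k * exp (c * u)"
proof -
  have "(c * u) ^ k / fact k \<le> exp (c * u)"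
  proof -
    have "(\<Sum>i\<in>{k}. (c * u) ^ i / fact i) \<le> (\<Sum>i. (c * u) ^ i / fact i)"
      by (rule sum_le_suminf) (use assms summable_exp[of "c * u"] in \<open>auto simp: field_simps\<close>)
    then show ?thesis by (simp add: exp_def scaleR_conv_of_real field_simps)
  qed
  then show ?thesis using assms by (simp add: field_simps power_mult_distrib)
qed

text \<open>Half of the Gaussian exponent absorbs the polynomial factor; the other half remains as
  decay.\<close>

lemma norm_power_exp_le:
  assumes "a > 0"
  obtains C where "C > 0" "\<And>x::'a::real_normed_vector. norm x ^ k * exp (- a * norm x ^ 2) \<le> C * exp (- (a/2) * norm x ^ 2)"
proof
  show "1 + fact k / (a/2) ^ k > 0" using assms by (simp add: add_pos_nonneg)
  fix x :: 'a
  \<comment> \<open>Passing to powers of the squared norm allows \<open>power_le_exp\<close> with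
    \<open>u = norm x ^ 2\<close>, the quantity in the exponent.\<close>
  have "norm x ^ k \<le> 1 + (norm x ^ 2) ^ k"
  proof (cases "norm x \<le> 1")
    case True
    then have "norm x ^ k \<le> 1" by (simp add: power_le_one)
    then show ?thesis by (simp add: add_increasing2)
  next
    case False
    then have "norm x ^ k \<le> norm x ^ (2 * k)" by (intro power_increasing) auto
    then show ?thesis by (simp add: power_mult)
  qed
  also have "\<dots> \<le> exp (a/2 * norm x ^ 2) + fact k / (a/2) ^ k * exp (a/2 * norm x ^ 2)"
    using assms by (intro add_mono power_le_exp) auto
  finally have "norm x ^ k * exp (- a * norm x ^ 2)
      \<le> (exp (a/2 * norm x ^ 2) + fact k / (a/2) ^ k * exp (a/2 * norm x ^ 2)) * exp (- a * norm x ^ 2)"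
    by (intro mult_right_mono) auto
  also have "\<dots> = (1 + fact k / (a/2) ^ k) * (exp (a/2 * norm x ^ 2) * exp (- a * norm x ^ 2))"
    by (simp add: algebra_simps)
  also have "exp (a/2 * norm x ^ 2) * exp (- a * norm x ^ 2) = exp (- (a/2) * norm x ^ 2)"
    by (simp add: exp_add[symmetric])
  finally show "norm x ^ k * exp (- a * norm x ^ 2) \<le> (1 + fact k / (a/2) ^ k) * exp (- (a/2) * norm x ^ 2)" .
qed

lemma integrable_norm_power_exp:
  assumes "a > 0"
  shows "integrable lborel (\<lambda>x::'a::euclidean_space. norm x ^ k * exp (- a * norm x ^ 2))"
proof -
  obtain C where C: "C > 0" "\<And>x::'a. norm x ^ k * exp (- a * norm x ^ 2) \<le> C * exp (- (a/2) * norm x ^ 2)"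
    using norm_power_exp_le[OF assms] by blast
  show ?thesis
  proof (rule Bochner_Integration.integrable_bound)
    show "integrable lborel (\<lambda>x::'a. C * exp (- (a/2) * norm x ^ 2))"
      by (intro integrable_mult_right integrable_exp_norm_sq) (use assms in auto)
  qed (use C in \<open>auto simp: abs_mult intro!: AE_I2\<close>)
qed

lemma integrable_gauss_norm_power:
  assumes "s > 0"
  shows "integrable lborel (\<lambda>x::'a::euclidean_space. gauss s x * norm x ^ k)"
proof -
  have "integrable lborel (\<lambda>x::'a. (2 * pi * s) powr (- (real DIM('a) / 2)) * (norm x ^ k * exp (- (1/(2 * s)) * norm x ^ 2)))"
    by (intro integrable_mult_right integrable_norm_power_exp) (use assms in auto)
  then show ?thesis by (simp add: gauss_def field_simps)
qed

lemma integrable_gauss_quadratic_bound: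
  fixes f :: "'a::euclidean_space \<Rightarrow> real"
  assumes "s > 0" "f \<in> borel_measurable borel" "\<And>x. \<bar>f x\<bar> \<le> A + B * norm x ^ 2"
  shows "integrable lborel (\<lambda>x. gauss s x * f x)"
proof (rule Bochner_Integration.integrable_bound)
  have "integrable lborel (\<lambda>x::'a. A * (gauss s x * norm x ^ 0) + B * (gauss s x * norm x ^ 2))"
    by (intro Bochner_Integration.integrable_add integrable_mult_right integrable_gauss_norm_power assms)
  then show "integrable lborel (\<lambda>x::'a. gauss s x * (A + B * norm x ^ 2))"
    by (simp add: algebra_simps)
  show "AE x in lborel. norm (gauss s x * f x) \<le> norm (gauss s x * (A + B * norm x ^ 2))"
  proof (intro AE_I2)
    fix x
    have "\<bar>f x\<bar> \<le> \<bar>A + B * norm x ^ 2\<bar>" using assms(3)[of x] by linarith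
    then show "norm (gauss s x * f x) \<le> norm (gauss s x * (A + B * norm x ^ 2))"
      by (simp add: abs_mult mult_left_mono)
  qed
qed (use assms in measurable)

lemma nn_integral_lborel_affine:
  fixes f :: "'a::euclidean_space \<Rightarrow> ennreal"
  assumes [measurable]: "f \<in> borel_measurable borel" and c: "c \<noteq> 0"
  shows "(\<integral>\<^sup>+x. f x \<partial>lborel) = ennreal (\<bar>c\<bar> ^ DIM('a)) * (\<integral>\<^sup>+x. f (t + c *\<^sub>R x) \<partial>lborel)"
  by (subst lborel_affine[OF c, of t])
     (simp add: nn_integral_density nn_integral_distr nn_integral_cmult)

lemma integrable_lborel_affine:
  fixes f :: "'a::euclidean_space \<Rightarrow> real"
  assumes c: "c \<noteq> 0"
  shows "integrable lborel (\<lambda>x. f (t + c *\<^sub>R x)) \<longleftrightarrow> integrable lborel f"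
proof -
  have *: "integrable lborel (\<lambda>x. g (t + c *\<^sub>R x))" if g: "integrable lborel g" and c: "c \<noteq> 0" for g :: "'a \<Rightarrow> real" and c t
  proof -
    have [measurable]: "g \<in> borel_measurable borel" using g by auto
    show ?thesis using g unfolding integrable_iff_bounded
      by (subst (asm) nn_integral_lborel_affine[where c=c and t=t]) (use c in \<open>auto simp: ennreal_mult_less_top\<close>)
  qed
  show ?thesis
  proof
    assume "integrable lborel (\<lambda>x. f (t + c *\<^sub>R x))"
    from *[OF this, of "1/c" "- (1/c) *\<^sub>R t"] c show "integrable lborel f"
      by (simp add: algebra_simps)
  qed (use * c in blast)
qed

lemma integral_lborel_affine:
  fixes f :: "'a::euclidean_space \<Rightarrow> real"
  assumes c: "c \<noteq> 0"
  shows "(\<integral>x. f x \<partial>lborel) = \<bar>c\<bar> ^ DIM('a) * (\<integral>x. f (t + c *\<^sub>R x) \<partial>lborel)"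
proof (cases "integrable lborel f")
  case True
  then have [measurable]: "f \<in> borel_measurable borel" by auto
  show ?thesis
    by (subst lborel_affine[OF c, of t]) (simp add: integral_density integral_distr)
next
  case False
  then show ?thesis using integrable_lborel_affine[OF c, of f t]
    by (simp add: not_integrable_integral_eq)
qed

lemma gauss_scale:
  assumes "t > 0"
  shows "gauss (t\<^sup>2) (t *\<^sub>R x) = gauss 1 (x::'a::euclidean_space) / t ^ DIM('a)"
proof -
  have "(2 * pi * t\<^sup>2) powr (- (real DIM('a) / 2)) = (2 * pi) powr (- (real DIM('a) / 2)) * (t powr 2) powr (- (real DIM('a) / 2))"
    using assms by (simp add: powr_mult)
  also have "(t powr 2) powr (- (real DIM('a) / 2)) = 1 / t ^ DIM('a)"
  proof -
    have "(t powr 2) powr (- (real DIM('a) / 2)) = t powr (- real DIM('a))"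
      by (simp add: powr_powr)
    also have "\<dots> = 1 / t powr real DIM('a)" by (rule powr_minus_divide)
    finally show ?thesis using assms by (simp only: powr_realpow)
  qed
  finally show ?thesis using assms by (simp add: gauss_def power_mult_distrib field_simps)
qed

section \<open>Symmetry and second moments of the standard Gaussian\<close>

lemma integral_lborel_odd:
  fixes f :: "'a::euclidean_space \<Rightarrow> real"
  assumes "\<And>x. f (- x) = - f x"
  shows "(\<integral>x. f x \<partial>lborel) = 0"
proof -
  have "(\<integral>x. f x \<partial>lborel) = (\<integral>x. f (- x) \<partial>lborel)"
    using integral_lborel_affine[of "-1" f 0] by simp
  then show ?thesis using assms by simp
qed

lemma integral_gauss_Basis_square:
  assumes b: "b \<in> Basis"
  shows "(\<integral>x. gauss 1 x * (x \<bullet> (b::'a::euclidean_space))\<^sup>2 \<partial>lborel) = 1"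
proof -
  \<comment> \<open>The square is attached to the factor of coordinate \<open>b\<close> alone, so
    the integral splits into one-dimensional ones, all equal to 1.\<close>
  let ?f = "\<lambda>c u. if c = b then normal_density 0 1 u * u\<^sup>2 else normal_density 0 1 u"
  have *: "has_bochner_integral lborel (?f c) 1" for c
    using std_normal_moment_even[of 1] by (cases "c = b") (simp_all add: has_bochner_integral_iff)
  have "(\<integral>\<^sup>+x. ennreal (gauss 1 x * (x \<bullet> b)\<^sup>2) \<partial>lborel) = (\<integral>\<^sup>+x. (\<Prod>c\<in>Basis. ennreal (?f c (x \<bullet> c))) \<partial>lborel)"
  proof (rule nn_integral_cong)
    fix x :: 'a
    have "(\<Prod>c\<in>Basis. ?f c (x \<bullet> c)) = (\<Prod>c\<in>Basis. normal_density 0 1 (x \<bullet> c) * (if c = b then (x \<bullet> b)\<^sup>2 else 1))"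
      by (intro prod.cong) auto
    also have "\<dots> = gauss 1 x * (x \<bullet> b)\<^sup>2"
      using b by (subst prod.distrib) (simp add: gauss_eq_prod prod.delta)
    finally show "ennreal (gauss 1 x * (x \<bullet> b)\<^sup>2) = (\<Prod>c\<in>Basis. ennreal (?f c (x \<bullet> c)))"
      by (subst prod_ennreal) auto
  qed
  also have "\<dots> = (\<Prod>c\<in>Basis. \<integral>\<^sup>+u. ennreal (?f c u) \<partial>lborel)"
    by (rule nn_integral_lborel_prod) auto
  also have "\<dots> = 1"
    by (intro prod.neutral ballI, subst nn_integral_eq_integral)
       (use * in \<open>auto simp: has_bochner_integral_iff\<close>)
  finally have "has_bochner_integral lborel (\<lambda>x. gauss 1 x * (x \<bullet> b)\<^sup>2) 1"
    by (intro has_bochner_integral_nn_integral) auto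
  then show ?thesis by (simp add: has_bochner_integral_iff)
qed

text \<open>Reflecting the coordinate \<open>b\<close> preserves Lebesgue measure and the Gaussian
  but changes the sign of the integrand.\<close>

lemma integral_gauss_Basis_cross:
  assumes b: "b \<in> Basis" "c \<in> Basis" "b \<noteq> c"
  shows "(\<integral>x. gauss 1 x * ((x \<bullet> (b::'a::euclidean_space)) * (x \<bullet> c)) \<partial>lborel) = 0"
proof -
  define e where "e j = (if j = b then -1 else 1::real)" for j
  define T where "T x = (\<Sum>j\<in>Basis. (e j * (x \<bullet> j)) *\<^sub>R j)" for x :: 'a
  have T: "T x \<bullet> j = e j * (x \<bullet> j)" if "j \<in> Basis" for j x
    using that by (simp add: T_def inner_sum_left inner_Basis if_distrib sum.delta cong: if_cong)
  have [measurable]: "T \<in> borel_measurable borel" unfolding T_def by measurable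
  have lb: "(lborel :: 'a measure) = distr lborel borel T"
    using lborel_affine_euclidean[of e 0] by (simp add: T_def[abs_def] e_def if_distrib density_1 one_ennreal_def[symmetric] cong: if_cong)
  have "norm (T x) ^ 2 = norm x ^ 2" for x
    unfolding norm_sq_eq_sum_Basis by (intro sum.cong) (auto simp: T e_def power2_eq_square)
  then have g: "gauss 1 (T x) = gauss 1 x" for x by (simp add: gauss_def)
  let ?f = "\<lambda>x. gauss 1 x * ((x \<bullet> b) * (x \<bullet> c))"
  have "(\<integral>x. ?f x \<partial>lborel) = (\<integral>x. ?f x \<partial>(distr lborel borel T))" using lb by simp
  also have "\<dots> = (\<integral>x. ?f (T x) \<partial>lborel)" by (rule integral_distr) auto
  also have "\<dots> = (\<integral>x. - ?f x \<partial>lborel)"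
    using b by (intro Bochner_Integration.integral_cong) (auto simp: g T e_def)
  finally show ?thesis by simp
qed

text \<open>The second moments form the identity matrix, so only the diagonal of the double sum over
  the basis survives. Applied to a Hessian, this is where Laplacians come from.\<close>

lemma integrable_gauss_quadratic:
  fixes B :: "'a::euclidean_space \<Rightarrow> 'a \<Rightarrow> real"
  assumes "bounded_bilinear B"
  shows "integrable lborel (\<lambda>x::'a. gauss 1 x * B x x)"
    and "(\<integral>x. gauss 1 x * B x x \<partial>(lborel::'a measure)) = (\<Sum>b\<in>Basis. B b b)"
proof -
  interpret bounded_bilinear B by fact
  have expand: "B x x = (\<Sum>b\<in>Basis. \<Sum>c\<in>Basis. (x \<bullet> b) * (x \<bullet> c) * B b c)" for x :: 'a
  proof -
    have "B x x = B (\<Sum>b\<in>Basis. (x \<bullet> b) *\<^sub>R b) (\<Sum>c\<in>Basis. (x \<bullet> c) *\<^sub>R c)"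
      by (simp add: euclidean_representation)
    also have "\<dots> = (\<Sum>b\<in>Basis. \<Sum>c\<in>Basis. (x \<bullet> b) * (x \<bullet> c) * B b c)"
      by (simp only: sum_left sum_right scaleR_left scaleR_right scaleR_scaleR real_scaleR_def sum_distrib_left)
        (subst sum.swap, simp add: mult_ac)
    finally show ?thesis .
  qed
  have int: "integrable lborel (\<lambda>x::'a. gauss 1 x * ((x \<bullet> b) * (x \<bullet> c)))" if "b \<in> Basis" "c \<in> Basis" for b c
  proof (rule integrable_gauss_quadratic_bound[where A = 0 and B = 1])
    show "\<bar>(x \<bullet> b) * (x \<bullet> c)\<bar> \<le> 0 + 1 * norm x ^ 2" for x
      using Basis_le_norm[OF that(1), of x] Basis_le_norm[OF that(2), of x]
      by (auto simp: abs_mult power2_eq_square intro!: mult_mono)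
  qed auto
  have eq: "gauss 1 x * B x x = (\<Sum>b\<in>Basis. \<Sum>c\<in>Basis. B b c * (gauss 1 x * ((x \<bullet> b) * (x \<bullet> c))))" for x :: 'a
    by (subst expand) (simp add: sum_distrib_left mult_ac)
  show "integrable lborel (\<lambda>x::'a. gauss 1 x * B x x)"
    unfolding eq by (intro Bochner_Integration.integrable_sum integrable_mult_right int)
  have "(\<integral>x. gauss 1 x * B x x \<partial>(lborel::'a measure))
     = (\<Sum>b\<in>Basis. \<Sum>c\<in>Basis. B b c * (\<integral>x. gauss 1 x * ((x \<bullet> b) * (x \<bullet> c)) \<partial>(lborel::'a measure)))"
    unfolding eq by (simp add: int Bochner_Integration.integral_sum)
  also have "\<dots> = (\<Sum>b\<in>Basis. \<Sum>c\<in>Basis. if c = b then B b b else 0)"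
    using integral_gauss_Basis_square integral_gauss_Basis_cross
    by (intro sum.cong refl) (auto simp: power2_eq_square)
  also have "\<dots> = (\<Sum>b\<in>Basis. B b b)" by simp
  finally show "(\<integral>x. gauss 1 x * B x x \<partial>(lborel::'a measure)) = (\<Sum>b\<in>Basis. B b b)" .
qed

text \<open>Completing the square: the precisions \<open>N\<close> and \<open>1\<close> add up to
  \<open>N + 1\<close> for the weighted mean, while the variances add up for the difference
  \<open>b - a\<close>.\<close>

lemma gauss_product:
  fixes a b :: "'a::euclidean_space"
  assumes "N > 0"
  shows "gauss (1/N) a * gauss 1 b
    = gauss (1/(N+1)) ((1/(N+1)) *\<^sub>R (N *\<^sub>R a + b)) * gauss (1 + 1/N) (b - a)"
proof -
  \<comment> \<open>The normalising constants agree because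
    \<open>1/N * 1 = 1/(N+1) * (1 + 1/N)\<close>.\<close>
  have 1: "(2 * pi * (1/N)) powr u * (2 * pi * 1) powr u
      = (2 * pi * (1/(N+1))) powr u * (2 * pi * (1 + 1/N)) powr u" for u :: real
  proof -
    have "2 * pi * (1/N) * (2 * pi * 1) = 2 * pi * (1/(N+1)) * (2 * pi * (1 + 1/N))"
      using assms by (simp add: divide_simps)
    then show ?thesis using assms by (simp only: powr_mult[symmetric])
  qed
  have 2: "- (norm a)\<^sup>2 / (2 * (1/N)) + - (norm b)\<^sup>2 / (2 * 1) =
      - (norm ((1/(N+1)) *\<^sub>R (N *\<^sub>R a + b)))\<^sup>2 / (2 * (1/(N+1))) + - (norm (b - a))\<^sup>2 / (2 * (1 + 1/N))"
  proof -
    have "(norm ((1/(N+1)) *\<^sub>R (N *\<^sub>R a + b)))\<^sup>2 = (1/(N+1))\<^sup>2 * (N\<^sup>2 * norm a ^ 2 + 2 * N * (a \<bullet> b) + norm b ^ 2)"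
      unfolding power2_norm_eq_inner
      by (simp add: inner_add_left inner_add_right inner_commute power2_eq_square algebra_simps)
    moreover have "(norm (b - a))\<^sup>2 = norm a ^ 2 - 2 * (a \<bullet> b) + norm b ^ 2"
      unfolding power2_norm_eq_inner
      by (simp add: inner_diff_left inner_diff_right inner_commute algebra_simps)
    moreover have "1 + 1/N = (N+1)/N" using assms by (simp add: field_simps)
    ultimately show ?thesis using assms
      by (simp add: divide_simps power2_eq_square) (simp add: algebra_simps)
  qed
  show ?thesis unfolding gauss_def
    using arg_cong2[where f = "(*)", OF 1[of "- (real DIM('a) / 2)"] arg_cong[where f = exp, OF 2]]
    by (simp only: exp_add mult_ac)
qed

section \<open>The risk in terms of marginal densities\<close>

lemma norm_add_sq_le: "(norm (x + y))\<^sup>2 \<le> 2 * norm x ^ 2 + 2 * (norm (y::'a::real_inner))\<^sup>2"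
proof -
  have "0 \<le> (norm (x - y))\<^sup>2" by simp
  then show ?thesis unfolding power2_norm_eq_inner
    by (simp add: inner_diff_left inner_diff_right inner_add_left inner_add_right inner_commute)
qed

lemma integrable_exp_quadratic_bound:
  fixes f :: "'a::euclidean_space \<Rightarrow> real"
  assumes "c > 0" "f \<in> borel_measurable borel"
    and bound: "\<And>x. \<bar>f x\<bar> \<le> K * exp (- c * norm x ^ 2) * (A + B * norm x ^ 2)"
  shows "integrable lborel f"
proof (rule Bochner_Integration.integrable_bound)
  have "integrable lborel (\<lambda>x::'a. (K * A) * (norm x ^ 0 * exp (- c * norm x ^ 2)) + (K * B) * (norm x ^ 2 * exp (- c * norm x ^ 2)))"
    by (intro Bochner_Integration.integrable_add integrable_mult_right integrable_norm_power_exp assms)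
  then show "integrable lborel (\<lambda>x::'a. K * exp (- c * norm x ^ 2) * (A + B * norm x ^ 2))"
    by (simp add: algebra_simps)
  show "AE x in lborel. norm (f x) \<le> norm (K * exp (- c * norm x ^ 2) * (A + B * norm x ^ 2))"
    by (intro AE_I2) (use bound in \<open>simp only: real_norm_def, meson abs_ge_self order_trans\<close>)
qed (use assms in measurable)

lemma weighted_mean_add:
  assumes "N > (0::real)"
  shows "(1/(N+1)) *\<^sub>R (N *\<^sub>R (a + x) + (b + x)) = (1/(N+1)) *\<^sub>R (N *\<^sub>R a + b) + (x::'a::real_vector)"
proof -
  have "N *\<^sub>R (a + x) + (b + x) = (N *\<^sub>R a + b) + (N + 1) *\<^sub>R x" by (simp add: algebra_simps)
  then have "(1/(N+1)) *\<^sub>R (N *\<^sub>R (a + x) + (b + x)) = (1/(N+1)) *\<^sub>R (N *\<^sub>R a + b) + (1/(N+1)) *\<^sub>R ((N + 1) *\<^sub>R x)"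
    by (simp only: scaleR_add_right)
  then show ?thesis using assms by (simp only: scaleR_scaleR) simp
qed

lemma norm_prod_sq: "(norm (p::'a::euclidean_space \<times> 'b::euclidean_space))\<^sup>2 = (norm (fst p))\<^sup>2 + (norm (snd p))\<^sup>2"
  by (simp add: norm_prod_def)

text \<open>In the coordinates \<open>w = a + k *\<^sub>R b\<close> and \<open>b\<close> the
  exponent is diagonal, so it dominates a multiple of the squared norm of the pair. The shear covers
  both independent Gaussians (\<open>k = 0\<close>) and the joint law met in
  \<open>integral_gauss_mixture\<close>.\<close>

lemma integrable_gauss_pair:
  fixes f :: "'a::euclidean_space \<times> 'a \<Rightarrow> real"
  assumes s: "0 < s" "0 < s'" and [measurable]: "f \<in> borel_measurable borel"
    and bound: "\<And>a b. \<bar>f (a, b)\<bar> \<le> A + B * (norm a ^ 2 + norm b ^ 2)"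
  shows "integrable (lborel \<Otimes>\<^sub>M lborel) (\<lambda>(a, b). gauss s (a + k *\<^sub>R b) * gauss s' b * f (a, b))"
proof -
  \<comment> \<open>The divisor comes from bounding the squared norm of \<open>a\<close> by
    \<open>2 * norm w ^ 2 + 2 * k^2 * norm b ^ 2\<close> and adding the squared norm of
    \<open>b\<close>.\<close>
  define c where "c = min (1 / (2 * s)) (1 / (2 * s')) / (2 + 2 * k\<^sup>2)"
  define K :: real where "K = (2 * pi * s) powr (- (real DIM('a) / 2)) * (2 * pi * s') powr (- (real DIM('a) / 2))"
  have kpos: "2 + 2 * k\<^sup>2 > 0" by (simp add: add_pos_nonneg)
  have c: "c > 0" using s kpos by (simp add: c_def)
  have "integrable lborel (\<lambda>p::'a \<times> 'a. gauss s (fst p + k *\<^sub>R snd p) * gauss s' (snd p) * f p)"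
  proof (rule integrable_exp_quadratic_bound[OF c])
    fix p :: "'a \<times> 'a"
    obtain a b where p: "p = (a, b)" by (cases p)
    let ?w = "a + k *\<^sub>R b"
    have "norm a ^ 2 \<le> 2 * (norm ?w)\<^sup>2 + 2 * (norm (- (k *\<^sub>R b)))\<^sup>2"
      using norm_add_sq_le[of ?w "- (k *\<^sub>R b)"] by simp
    then have "norm p ^ 2 \<le> 2 * (norm ?w)\<^sup>2 + (1 + 2 * k\<^sup>2) * norm b ^ 2"
      by (simp add: norm_prod_sq p power_mult_distrib algebra_simps)
    also have "\<dots> \<le> (2 + 2 * k\<^sup>2) * ((norm ?w)\<^sup>2 + norm b ^ 2)"
      by (simp add: algebra_simps)
    finally have 1: "norm p ^ 2 / (2 + 2 * k\<^sup>2) \<le> (norm ?w)\<^sup>2 + norm b ^ 2"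
      using kpos by (simp add: field_simps)
    let ?m = "min (1 / (2 * s)) (1 / (2 * s'))"
    have "c * norm p ^ 2 = ?m * (norm p ^ 2 / (2 + 2 * k\<^sup>2))" by (simp add: c_def)
    also have "\<dots> \<le> ?m * ((norm ?w)\<^sup>2 + norm b ^ 2)"
      using s 1 by (intro mult_left_mono) auto
    also have "\<dots> = ?m * (norm ?w)\<^sup>2 + ?m * norm b ^ 2" by (simp add: algebra_simps)
    also have "\<dots> \<le> (1 / (2 * s)) * (norm ?w)\<^sup>2 + (1 / (2 * s')) * norm b ^ 2"
      by (intro add_mono mult_right_mono) auto
    finally have 2: "- (norm ?w)\<^sup>2 / (2 * s) + - (norm b)\<^sup>2 / (2 * s') \<le> - c * norm p ^ 2"
      by simp
    have "gauss s ?w * gauss s' b = K * exp (- (norm ?w)\<^sup>2 / (2 * s) + - (norm b)\<^sup>2 / (2 * s'))"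
      unfolding exp_add by (simp add: gauss_def K_def)
    also have "\<dots> \<le> K * exp (- c * norm p ^ 2)"
      using 2 by (intro mult_left_mono) (auto simp: K_def)
    finally have "gauss s ?w * gauss s' b \<le> K * exp (- c * norm p ^ 2)" .
    moreover have "\<bar>f p\<bar> \<le> A + B * norm p ^ 2" using bound[of a b] by (simp add: p norm_prod_sq)
    ultimately show "\<bar>gauss s (fst p + k *\<^sub>R snd p) * gauss s' (snd p) * f p\<bar> \<le> K * exp (- c * norm p ^ 2) * (A + B * norm p ^ 2)"
      unfolding p fst_conv snd_conv abs_mult[of "_ * _" "f _"]
      by (intro mult_mono) (auto simp: K_def)
  next
    show "(\<lambda>p. gauss s (fst p + k *\<^sub>R snd p) * gauss s' (snd p) * f p) \<in> borel_measurable borel"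
      using assms(3) unfolding borel_prod[symmetric] by measurable
  qed
  then show ?thesis by (simp add: lborel_prod case_prod_unfold)
qed

text \<open>For fixed \<open>a\<close> put \<open>b = a + u\<close>: then \<open>a\<close> and
  \<open>u\<close> enter \<open>h\<close> only through \<open>a + u / (N + 1)\<close>. After
  exchanging the integrals a translation of \<open>a\<close> removes \<open>u\<close> from
  \<open>h\<close>, and the density of \<open>u\<close> integrates to 1.\<close>

lemma integral_gauss_mixture:
  fixes h :: "'a::euclidean_space \<Rightarrow> real"
  assumes N: "N > 0" and [measurable]: "h \<in> borel_measurable borel"
    and bound: "\<And>w. \<bar>h w\<bar> \<le> A + B * norm w ^ 2"
  shows "(\<integral>a. \<integral>b. gauss (1/N) a * gauss 1 b * h ((1/(N+1)) *\<^sub>R (N *\<^sub>R a + b)) \<partial>lborel \<partial>lborel)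
    = (\<integral>w. gauss (1/(N+1)) w * h w \<partial>lborel)"
proof -
  let ?k = "1/(N+1)"
  let ?F = "\<lambda>a u. gauss ?k (a + ?k *\<^sub>R u) * gauss (1 + 1/N) u * h (a + ?k *\<^sub>R u)"
  have A: "A \<ge> 0" using bound[of 0] by simp
  have eq: "?k *\<^sub>R (N *\<^sub>R a + (a + u)) = a + ?k *\<^sub>R u" for a u :: 'a
    using weighted_mean_add[OF N, of 0 a u] by (simp add: add.commute)
  have "(\<integral>b. gauss (1/N) a * gauss 1 b * h (?k *\<^sub>R (N *\<^sub>R a + b)) \<partial>lborel) = (\<integral>u. ?F a u \<partial>lborel)" for a
    by (subst integral_lborel_affine[of 1 _ a]) (simp_all add: gauss_product[OF N] eq)
  then have "(\<integral>a. \<integral>b. gauss (1/N) a * gauss 1 b * h ((1/(N+1)) *\<^sub>R (N *\<^sub>R a + b)) \<partial>lborel \<partial>lborel)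
      = (\<integral>a. \<integral>u. ?F a u \<partial>lborel \<partial>lborel)" by simp
  also have "\<dots> = (\<integral>u. \<integral>a. ?F a u \<partial>lborel \<partial>lborel)"
  proof (rule lborel_pair.Fubini_integral[symmetric])
    have "integrable (lborel \<Otimes>\<^sub>M lborel) (\<lambda>(a, u). gauss ?k (a + ?k *\<^sub>R u) * gauss (1 + 1/N) u * (\<lambda>p. h (fst p + ?k *\<^sub>R snd p)) (a, u))"
    proof (rule integrable_gauss_pair)
      fix a b :: 'a
      have "(norm (a + ?k *\<^sub>R b))\<^sup>2 \<le> 2 * norm a ^ 2 + 2 * (norm (?k *\<^sub>R b))\<^sup>2" by (rule norm_add_sq_le)
      also have "(norm (?k *\<^sub>R b))\<^sup>2 \<le> norm b ^ 2"
        using N by (intro power_mono) (auto simp: mult_left_le_one_le field_simps)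
      finally have *: "(norm (a + ?k *\<^sub>R b))\<^sup>2 \<le> 2 * (norm a ^ 2 + norm b ^ 2)" by simp
      have "\<bar>h (a + ?k *\<^sub>R b)\<bar> \<le> A + B * (norm (a + ?k *\<^sub>R b))\<^sup>2" by (rule bound)
      also have "\<dots> \<le> A + \<bar>B\<bar> * (norm (a + ?k *\<^sub>R b))\<^sup>2" by (intro add_left_mono mult_right_mono) auto
      also have "\<dots> \<le> A + \<bar>B\<bar> * (2 * (norm a ^ 2 + norm b ^ 2))" using * by (intro add_left_mono mult_left_mono) auto
      finally show "\<bar>h (fst (a, b) + ?k *\<^sub>R snd (a, b))\<bar> \<le> A + (2 * \<bar>B\<bar>) * (norm a ^ 2 + norm b ^ 2)"
        by (simp add: algebra_simps)
      show "(\<lambda>p. h (fst p + ?k *\<^sub>R snd p)) \<in> borel_measurable borel"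
        unfolding borel_prod[symmetric] by measurable
    qed (use N in \<open>auto simp: add_pos_pos\<close>)
    then show "integrable (lborel \<Otimes>\<^sub>M lborel) (\<lambda>(a, u). ?F a u)" by simp
  qed
  also have "\<dots> = (\<integral>u. gauss (1 + 1/N) u * (\<integral>w. gauss ?k w * h w \<partial>lborel) \<partial>(lborel :: 'a measure))"
  proof (rule Bochner_Integration.integral_cong)
    fix u :: 'a
    have "(\<integral>a. ?F a u \<partial>lborel) = (\<integral>w. ?F (- (?k *\<^sub>R u) + 1 *\<^sub>R w) u \<partial>lborel)"
      by (subst integral_lborel_affine[of 1 _ "- (?k *\<^sub>R u)"]) simp_all
    also have "\<dots> = (\<integral>w. gauss (1 + 1/N) u * (gauss ?k w * h w) \<partial>lborel)"
      by (simp add: mult_ac)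
    finally show "(\<integral>a. ?F a u \<partial>lborel) = gauss (1 + 1/N) u * (\<integral>w. gauss ?k w * h w \<partial>lborel)" by simp
  qed simp
  also have "\<dots> = (\<integral>w. gauss ?k w * h w \<partial>lborel)"
    using N integral_gauss[of "1 + 1/N", where 'a='a] by (simp add: add_pos_pos)
  finally show ?thesis .
qed

lemma abs_ln_gauss_le:
  assumes "s > 0"
  shows "\<bar>ln (gauss s (x::'a::euclidean_space))\<bar> \<le> \<bar>ln ((2 * pi * s) powr (- (real DIM('a) / 2)))\<bar> + (1 / (2 * s)) * norm x ^ 2"
proof -
  have "ln (gauss s x) = ln ((2 * pi * s) powr (- (real DIM('a) / 2))) + - (norm x)\<^sup>2 / (2 * s)"
    unfolding gauss_def using assms by (subst ln_mult_pos) auto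
  moreover have "0 \<le> norm x ^ 2 / (2 * s)" using assms by simp
  ultimately show ?thesis by simp
qed

text \<open>Integrability against every centred Gaussian makes the marginal densities finite. The
  lower bound \<open>c\<close> on a ball about \<open>M\<close> makes them positive and controls
  their logarithms from below. Smoothness enters only in \<open>c2_gauss_prior\<close>.\<close>

locale gauss_prior =
  fixes q :: "'a::euclidean_space \<Rightarrow> real" and M :: 'a and r c :: real
  assumes measurable_prior [measurable]: "q \<in> borel_measurable borel"
    and prior_nonneg: "\<And>x. 0 \<le> q x"
    and integrable_prior: "\<And>a. a > 0 \<Longrightarrow> integrable lborel (\<lambda>x. exp (- a * norm x ^ 2) * q x)"
    and r: "r > 0" and c: "c > 0"
    and prior_ge: "\<And>x. x \<in> cball M r \<Longrightarrow> c \<le> q x"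
begin

definition marg :: "real \<Rightarrow> 'a \<Rightarrow> real" where
  "marg s y = (\<integral>x. gauss s (y - x) * q x \<partial>lborel)"

lemma measurable_marg [measurable]: "marg s \<in> borel_measurable borel"
  unfolding marg_def by measurable

lemma gauss_shift_le:
  assumes "s > 0"
  shows "gauss s (y - x) \<le> (2 * pi * s) powr (- (real DIM('a) / 2)) * exp (norm y ^ 2 / (2 * s)) * exp (- (1 / (4 * s)) * (norm (x::'a))\<^sup>2)"
proof -
  have "norm x ^ 2 \<le> 2 * (norm (x - y))\<^sup>2 + 2 * norm y ^ 2" using norm_add_sq_le[of "x - y" y] by simp
  then have "- (norm (y - x))\<^sup>2 / (2 * s) \<le> norm y ^ 2 / (2 * s) + - (1 / (4 * s)) * norm x ^ 2"
    using assms by (simp add: norm_minus_commute field_simps)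
  then have "exp (- (norm (y - x))\<^sup>2 / (2 * s)) \<le> exp (norm y ^ 2 / (2 * s)) * exp (- (1 / (4 * s)) * norm x ^ 2)"
    unfolding exp_add[symmetric] by simp
  then show ?thesis unfolding gauss_def mult.assoc by (intro mult_left_mono) auto
qed

lemma integrable_marg:
  assumes "s > 0"
  shows "integrable lborel (\<lambda>x. gauss s (y - x) * q x)"
proof (rule Bochner_Integration.integrable_bound)
  show "integrable lborel (\<lambda>x. (2 * pi * s) powr (- (real DIM('a) / 2)) * exp (norm y ^ 2 / (2 * s)) * (exp (- (1 / (4 * s)) * norm x ^ 2) * q x))"
    by (intro integrable_mult_right integrable_prior) (use assms in auto)
  show "AE x in lborel. norm (gauss s (y - x) * q x) \<le> norm ((2 * pi * s) powr (- (real DIM('a) / 2)) * exp (norm y ^ 2 / (2 * s)) * (exp (- (1 / (4 * s)) * norm x ^ 2) * q x))"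
    using mult_right_mono[OF gauss_shift_le[OF assms] prior_nonneg] prior_nonneg
    by (auto intro!: AE_I2 simp: abs_mult mult.assoc)
qed measurable

text \<open>Only the part of the integral over \<open>cball M r\<close> is kept; there the prior is
  at least \<open>c\<close> and the squared distance to \<open>M + y\<close> is at most
  \<open>2 * r^2 + 2 * norm y ^ 2\<close>.\<close>

lemma marg_lower:
  assumes "s > 0"
  shows "(2 * pi * s) powr (- (real DIM('a) / 2)) * exp (- (r\<^sup>2 + norm y ^ 2) / s) * (c * measure lborel (cball M r)) \<le> marg s (M + y)"
    and "marg s (M + y) > 0"
proof -
  let ?C = "(2 * pi * s) powr (- (real DIM('a) / 2)) * exp (- (r\<^sup>2 + norm y ^ 2) / s) * c"
  have fin: "emeasure lborel (cball M r) < \<infinity>" using emeasure_bounded_finite[OF bounded_cball, of M r] by simp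
  have le: "?C * indicator (cball M r) x \<le> gauss s (M + y - x) * q x" for x
  proof (cases "x \<in> cball M r")
    case True
    have "(norm (M + y - x))\<^sup>2 \<le> 2 * (norm (M - x))\<^sup>2 + 2 * norm y ^ 2"
      using norm_add_sq_le[of "M - x" y] by (simp add: algebra_simps)
    also have "(norm (M - x))\<^sup>2 \<le> r\<^sup>2" using True by (intro power_mono) (auto simp: dist_norm)
    finally have "(norm (M + y - x))\<^sup>2 / (2 * s) \<le> (2 * r\<^sup>2 + 2 * norm y ^ 2) / (2 * s)"
      using assms by (intro divide_right_mono) auto
    moreover have "(2 * r\<^sup>2 + 2 * norm y ^ 2) / (2 * s) = (r\<^sup>2 + norm y ^ 2) / s"
      using mult_divide_mult_cancel_left[of 2 "r\<^sup>2 + norm y ^ 2" s] by (simp add: algebra_simps)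
    ultimately have "- (r\<^sup>2 + norm y ^ 2) / s \<le> - (norm (M + y - x))\<^sup>2 / (2 * s)"
      by (simp only: minus_divide_left[symmetric] neg_le_iff_le)
    then have "(2 * pi * s) powr (- (real DIM('a) / 2)) * exp (- (r\<^sup>2 + norm y ^ 2) / s) \<le> gauss s (M + y - x)"
      unfolding gauss_def by (intro mult_left_mono) auto
    then show ?thesis using prior_ge[OF True] c True by (auto intro!: mult_mono)
  qed (use prior_nonneg in auto)
  have "?C * measure lborel (cball M r) = (\<integral>x. ?C * indicator (cball M r) x \<partial>lborel)"
    using fin by simp
  also have "\<dots> \<le> marg s (M + y)" unfolding marg_def
  proof (rule integral_mono)
    show "integrable lborel (\<lambda>x. ?C * indicator (cball M r) x)"
      using fin by (intro integrable_mult_right integrable_real_indicator) auto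
  qed (use le integrable_marg[OF assms] in auto)
  finally show 1: "(2 * pi * s) powr (- (real DIM('a) / 2)) * exp (- (r\<^sup>2 + norm y ^ 2) / s) * (c * measure lborel (cball M r)) \<le> marg s (M + y)"
    by (simp add: mult_ac)
  have "measure lborel (cball M r) > 0" using content_cball_pos[OF r, of M] by simp
  then show "marg s (M + y) > 0"
    using assms c by (intro less_le_trans[OF _ 1]) auto
qed

lemma marg_pos: "s > 0 \<Longrightarrow> marg s y > 0"
  using marg_lower(2)[of s "y - M"] by simp

text \<open>Quadratic growth in \<open>y\<close> makes every expected logarithm below finite. The
  constant is uniform in \<open>s\<close>, so the loss for small \<open>s\<close> is only a factor
  \<open>1 / s\<close>, which the truncation argument can afford.\<close>

lemma ln_marg_bound:
  obtains C where "C \<ge> 0" "\<And>s y. 0 < s \<Longrightarrow> s \<le> 1 \<Longrightarrow> \<bar>ln (marg s (M + y))\<bar> \<le> C / s + C / s * norm y ^ 2"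
proof -
  define d where "d = real DIM('a) / 2"
  define I where "I = (\<integral>x. exp (- (1/4) * norm x ^ 2) * q x \<partial>lborel)"
  define V where "V = c * measure lborel (cball M r)"
  \<comment> \<open>The summands \<open>d\<close>, \<open>norm M ^ 2\<close> and
    \<open>ln (1 + I)\<close> serve the upper bound, \<open>d * ln (2 * pi)\<close>,
    \<open>r^2\<close> and the modulus of \<open>ln V\<close> the lower one; the leading 1 covers
    the coefficient of \<open>norm y ^ 2\<close>.\<close>
  define C where "C = 1 + d + d * ln (2 * pi) + norm M ^ 2 + ln (1 + I) + r\<^sup>2 + \<bar>ln V\<bar>"
  have I: "I \<ge> 0" unfolding I_def using prior_nonneg by (intro integral_nonneg_AE) auto
  have V: "V > 0" unfolding V_def using content_cball_pos[OF r, of M] c by simp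
  have d: "d \<ge> 0" by (simp add: d_def)
  have lnpi: "ln (2 * pi) \<ge> 0" using pi_gt3 by (intro ln_ge_zero) simp
  have C: "C \<ge> 1" "d + norm M ^ 2 + ln (1 + I) \<le> C" "d * ln (2 * pi) + r\<^sup>2 + \<bar>ln V\<bar> \<le> C"
    unfolding C_def using I d lnpi by auto
  show ?thesis
  proof
    show "C \<ge> 0" using C by simp
    fix s :: real and y :: 'a assume s: "0 < s" "s \<le> 1"
    have ins: "u \<le> u / s" if "u \<ge> 0" for u
      using s that mult_left_mono[of 1 "1/s" u] by simp
    have lnpow: "ln ((2 * pi * s) powr (- d)) = - d * (ln (2 * pi) + ln s)"
      using s by (simp add: ln_powr ln_mult)
    have lns: "ln s \<le> 0" "- ln s \<le> 1 / s"
    proof -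
      show "ln s \<le> 0" using s by simp
      have "ln (1 / s) \<le> 1 / s - 1" using s by (intro ln_le_minus_one) simp
      then show "- ln s \<le> 1 / s" using s by (simp add: ln_div)
    qed
    have "marg s (M + y) \<le> (\<integral>x. (2 * pi * s) powr (- d) * exp ((norm (M + y))\<^sup>2 / (2 * s)) * (exp (- (1 / 4) * norm x ^ 2) * q x) \<partial>lborel)"
      unfolding marg_def
    proof (rule integral_mono)
      fix x :: 'a
      have "norm x ^ 2 * s \<le> norm x ^ 2" using s by (simp add: mult_right_le_one_le)
      then have "- (1 / (4 * s)) * norm x ^ 2 \<le> - (1 / 4) * norm x ^ 2" using s by (simp add: field_simps)
      then have "(2 * pi * s) powr (- d) * exp ((norm (M + y))\<^sup>2 / (2 * s)) * exp (- (1 / (4 * s)) * norm x ^ 2)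
         \<le> (2 * pi * s) powr (- d) * exp ((norm (M + y))\<^sup>2 / (2 * s)) * exp (- (1 / 4) * norm x ^ 2)"
        by (intro mult_left_mono) auto
      from order_trans[OF gauss_shift_le[OF s(1), of "M + y" x, folded d_def] this]
      show "gauss s (M + y - x) * q x \<le> (2 * pi * s) powr (- d) * exp ((norm (M + y))\<^sup>2 / (2 * s)) * (exp (- (1 / 4) * norm x ^ 2) * q x)"
        unfolding mult.assoc[symmetric] by (intro mult_right_mono prior_nonneg) (simp add: mult.assoc)
    qed (use integrable_marg s in \<open>auto intro!: integrable_mult_right integrable_prior[of "1/4", simplified]\<close>)
    also have "\<dots> = (2 * pi * s) powr (- d) * exp ((norm (M + y))\<^sup>2 / (2 * s)) * I"
      by (simp add: I_def)
    \<comment> \<open>With \<open>1 + I\<close> in place of \<open>I\<close> the logarithm is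
      nonnegative, so dividing it by \<open>s \<le> 1\<close> only enlarges it.\<close>
    also have "\<dots> \<le> (2 * pi * s) powr (- d) * exp ((norm (M + y))\<^sup>2 / (2 * s)) * (1 + I)"
      by (intro mult_left_mono) auto
    finally have "ln (marg s (M + y)) \<le> ln ((2 * pi * s) powr (- d) * exp ((norm (M + y))\<^sup>2 / (2 * s)) * (1 + I))"
      using marg_pos[OF s(1)] by (subst ln_le_cancel_iff) (use s I in auto)
    also have "\<dots> = - d * (ln (2 * pi) + ln s) + (norm (M + y))\<^sup>2 / (2 * s) + ln (1 + I)"
      using s I by (simp add: ln_mult_pos lnpow)
    also have "\<dots> \<le> d / s + (norm M ^ 2 + norm y ^ 2) / s + ln (1 + I) / s"
    proof (intro add_mono)
      have "d * (- ln s) \<le> d * (1 / s)" using lns d by (intro mult_left_mono) auto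
      moreover have "0 \<le> d * ln (2 * pi)" using d lnpi by simp
      ultimately show "- d * (ln (2 * pi) + ln s) \<le> d / s" by (simp add: algebra_simps)
      show "(norm (M + y))\<^sup>2 / (2 * s) \<le> (norm M ^ 2 + norm y ^ 2) / s"
        using norm_add_sq_le[of M y] s by (simp add: field_simps)
      show "ln (1 + I) \<le> ln (1 + I) / s" using I by (intro ins) auto
    qed
    also have "\<dots> = (d + norm M ^ 2 + ln (1 + I)) / s + 1 / s * norm y ^ 2"
      by (simp add: add_divide_distrib)
    also have "\<dots> \<le> C / s + C / s * norm y ^ 2"
      using C s by (intro add_mono mult_right_mono divide_right_mono) auto
    finally have up: "ln (marg s (M + y)) \<le> C / s + C / s * norm y ^ 2" .
    have "- (C / s + C / s * norm y ^ 2) \<le> - ((d * ln (2 * pi) + r\<^sup>2 + \<bar>ln V\<bar>) / s + 1 / s * norm y ^ 2)"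
      using C s by (simp only: neg_le_iff_le) (intro add_mono mult_right_mono divide_right_mono; auto)
    also have "\<dots> = - (d * ln (2 * pi)) / s + - (r\<^sup>2 + norm y ^ 2) / s + - \<bar>ln V\<bar> / s"
      by (simp add: add_divide_distrib diff_divide_distrib)
    also have "\<dots> \<le> - d * (ln (2 * pi) + ln s) + - (r\<^sup>2 + norm y ^ 2) / s + ln V"
    proof (intro add_mono order_refl)
      have "0 \<le> - (d * ln s)" using d lns by (simp add: mult_nonneg_nonpos)
      moreover have "d * ln (2 * pi) \<le> (d * ln (2 * pi)) / s" using d lnpi by (intro ins) simp
      ultimately show "- (d * ln (2 * pi)) / s \<le> - d * (ln (2 * pi) + ln s)" by (simp add: algebra_simps)
      have "\<bar>ln V\<bar> \<le> \<bar>ln V\<bar> / s" by (intro ins) auto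
      then show "- \<bar>ln V\<bar> / s \<le> ln V" by simp
    qed
    also have "\<dots> = ln ((2 * pi * s) powr (- d) * exp (- (r\<^sup>2 + norm y ^ 2) / s) * V)"
      using s V by (simp add: ln_mult_pos lnpow)
    also have "\<dots> \<le> ln (marg s (M + y))"
      using marg_lower(1)[OF s(1), of y] marg_pos[OF s(1), of "M + y"] s V
      by (subst ln_le_cancel_iff) (auto simp: d_def V_def)
    finally show "\<bar>ln (marg s (M + y))\<bar> \<le> C / s + C / s * norm y ^ 2" using up by (simp add: abs_le_iff)
  qed
qed

definition elog_marg :: "real \<Rightarrow> real" where
  "elog_marg s = (\<integral>y. gauss s y * ln (marg s (M + y)) \<partial>lborel)"

definition pred :: "real \<Rightarrow> 'a \<Rightarrow> 'a \<Rightarrow> real" where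
  "pred N y z = (\<integral>x. gauss 1 (z - x) * (gauss (1/N) (y - x) * q x) \<partial>lborel) / (\<integral>x. gauss (1/N) (y - x) * q x \<partial>lborel)"

lemma pred_eq:
  assumes "N > 0"
  shows "pred N y z = gauss (1 + 1/N) (z - y) * marg (1/(N+1)) ((1/(N+1)) *\<^sub>R (N *\<^sub>R y + z)) / marg (1/N) y"
proof -
  let ?k = "1/(N+1)"
  have "gauss 1 (z - x) * (gauss (1/N) (y - x) * q x)
      = gauss (1 + 1/N) (z - y) * (gauss ?k (?k *\<^sub>R (N *\<^sub>R y + z) - x) * q x)" for x
  proof -
    have "?k *\<^sub>R (N *\<^sub>R (y - x) + (z - x)) = ?k *\<^sub>R (N *\<^sub>R y + z) - x"
      using weighted_mean_add[OF assms, of y "- x" z] by simp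
    then show ?thesis using gauss_product[OF assms, of "y - x" "z - x"] by (simp add: mult_ac)
  qed
  then show ?thesis unfolding pred_def marg_def by (simp only: integral_mult_right_zero)
qed

end

text \<open>This is the risk of the uniform prior, whose predictive density is Gaussian with
  variance \<open>1 + 1/N\<close> about \<open>y\<close>. It stands outside the locale and takes
  only the type of the space, so that two priors share literally the same term and it cancels in the
  difference of their risks.\<close>

definition base_risk :: "'a::euclidean_space itself \<Rightarrow> real \<Rightarrow> real" where
  "base_risk _ N = (\<integral>a. \<integral>b. gauss (1/N) (a::'a) * gauss 1 b * (ln (gauss 1 b) - ln (gauss (1 + 1/N) (b - a))) \<partial>lborel \<partial>lborel)"

context gauss_prior
begin

lemma risk_eq:
  assumes N: "N \<ge> 1"
  shows "(\<integral>y. gauss (1/N) (y - M) * (\<integral>z. gauss 1 (z - M) * ln (gauss 1 (z - M) / pred N y z) \<partial>lborel) \<partial>lborel)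
    = base_risk TYPE('a) N + elog_marg (1/N) - elog_marg (1/(N+1))"
proof -
  let ?k = "1/(N+1)"
  \<comment> \<open>The logarithm of the density ratio splits as \<open>f1 - f2 + f3\<close>. Each
    piece is shown integrable for the joint law, so that the iterated integral can be split as
    well.\<close>
  define f1 where "f1 p = ln (gauss 1 (snd p)) - ln (gauss (1 + 1/N) (snd p - fst p))" for p :: "'a \<times> 'a"
  define f2 where "f2 p = ln (marg ?k (M + ?k *\<^sub>R (N *\<^sub>R fst p + snd p)))" for p :: "'a \<times> 'a"
  define f3 where "f3 p = ln (marg (1/N) (M + fst p))" for p :: "'a \<times> 'a"
  obtain C where C: "C \<ge> 0" "\<And>s y. 0 < s \<Longrightarrow> s \<le> 1 \<Longrightarrow> \<bar>ln (marg s (M + y))\<bar> \<le> C / s + C / s * norm y ^ 2"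
    using ln_marg_bound by blast
  \<comment> \<open>The assumption \<open>N \<ge> 1\<close> puts both variances \<open>1/N\<close>
    and \<open>1/(N+1)\<close> into the range of the bound on
    \<open>ln (marg s (M + y))\<close>.\<close>
  have N0: "0 < 1/N" "1/N \<le> 1" "0 < ?k" "?k \<le> 1" "0 < 1 + 1/N" "N > 0" "N \<ge> 0" using N by (auto simp: add_pos_pos)
  have [measurable]: "f1 \<in> borel_measurable borel" "f2 \<in> borel_measurable borel" "f3 \<in> borel_measurable borel"
    unfolding f1_def f2_def f3_def borel_prod[symmetric] by measurable
  let ?g = "\<lambda>f (a, b). gauss (1/N) a * gauss 1 b * f (a, b)"
  have I3: "integrable (lborel \<Otimes>\<^sub>M lborel) (?g f3)"
  proof -
    have "\<bar>f3 (a, b)\<bar> \<le> C * N + (C * N) * (norm a ^ 2 + norm b ^ 2)" for a b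
    proof -
      have "\<bar>f3 (a, b)\<bar> \<le> C * N + (C * N) * norm a ^ 2" using C(2)[OF N0(1,2), of a] by (simp add: f3_def)
      also have "\<dots> \<le> C * N + (C * N) * (norm a ^ 2 + norm b ^ 2)"
        using C(1) N by (intro add_left_mono mult_left_mono) auto
      finally show ?thesis .
    qed
    from integrable_gauss_pair[OF N0(1), of 1, OF _ _ this, of 0] show ?thesis by simp
  qed
  have I2: "integrable (lborel \<Otimes>\<^sub>M lborel) (?g f2)"
  proof -
    have "\<bar>f2 (a, b)\<bar> \<le> C * (N+1) + (C * (N+1) * 2) * (norm a ^ 2 + norm b ^ 2)" for a b
    proof -
      let ?w = "?k *\<^sub>R (N *\<^sub>R a + b)"
      have "(norm ?w)\<^sup>2 \<le> 2 * (norm ((?k * N) *\<^sub>R a))\<^sup>2 + 2 * (norm (?k *\<^sub>R b))\<^sup>2"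
        using norm_add_sq_le[of "(?k * N) *\<^sub>R a" "?k *\<^sub>R b"] by (simp add: algebra_simps)
      also have "\<dots> \<le> 2 * norm a ^ 2 + 2 * norm b ^ 2"
        using N by (intro add_mono mult_left_mono power_mono) (auto simp: mult_left_le_one_le field_simps)
      finally have w: "(norm ?w)\<^sup>2 \<le> 2 * (norm a ^ 2 + norm b ^ 2)" by simp
      have "\<bar>f2 (a, b)\<bar> \<le> C * (N+1) + (C * (N+1)) * (norm ?w)\<^sup>2" using C(2)[OF N0(3,4), of ?w] by (simp add: f2_def)
      also have "\<dots> \<le> C * (N+1) + (C * (N+1)) * (2 * (norm a ^ 2 + norm b ^ 2))"
        using C(1) N by (intro add_left_mono mult_left_mono w) auto
      finally show ?thesis by (simp only: mult.assoc)
    qed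
    from integrable_gauss_pair[OF N0(1), of 1, OF _ _ this, of 0] show ?thesis by simp
  qed
  have I1: "integrable (lborel \<Otimes>\<^sub>M lborel) (?g f1)"
  proof -
    let ?A1 = "\<bar>ln ((2 * pi * 1) powr (- (real DIM('a) / 2)))\<bar>"
    let ?A2 = "\<bar>ln ((2 * pi * (1 + 1/N)) powr (- (real DIM('a) / 2)))\<bar>"
    have "\<bar>f1 (a, b)\<bar> \<le> (?A1 + ?A2) + 2 * (norm a ^ 2 + norm b ^ 2)" for a b
    proof -
      have "1 / (2 * (1 + 1/N)) \<le> 1/2" using N by (simp add: field_simps)
      then have "1 / (2 * (1 + 1/N)) * (norm (b - a))\<^sup>2 \<le> 1/2 * (norm (b - a))\<^sup>2" by (rule mult_right_mono) simp
      moreover have "(norm (b - a))\<^sup>2 \<le> 2 * norm b ^ 2 + 2 * norm a ^ 2" using norm_add_sq_le[of b "- a"] by simp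
      moreover have "\<bar>f1 (a, b)\<bar> \<le> \<bar>ln (gauss 1 b)\<bar> + \<bar>ln (gauss (1 + 1/N) (b - a))\<bar>" by (simp add: f1_def)
      ultimately show ?thesis using abs_ln_gauss_le[of 1 b] abs_ln_gauss_le[OF N0(5), of "b - a"] zero_le_power2[of "norm a"] zero_le_power2[of "norm b"]
        by argo
    qed
    from integrable_gauss_pair[OF N0(1), of 1, OF _ _ this, of 0] show ?thesis by simp
  qed
  have I: "integrable (lborel \<Otimes>\<^sub>M lborel) (\<lambda>p. ?g f1 p - ?g f2 p + ?g f3 p)"
    using I1 I2 I3 by (intro Bochner_Integration.integrable_add Bochner_Integration.integrable_diff)
  have iter: "(\<integral>a. \<integral>b. f (a, b) \<partial>lborel \<partial>lborel) = integral\<^sup>L (lborel \<Otimes>\<^sub>M lborel) f"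
    if "integrable (lborel \<Otimes>\<^sub>M lborel) f" for f :: "'a \<times> 'a \<Rightarrow> real"
    using lborel_pair.integral_fst'[OF that] .
  have eq: "gauss (1/N) a * (gauss 1 b * ln (gauss 1 b / pred N (M + a) (M + b)))
      = ?g f1 (a, b) - ?g f2 (a, b) + ?g f3 (a, b)" for a b
  proof -
    have w: "?k *\<^sub>R (N *\<^sub>R (M + a) + (M + b)) = M + ?k *\<^sub>R (N *\<^sub>R a + b)"
      using weighted_mean_add[OF N0(6), of a M b] by (simp add: add.commute)
    have "ln (gauss 1 b / pred N (M + a) (M + b)) = f1 (a, b) - f2 (a, b) + f3 (a, b)"
      unfolding pred_eq[OF N0(6)] w f1_def f2_def f3_def
      using gauss_pos[OF N0(5), of "b - a"] gauss_pos[of 1 b] marg_pos[OF N0(1), of "M + a"] marg_pos[OF N0(3), of "M + ?k *\<^sub>R (N *\<^sub>R a + b)"]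
      by (simp add: ln_div ln_mult_pos)
    then show ?thesis by (simp only: prod.case) (simp add: algebra_simps)
  qed
  have "(\<integral>y. gauss (1/N) (y - M) * (\<integral>z. gauss 1 (z - M) * ln (gauss 1 (z - M) / pred N y z) \<partial>lborel) \<partial>lborel)
      = (\<integral>a. gauss (1/N) a * (\<integral>b. gauss 1 b * ln (gauss 1 b / pred N (M + a) (M + b)) \<partial>lborel) \<partial>lborel)"
    apply (subst integral_lborel_affine[of 1 _ M], simp)
    apply (subst (2) integral_lborel_affine[of 1 _ M], simp)
    apply simp
    done
  also have "\<dots> = (\<integral>a. \<integral>b. ?g f1 (a, b) - ?g f2 (a, b) + ?g f3 (a, b) \<partial>lborel \<partial>lborel)"
    by (subst integral_mult_right_zero[symmetric]) (simp only: eq)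
  also have "\<dots> = integral\<^sup>L (lborel \<Otimes>\<^sub>M lborel) (?g f1) - integral\<^sup>L (lborel \<Otimes>\<^sub>M lborel) (?g f2) + integral\<^sup>L (lborel \<Otimes>\<^sub>M lborel) (?g f3)"
    unfolding iter[OF I]
    by (simp only: Bochner_Integration.integral_add[OF Bochner_Integration.integrable_diff[OF I1 I2] I3]
        Bochner_Integration.integral_diff[OF I1 I2])
  also have "integral\<^sup>L (lborel \<Otimes>\<^sub>M lborel) (?g f1) = base_risk TYPE('a) N"
    unfolding iter[OF I1, symmetric] base_risk_def by (simp add: f1_def)
  \<comment> \<open>The function \<open>f2\<close> sees the pair only through its weighted mean, so
    the mixture lemma reduces it to a single Gaussian of variance \<open>1/(N+1)\<close>.\<close>
  also have "integral\<^sup>L (lborel \<Otimes>\<^sub>M lborel) (?g f2) = elog_marg ?k"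
    unfolding iter[OF I2, symmetric] elog_marg_def
    using integral_gauss_mixture[OF N0(6), of "\<lambda>w. ln (marg ?k (M + w))" "C * (N+1)" "C * (N+1)"] C(2)[OF N0(3,4)]
    by (simp add: f2_def)
  also have "integral\<^sup>L (lborel \<Otimes>\<^sub>M lborel) (?g f3) = elog_marg (1/N)"
    unfolding iter[OF I3, symmetric] elog_marg_def
    using integral_gauss[of 1, where 'a='a] by (simp add: f3_def mult.assoc mult.left_commute[of _ "gauss 1 _"])
  finally show ?thesis by simp
qed

end

section \<open>Second-order behaviour of the expected log marginal\<close>

text \<open>The truncation region is a box because the Leibniz rule for parameter integrals is
  applied on boxes, and it is symmetric about 0 so that odd integrands vanish.\<close>

definition cube :: "real \<Rightarrow> 'a::euclidean_space set" where
  "cube R = cbox (- (R *\<^sub>R One)) (R *\<^sub>R One)"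

lemma mem_cube: "z \<in> cube R \<longleftrightarrow> (\<forall>b\<in>Basis. \<bar>z \<bullet> b\<bar> \<le> R)"
  by (auto simp: cube_def mem_box abs_le_iff)

lemma norm_le_of_mem_cube:
  assumes "z \<in> cube R"
  shows "norm (z::'a::euclidean_space) \<le> real DIM('a) * R"
proof -
  have "norm z \<le> (\<Sum>b\<in>Basis. \<bar>z \<bullet> b\<bar>)" by (rule norm_le_l1)
  also have "\<dots> \<le> (\<Sum>b\<in>(Basis::'a set). R)" using assms by (intro sum_mono) (auto simp: mem_cube)
  finally show ?thesis by simp
qed

lemma norm_gt_of_not_mem_cube: "z \<notin> cube R \<Longrightarrow> R < norm (z::'a::euclidean_space)"
  using Basis_le_norm by (force simp: mem_cube not_le intro: less_le_trans)

lemma measurable_cube [measurable]: "cube R \<in> sets borel"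
  by (simp add: cube_def)

lemma compact_cube: "compact (cube R)"
  by (simp add: cube_def)

lemma eventually_mem_cube:
  assumes "filterlim R at_top F"
  shows "eventually (\<lambda>n. z \<in> cube (R n)) F"
proof -
  have "eventually (\<lambda>n. norm z \<le> R n) F" using assms by (simp add: filterlim_at_top)
  then show ?thesis
    by eventually_elim (use norm_gt_of_not_mem_cube in fastforce)
qed

text \<open>A bridge between two integrals: differentiation in the parameter uses the gauge integral
  over a box, domination and limits use the Lebesgue integral.\<close>

lemma integral_cube_eq_lebesgue:
  fixes f :: "'a::euclidean_space \<Rightarrow> real"
  assumes "continuous_on (cube R) f"
  shows "integrable lborel (\<lambda>x. indicator (cube R) x * f x)"
    and "integral (cube R) f = (\<integral>x. indicator (cube R) x * f x \<partial>lborel)"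
proof -
  show "integrable lborel (\<lambda>x. indicator (cube R) x * f x)"
    using borel_integrable_compact[OF compact_cube assms] by simp
  then have "set_integrable lborel (cube R) f" by (simp add: set_integrable_def)
  from set_borel_integral_eq_integral(2)[OF this]
  show "integral (cube R) f = (\<integral>x. indicator (cube R) x * f x \<partial>lborel)"
    by (simp add: set_lebesgue_integral_def)
qed

lemma integral_cube_odd:
  fixes f :: "'a::euclidean_space \<Rightarrow> real"
  assumes "\<And>x. f (- x) = - f x"
  shows "integral (cube R) f = 0"
proof -
  have "integral (cube R) (\<lambda>x. f (- x)) = integral (cube R) f"
    using integral_reflect[of "R *\<^sub>R One" "- (R *\<^sub>R One)" f] by (simp add: cube_def)
  then show ?thesis using assms by simp
qed

lemma integrable_gauss_one_plus_norm:
  assumes "i \<le> 2"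
  shows "integrable lborel (\<lambda>z::'a::euclidean_space. gauss 1 z * (1 + norm z) ^ i)"
proof (rule integrable_gauss_quadratic_bound)
  fix z :: 'a
  have "(1 + norm z) ^ i \<le> (1 + norm z) ^ 2" using assms by (intro power_increasing) auto
  also have "\<dots> \<le> 2 + 2 * norm z ^ 2"
    using zero_le_power2[of "1 - norm z"] by (simp add: power2_eq_square algebra_simps)
  finally show "\<bar>(1 + norm z) ^ i\<bar> \<le> 2 + 2 * norm z ^ 2" by simp
qed auto

text \<open>The weight \<open>1 + norm z\<close> is submultiplicative, which separates
  \<open>z\<close> from \<open>z'\<close> in growth bounds on functions of
  \<open>z + z'\<close>.\<close>

lemma one_plus_norm_add: "1 + norm (z + z') \<le> (1 + norm z) * (1 + norm (z'::'a::real_normed_vector))"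
proof -
  have "0 \<le> norm z * norm z'" by simp
  moreover have "(1 + norm z) * (1 + norm z') = 1 + norm z + norm z' + norm z * norm z'" by (simp add: algebra_simps)
  ultimately show ?thesis using norm_triangle_ineq[of z z'] by linarith
qed

text \<open>Twice continuous differentiability near \<open>M\<close>, with the gradient as a vector
  field \<open>g\<close> and the Hessian as an operator \<open>H x\<close>. Continuity of the
  Hessian is required for each fixed vector; \<open>H_expand\<close> turns this into joint
  continuity.\<close>

locale c2_gauss_prior = gauss_prior q M r c
  for q :: "'a::euclidean_space \<Rightarrow> real" and M r c +
  fixes g :: "'a \<Rightarrow> 'a" and H :: "'a \<Rightarrow> 'a \<Rightarrow> 'a"
  assumes grad: "\<And>x. x \<in> cball M r \<Longrightarrow> (q has_derivative (\<lambda>h. g x \<bullet> h)) (at x)"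
    and hess: "\<And>x. x \<in> cball M r \<Longrightarrow> (g has_derivative H x) (at x)"
    and cont_hess: "\<And>v. continuous_on (cball M r) (\<lambda>x. H x v)"
begin

text \<open>\<open>p1\<close> and \<open>p2\<close> are the first and second derivatives of
  \<open>p0\<close> in \<open>t\<close>, along the line through \<open>M\<close> in direction
  \<open>v\<close>.\<close>

definition p0 :: "real \<Rightarrow> 'a \<Rightarrow> real" where "p0 t v = q (M + t *\<^sub>R v)"
definition p1 :: "real \<Rightarrow> 'a \<Rightarrow> real" where "p1 t v = g (M + t *\<^sub>R v) \<bullet> v"
definition p2 :: "real \<Rightarrow> 'a \<Rightarrow> real" where "p2 t v = H (M + t *\<^sub>R v) v \<bullet> v"

text \<open>Negative \<open>t\<close> is included so that 0 is an interior point of the interval in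
  which \<open>t\<close> varies.\<close>

definition line_dom :: "(real \<times> 'a) set" where "line_dom = {(t, v). \<bar>t\<bar> * norm v \<le> r}"

text \<open>For \<open>p0\<close> this is the truncated form of
  \<open>marg (t^2) (M + t *\<^sub>R z)\<close> after rescaling the integration variable. The
  parameter \<open>p\<close> lets the derivatives \<open>p1\<close> and \<open>p2\<close> share the
  same lemmas.\<close>

definition tmarg :: "(real \<Rightarrow> 'a \<Rightarrow> real) \<Rightarrow> real \<Rightarrow> real \<Rightarrow> 'a \<Rightarrow> real" where
  "tmarg p R t z = integral (cube R) (\<lambda>z'. gauss 1 z' * p t (z + z'))"

lemma line_dom_mem: "(t, v) \<in> line_dom \<Longrightarrow> M + t *\<^sub>R v \<in> cball M r"
  by (simp add: line_dom_def dist_norm)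

lemma bounded_linear_H: "x \<in> cball M r \<Longrightarrow> bounded_linear (H x)"
  using hess has_derivative_bounded_linear by blast

lemma H_expand:
  assumes "x \<in> cball M r"
  shows "H x v = (\<Sum>b\<in>Basis. (v \<bullet> b) *\<^sub>R H x b)"
proof -
  interpret bounded_linear "H x" by (rule bounded_linear_H[OF assms])
  have "H x v = H x (\<Sum>b\<in>Basis. (v \<bullet> b) *\<^sub>R b)" by (simp add: euclidean_representation)
  then show ?thesis by (simp add: sum scaleR)
qed

lemma cont_q: "continuous_on (cball M r) q"
  by (rule continuous_at_imp_continuous_on) (use grad has_derivative_continuous in blast)

lemma cont_g: "continuous_on (cball M r) g"
  by (rule continuous_at_imp_continuous_on) (use hess has_derivative_continuous in blast)

lemma cont_path: "continuous_on line_dom (\<lambda>(t, v). M + t *\<^sub>R v)"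
  unfolding case_prod_unfold by (intro continuous_intros)

lemma cont_p0: "continuous_on line_dom (\<lambda>(t, v). p0 t v)"
proof -
  have "continuous_on line_dom (\<lambda>x. q (case x of (t, v) \<Rightarrow> M + t *\<^sub>R v))"
    by (rule continuous_on_compose2[OF cont_q cont_path]) (auto simp: line_dom_mem simp del: mem_cball)
  then show ?thesis by (simp add: p0_def case_prod_unfold)
qed

lemma cont_p1: "continuous_on line_dom (\<lambda>(t, v). p1 t v)"
proof -
  have "continuous_on line_dom (\<lambda>x. g (case x of (t, v) \<Rightarrow> M + t *\<^sub>R v))"
    by (rule continuous_on_compose2[OF cont_g cont_path]) (auto simp: line_dom_mem simp del: mem_cball)
  then show ?thesis unfolding p1_def case_prod_unfold by (intro continuous_intros)
qed

lemma cont_p2: "continuous_on line_dom (\<lambda>(t, v). p2 t v)"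
proof -
  have "continuous_on line_dom (\<lambda>x. H (case x of (t, v) \<Rightarrow> M + t *\<^sub>R v) b)" for b
    by (rule continuous_on_compose2[OF cont_hess cont_path]) (auto simp: line_dom_mem simp del: mem_cball)
  then have "continuous_on line_dom (\<lambda>x. (\<Sum>b\<in>Basis. (snd x \<bullet> b) *\<^sub>R H (case x of (t, v) \<Rightarrow> M + t *\<^sub>R v) b) \<bullet> snd x)"
    by (intro continuous_intros)
  also have "?this \<longleftrightarrow> ?thesis"
    by (intro continuous_on_cong) (auto simp: p2_def H_expand[OF line_dom_mem])
  finally show ?thesis .
qed

lemma deriv_p0:
  assumes "(t, v) \<in> line_dom"
  shows "((\<lambda>t. p0 t v) has_field_derivative p1 t v) (at t within U)"
proof -
  have "((\<lambda>t. M + t *\<^sub>R v) has_derivative (\<lambda>h. h *\<^sub>R v)) (at t within U)"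
    by (auto intro!: derivative_eq_intros)
  from has_derivative_compose[OF this grad[OF line_dom_mem[OF assms]]]
  show ?thesis unfolding p0_def p1_def has_field_derivative_def
    by (simp add: mult.commute) (metis mult_commute_abs)
qed

lemma deriv_p1:
  assumes "(t, v) \<in> line_dom"
  shows "((\<lambda>t. p1 t v) has_field_derivative p2 t v) (at t within U)"
proof -
  interpret bounded_linear "H (M + t *\<^sub>R v)" by (rule bounded_linear_H[OF line_dom_mem[OF assms]])
  have "((\<lambda>t. M + t *\<^sub>R v) has_derivative (\<lambda>h. h *\<^sub>R v)) (at t within U)"
    by (auto intro!: derivative_eq_intros)
  from has_derivative_inner_left[OF has_derivative_compose[OF this hess[OF line_dom_mem[OF assms]]], of v]
  have "((\<lambda>t. p1 t v) has_derivative (\<lambda>h. h * p2 t v)) (at t within U)"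
    unfolding p1_def p2_def by (simp add: scaleR)
  then show ?thesis unfolding has_field_derivative_def by (simp add: mult_commute_abs)
qed

text \<open>Compactness of the ball bounds the prior, its gradient and its Hessian; each derivative
  in \<open>t\<close> brings out one factor \<open>v\<close>. All bounds are written as powers,
  including exponents 0 and 1, to fit the common hypothesis of the lemmas on
  \<open>tmarg\<close>.\<close>

lemma p_bounds:
  obtains K where "K > 0"
    "\<And>t v. (t, v) \<in> line_dom \<Longrightarrow> \<bar>p0 t v\<bar> \<le> K * (1 + norm v) ^ 0"
    "\<And>t v. (t, v) \<in> line_dom \<Longrightarrow> \<bar>p1 t v\<bar> \<le> K * (1 + norm v) ^ 1"
    "\<And>t v. (t, v) \<in> line_dom \<Longrightarrow> \<bar>p2 t v\<bar> \<le> K * (1 + norm v) ^ 2"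
proof -
  have bnd: "\<exists>k. \<forall>x\<in>cball M r. norm (f x) \<le> k" if "continuous_on (cball M r) f" for f :: "'a \<Rightarrow> 'b::real_normed_vector"
    using compact_imp_bounded[OF compact_continuous_image[OF that compact_cball]] by (auto simp: bounded_iff)
  obtain k0 where k0: "\<And>x. x \<in> cball M r \<Longrightarrow> norm (q x) \<le> k0" using bnd[OF cont_q] by blast
  obtain k1 where k1: "\<And>x. x \<in> cball M r \<Longrightarrow> norm (g x) \<le> k1" using bnd[OF cont_g] by blast
  have "\<forall>b. \<exists>k. \<forall>x\<in>cball M r. norm (H x b) \<le> k" using bnd[OF cont_hess] by blast
  then obtain k2 where k2: "\<And>x b. x \<in> cball M r \<Longrightarrow> norm (H x b) \<le> k2 b" by metis
  define K where "K = 1 + \<bar>k0\<bar> + \<bar>k1\<bar> + (\<Sum>b\<in>Basis. \<bar>k2 b\<bar>)"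
  have s0: "0 \<le> (\<Sum>b\<in>(Basis::'a set). \<bar>k2 b\<bar>)" by (intro sum_nonneg) auto
  have K: "K > 0" "\<bar>k0\<bar> \<le> K" "\<bar>k1\<bar> \<le> K" "(\<Sum>b\<in>Basis. \<bar>k2 b\<bar>) \<le> K"
    using s0 by (auto simp: K_def simp del: sum_abs_ge_zero intro!: add_pos_nonneg)
  show ?thesis
  proof
    fix t v assume d: "(t, v) \<in> line_dom"
    let ?x = "M + t *\<^sub>R v"
    have x: "?x \<in> cball M r" by (rule line_dom_mem[OF d])
    show "\<bar>p0 t v\<bar> \<le> K * (1 + norm v) ^ 0" using k0[OF x] K by (simp add: p0_def)
    have "\<bar>p1 t v\<bar> \<le> norm (g ?x) * norm v" unfolding p1_def by (rule Cauchy_Schwarz_ineq2)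
    also have "\<dots> \<le> K * (1 + norm v)" using k1[OF x] K by (intro mult_mono) auto
    finally show "\<bar>p1 t v\<bar> \<le> K * (1 + norm v) ^ 1" by simp
    have "norm (H ?x v) \<le> (\<Sum>b\<in>Basis. \<bar>k2 b\<bar> * norm v)"
      unfolding H_expand[OF x, of v]
    proof (rule sum_norm_le)
      fix b :: 'a assume b: "b \<in> Basis"
      have "norm ((v \<bullet> b) *\<^sub>R H ?x b) = \<bar>v \<bullet> b\<bar> * norm (H ?x b)" by simp
      also have "\<dots> \<le> norm v * \<bar>k2 b\<bar>" using k2[OF x, of b] Basis_le_norm[OF b, of v] by (intro mult_mono) auto
      finally show "norm ((v \<bullet> b) *\<^sub>R H ?x b) \<le> \<bar>k2 b\<bar> * norm v" by (simp add: mult.commute)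
    qed
    also have "\<dots> \<le> K * norm v" using K by (simp add: sum_distrib_right[symmetric] mult_right_mono)
    finally have "norm (H ?x v) \<le> K * norm v" .
    then have "norm (H ?x v) * norm v \<le> K * (1 + norm v) * (1 + norm v)"
      using K by (intro mult_mono) (auto intro: order_trans mult_left_mono)
    moreover have "\<bar>p2 t v\<bar> \<le> norm (H ?x v) * norm v" unfolding p2_def by (rule Cauchy_Schwarz_ineq2)
    ultimately show "\<bar>p2 t v\<bar> \<le> K * (1 + norm v) ^ 2" by (simp add: power2_eq_square mult.assoc)
  qed (use K in auto)
qed

text \<open>A point of \<open>cube R\<close> has norm at most \<open>DIM('a) * R\<close>; the factor
  2 accounts for the two summands \<open>z\<close> and \<open>z'\<close>.\<close>

lemma cube_line_dom:
  assumes "2 * T * real DIM('a) * R \<le> r" "\<bar>t\<bar> \<le> T" "z \<in> cube R" "z' \<in> cube R"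
  shows "(t, z + z') \<in> line_dom"
proof -
  have "norm (z + z') \<le> 2 * real DIM('a) * R"
    using norm_triangle_ineq[of z z'] norm_le_of_mem_cube[OF assms(3)] norm_le_of_mem_cube[OF assms(4)] by simp
  then have "\<bar>t\<bar> * norm (z + z') \<le> T * (2 * real DIM('a) * R)"
    using assms(2) by (intro mult_mono) auto
  then show ?thesis using assms(1) by (simp add: line_dom_def mult_ac)
qed

lemma cont_tmarg:
  assumes p: "continuous_on line_dom (\<lambda>(t, v). p t v)" and T: "2 * T * real DIM('a) * R \<le> r"
  shows "continuous_on ({- T..T} \<times> cube R) (\<lambda>(t, z). tmarg p R t z)"
proof -
  have "continuous_on (({- T..T} \<times> cube R) \<times> cube R) (\<lambda>x. gauss 1 (snd x) * (\<lambda>(t, v). p t v) (fst (fst x), snd (fst x) + snd x))"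
    by (intro continuous_intros continuous_on_compose2[OF p])
       (auto intro!: cube_line_dom[OF T])
  then show ?thesis unfolding tmarg_def cube_def case_prod_unfold
    by (intro integral_continuous_on_param) (simp add: case_prod_unfold)
qed

lemma cont_tmarg_integrand:
  assumes p: "continuous_on line_dom (\<lambda>(t, v). p t v)" and T: "2 * T * real DIM('a) * R \<le> r" "\<bar>t\<bar> \<le> T" "z \<in> cube R"
  shows "continuous_on (cube R) (\<lambda>z'. gauss 1 z' * p t (z + z'))"
proof -
  have "continuous_on (cube R) (\<lambda>z'. (\<lambda>(t, v). p t v) (t, z + z'))"
    by (rule continuous_on_compose2[OF p]) (auto intro!: continuous_intros cube_line_dom[OF T])
  then show ?thesis by (intro continuous_intros) simp
qed

lemma cont_tmarg_slice:
  assumes p: "continuous_on line_dom (\<lambda>(t, v). p t v)" and T: "2 * T * real DIM('a) * R \<le> r" "\<bar>t\<bar> \<le> T"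
  shows "continuous_on (cube R) (tmarg p R t)"
proof -
  have "continuous_on (cube R) (\<lambda>z. (\<lambda>(t, z). tmarg p R t z) (t, z))"
    by (rule continuous_on_compose2[OF cont_tmarg[OF p T(1)]]) (use T in \<open>auto intro!: continuous_intros\<close>)
  then show ?thesis by simp
qed

lemma deriv_tmarg:
  assumes p: "continuous_on line_dom (\<lambda>(t, v). p t v)" and p': "continuous_on line_dom (\<lambda>(t, v). p' t v)"
    and d: "\<And>t v U. (t, v) \<in> line_dom \<Longrightarrow> ((\<lambda>t. p t v) has_field_derivative p' t v) (at t within U)"
    and T: "2 * T * real DIM('a) * R \<le> r" "t \<in> {- T..T}" "z \<in> cube R"
  shows "((\<lambda>t. tmarg p R t z) has_field_derivative tmarg p' R t z) (at t within {- T..T})"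
  unfolding tmarg_def cube_def
proof (rule leibniz_rule_field_derivative)
  fix u z' assume u: "u \<in> {- T..T}" and z': "z' \<in> cbox (- (R *\<^sub>R One)) (R *\<^sub>R One :: 'a)"
  have "(u, z + z') \<in> line_dom" using u z' T by (intro cube_line_dom[OF T(1)]) (auto simp: cube_def)
  from DERIV_cmult[OF d[OF this]]
  show "((\<lambda>u. gauss 1 z' * p u (z + z')) has_field_derivative gauss 1 z' * p' u (z + z')) (at u within {- T..T})" .
next
  fix u assume "u \<in> {- T..T}"
  then show "(\<lambda>z'. gauss 1 z' * p u (z + z')) integrable_on cbox (- (R *\<^sub>R One)) (R *\<^sub>R One)"
    using cont_tmarg_integrand[OF p T(1) _ T(3), of u] by (intro integrable_continuous) (auto simp: cube_def)
next
  have "continuous_on ({- T..T} \<times> cube R) (\<lambda>x. gauss 1 (snd x) * (\<lambda>(t, v). p' t v) (fst x, z + snd x))"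
    using T by (intro continuous_intros continuous_on_compose2[OF p']) (auto intro!: cube_line_dom[OF T(1)])
  then show "continuous_on ({- T..T} \<times> cbox (- (R *\<^sub>R One)) (R *\<^sub>R One)) (\<lambda>(u, z'). gauss 1 z' * p' u (z + z'))"
    by (simp add: cube_def case_prod_unfold)
qed (use T in auto)

text \<open>Discarding everything outside the unit cube gives a lower bound that depends on none of
  \<open>R\<close>, \<open>t\<close> and \<open>z\<close>. It serves as the uniform denominator in
  the domination arguments.\<close>

lemma tmarg_pos_bound:
  assumes T: "2 * T * real DIM('a) * R \<le> r" "\<bar>t\<bar> \<le> T" "z \<in> cube R" and R: "1 \<le> R"
  shows "c * integral (cube 1) (gauss 1 :: 'a \<Rightarrow> real) \<le> tmarg p0 R t z"
proof -
  have "c * integral (cube 1) (gauss 1 :: 'a \<Rightarrow> real) = integral (cube 1) (\<lambda>z'::'a. c * gauss 1 z')"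
    by simp
  also have "\<dots> \<le> integral (cube R) (\<lambda>z'::'a. c * gauss 1 z')"
  proof (rule integral_subset_le)
    show "cube 1 \<subseteq> (cube R :: 'a set)" using R by (fastforce simp: mem_cube)
  qed (use c in \<open>auto simp: cube_def intro!: integrable_continuous continuous_intros\<close>)
  also have "\<dots> \<le> tmarg p0 R t z" unfolding tmarg_def
  proof (rule integral_le)
    show "(\<lambda>z'. gauss 1 z' * p0 t (z + z')) integrable_on cube R"
      using cont_tmarg_integrand[OF cont_p0 T] unfolding cube_def by (rule integrable_continuous)
    show "c * gauss 1 z' \<le> gauss 1 z' * p0 t (z + z')" if "z' \<in> cube R" for z'
      unfolding p0_def mult.commute[of c]
      by (intro mult_left_mono prior_ge line_dom_mem cube_line_dom[OF T that]) simp
  qed (auto simp: cube_def intro!: integrable_continuous continuous_intros)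
  finally show ?thesis .
qed

lemma gauss_cube_pos: "integral (cube 1) (gauss 1 :: 'a \<Rightarrow> real) > 0"
proof -
  define m where "m = (2 * pi * 1) powr (- (real DIM('a) / 2)) * exp (- (real DIM('a))\<^sup>2 / (2 * 1))"
  have "m > 0" by (simp add: m_def)
  have "m \<le> gauss 1 z" if "z \<in> cube 1" for z :: 'a
  proof -
    have "norm z ^ 2 \<le> (real DIM('a))\<^sup>2" using norm_le_of_mem_cube[OF that] by (intro power_mono) auto
    then show ?thesis unfolding m_def gauss_def by (intro mult_left_mono) auto
  qed
  then have "integral (cube 1) (\<lambda>z::'a. m) \<le> integral (cube 1) (gauss 1 :: 'a \<Rightarrow> real)"
    by (intro integral_le) (auto simp: cube_def intro!: integrable_continuous continuous_intros)
  moreover have "integral (cube 1) (\<lambda>z::'a. m) > 0"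
    using \<open>m > 0\<close> unfolding cube_def by (simp add: content_cbox_if box_eq_empty inner_sum_left_Basis prod_pos not_less)
  ultimately show ?thesis by simp
qed

lemma tmarg_pos:
  assumes "2 * T * real DIM('a) * R \<le> r" "\<bar>t\<bar> \<le> T" "z \<in> cube R" "1 \<le> R"
  shows "tmarg p0 R t z > 0"
  using tmarg_pos_bound[OF assms] gauss_cube_pos c by (meson less_le_trans mult_pos_pos)

section \<open>The truncated expected logarithm and its derivatives in the scale parameter\<close>

definition tlog :: "real \<Rightarrow> real \<Rightarrow> real" where
  "tlog R t = integral (cube R) (\<lambda>z. gauss 1 z * ln (tmarg p0 R t z))"
definition tlog1 :: "real \<Rightarrow> real \<Rightarrow> real" where
  "tlog1 R t = integral (cube R) (\<lambda>z. gauss 1 z * (tmarg p1 R t z / tmarg p0 R t z))"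
definition tlog2 :: "real \<Rightarrow> real \<Rightarrow> real" where
  "tlog2 R t = integral (cube R) (\<lambda>z. gauss 1 z * (tmarg p2 R t z / tmarg p0 R t z - (tmarg p1 R t z / tmarg p0 R t z)\<^sup>2))"

context
  fixes T R :: real
  assumes T: "2 * T * real DIM('a) * R \<le> r" and R: "1 \<le> R"
begin

lemma cont_tmargs:
  "continuous_on ({- T..T} \<times> cube R) (\<lambda>x. tmarg p0 R (fst x) (snd x))"
  "continuous_on ({- T..T} \<times> cube R) (\<lambda>x. tmarg p1 R (fst x) (snd x))"
  "continuous_on ({- T..T} \<times> cube R) (\<lambda>x. tmarg p2 R (fst x) (snd x))"
  using cont_tmarg[OF cont_p0 T] cont_tmarg[OF cont_p1 T] cont_tmarg[OF cont_p2 T] by (simp_all add: case_prod_unfold)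

lemma tmarg_nz: "x \<in> {- T..T} \<times> cube R \<Longrightarrow> tmarg p0 R (fst x) (snd x) \<noteq> 0"
  using tmarg_pos[OF T, of "fst x" "snd x"] R by (auto simp: abs_le_iff)

lemma cont_slice:
  assumes "\<bar>t\<bar> \<le> T"
  shows "continuous_on (cube R) (\<lambda>z. gauss 1 z * ln (tmarg p0 R t z))"
    and "continuous_on (cube R) (\<lambda>z. gauss 1 z * (tmarg p1 R t z / tmarg p0 R t z))"
    and "continuous_on (cube R) (\<lambda>z. gauss 1 z * (tmarg p2 R t z / tmarg p0 R t z - (tmarg p1 R t z / tmarg p0 R t z)\<^sup>2))"
proof -
  note [continuous_intros] = cont_tmarg_slice[OF cont_p0 T assms] cont_tmarg_slice[OF cont_p1 T assms] cont_tmarg_slice[OF cont_p2 T assms]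
  have "\<forall>z\<in>cube R. tmarg p0 R t z \<noteq> 0" "\<forall>z\<in>cube R. 0 < tmarg p0 R t z" using tmarg_pos[OF T assms] R by force+
  then show "continuous_on (cube R) (\<lambda>z. gauss 1 z * ln (tmarg p0 R t z))"
    "continuous_on (cube R) (\<lambda>z. gauss 1 z * (tmarg p1 R t z / tmarg p0 R t z))"
    "continuous_on (cube R) (\<lambda>z. gauss 1 z * (tmarg p2 R t z / tmarg p0 R t z - (tmarg p1 R t z / tmarg p0 R t z)\<^sup>2))"
    by (intro continuous_intros; simp)+
qed

lemma deriv_tlog:
  assumes t: "t \<in> {- T..T}"
  shows "(tlog R has_field_derivative tlog1 R t) (at t within {- T..T})"
  unfolding tlog_def[abs_def] tlog1_def cube_def
proof (rule leibniz_rule_field_derivative)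
  fix u and z :: 'a assume u: "u \<in> {- T..T}" and "z \<in> cbox (- (R *\<^sub>R One)) (R *\<^sub>R One)"
  then have z: "z \<in> cube R" by (simp add: cube_def)
  have pos: "tmarg p0 R u z > 0" using u by (intro tmarg_pos[OF T _ z R]) auto
  have "((\<lambda>u. ln (tmarg p0 R u z)) has_field_derivative (1 / tmarg p0 R u z) * tmarg p1 R u z) (at u within {- T..T})"
    by (rule DERIV_chain2[where f = ln, OF _ deriv_tmarg[OF cont_p0 cont_p1 deriv_p0 T u z]])
       (use pos in \<open>auto intro!: derivative_eq_intros\<close>)
  from DERIV_cmult[OF this, of "gauss 1 z"]
  show "((\<lambda>u. gauss 1 z * ln (tmarg p0 R u z)) has_field_derivative gauss 1 z * (tmarg p1 R u z / tmarg p0 R u z)) (at u within {- T..T})"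
    by simp
next
  fix u assume "u \<in> {- T..T}"
  then show "(\<lambda>z. gauss 1 z * ln (tmarg p0 R u z)) integrable_on cbox (- (R *\<^sub>R One)) (R *\<^sub>R One)"
    using cont_slice(1)[of u] by (intro integrable_continuous) (auto simp: cube_def)
next
  have "continuous_on ({- T..T} \<times> cube R) (\<lambda>x. gauss 1 (snd x) * (tmarg p1 R (fst x) (snd x) / tmarg p0 R (fst x) (snd x)))"
    using tmarg_nz by (intro continuous_intros cont_tmargs) auto
  then show "continuous_on ({- T..T} \<times> cbox (- (R *\<^sub>R One)) (R *\<^sub>R One)) (\<lambda>(u, z). gauss 1 z * (tmarg p1 R u z / tmarg p0 R u z))"
    by (simp add: cube_def case_prod_unfold)
qed (use t in auto)

lemma deriv_tlog1:
  assumes t: "t \<in> {- T..T}"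
  shows "(tlog1 R has_field_derivative tlog2 R t) (at t within {- T..T})"
  unfolding tlog1_def[abs_def] tlog2_def cube_def
proof (rule leibniz_rule_field_derivative)
  fix u and z :: 'a assume u: "u \<in> {- T..T}" and "z \<in> cbox (- (R *\<^sub>R One)) (R *\<^sub>R One)"
  then have z: "z \<in> cube R" by (simp add: cube_def)
  have pos: "tmarg p0 R u z > 0" using u by (intro tmarg_pos[OF T _ z R]) auto
  have "((\<lambda>u. tmarg p1 R u z / tmarg p0 R u z) has_field_derivative
      (tmarg p2 R u z * tmarg p0 R u z - tmarg p1 R u z * tmarg p1 R u z) / (tmarg p0 R u z * tmarg p0 R u z)) (at u within {- T..T})"
    by (rule DERIV_divide[OF deriv_tmarg[OF cont_p1 cont_p2 deriv_p1 T u z] deriv_tmarg[OF cont_p0 cont_p1 deriv_p0 T u z]])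
       (use pos in auto)
  from DERIV_cmult[OF this, of "gauss 1 z"]
  show "((\<lambda>u. gauss 1 z * (tmarg p1 R u z / tmarg p0 R u z)) has_field_derivative
      gauss 1 z * (tmarg p2 R u z / tmarg p0 R u z - (tmarg p1 R u z / tmarg p0 R u z)\<^sup>2)) (at u within {- T..T})"
    using pos by (simp add: power2_eq_square diff_divide_distrib)
next
  fix u assume "u \<in> {- T..T}"
  then show "(\<lambda>z. gauss 1 z * (tmarg p1 R u z / tmarg p0 R u z)) integrable_on cbox (- (R *\<^sub>R One)) (R *\<^sub>R One)"
    using cont_slice(2)[of u] by (intro integrable_continuous) (auto simp: cube_def)
next
  have "continuous_on ({- T..T} \<times> cube R) (\<lambda>x. gauss 1 (snd x) * (tmarg p2 R (fst x) (snd x) / tmarg p0 R (fst x) (snd x) - (tmarg p1 R (fst x) (snd x) / tmarg p0 R (fst x) (snd x))\<^sup>2))"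
    using tmarg_nz by (intro continuous_intros cont_tmargs) auto
  then show "continuous_on ({- T..T} \<times> cbox (- (R *\<^sub>R One)) (R *\<^sub>R One)) (\<lambda>(u, z). gauss 1 z * (tmarg p2 R u z / tmarg p0 R u z - (tmarg p1 R u z / tmarg p0 R u z)\<^sup>2))"
    by (simp add: cube_def case_prod_unfold)
qed (use t in auto)

text \<open>At \<open>t = 0\<close> the function \<open>p1\<close> is linear in \<open>v\<close> and
  \<open>p0\<close> is constant, so over symmetric cubes the quotient of the two means is odd in
  \<open>z\<close>.\<close>

lemma tlog1_zero: "tlog1 R 0 = 0"
  unfolding tlog1_def
proof (rule integral_cube_odd)
  fix z :: 'a
  have "tmarg p1 R 0 (- z) = integral (cube R) (\<lambda>z'. (\<lambda>z'. gauss 1 z' * p1 0 (- z + - z')) (- z'))"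
    by (simp add: tmarg_def)
  also have "\<dots> = integral (cube R) (\<lambda>z'. gauss 1 z' * p1 0 (- z + - z'))"
    using integral_reflect[of "R *\<^sub>R One" "- (R *\<^sub>R One)" "\<lambda>z'. gauss 1 z' * p1 0 (- z + - z')"]
    unfolding cube_def by (simp only: minus_minus)
  also have "\<dots> = - tmarg p1 R 0 z"
    unfolding tmarg_def integral_neg[symmetric] by (intro integral_cong) (simp add: p1_def inner_diff_right inner_add_right algebra_simps)
  finally have "tmarg p1 R 0 (- z) = - tmarg p1 R 0 z" .
  moreover have "tmarg p0 R 0 (- z) = tmarg p0 R 0 z" by (simp add: tmarg_def p0_def)
  ultimately show "gauss 1 (- z) * (tmarg p1 R 0 (- z) / tmarg p0 R 0 (- z)) = - (gauss 1 z * (tmarg p1 R 0 z / tmarg p0 R 0 z))"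
    by simp
qed

text \<open>The derivative at the intermediate point \<open>\<tau>\<close> is itself an increment
  from \<open>tlog1 R 0 = 0\<close>, which yields the factor \<open>\<tau>\<close> and a second
  derivative. The location of \<open>\<tau>\<close> between \<open>t0\<close> and \<open>t1\<close>
  is kept, since it fixes the limit of that factor.\<close>

lemma tlog_diff:
  assumes t: "0 < t0" "t0 < t1" "t1 \<le> T"
  obtains \<tau> \<tau>' where "t0 < \<tau>" "\<tau> < t1" "0 < \<tau>'" "\<tau>' < t1" "tlog R t1 - tlog R t0 = (t1 - t0) * \<tau> * tlog2 R \<tau>'"
proof -
  have "\<exists>\<tau>\<in>{t0<..<t1}. tlog R t1 - tlog R t0 = (\<lambda>h. tlog1 R \<tau> * h) (t1 - t0)"
  proof (rule mvt_simple[OF t(2)])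
    fix u assume u: "t0 \<le> u" "u \<le> t1"
    have "(tlog R has_field_derivative tlog1 R u) (at u within {t0..t1})"
      by (rule has_field_derivative_subset[OF deriv_tlog]) (use u t in auto)
    then show "(tlog R has_derivative (\<lambda>h. tlog1 R u * h)) (at u within {t0..t1})"
      by (simp add: has_field_derivative_def)
  qed
  then obtain \<tau> where \<tau>: "t0 < \<tau>" "\<tau> < t1" "tlog R t1 - tlog R t0 = tlog1 R \<tau> * (t1 - t0)" by auto
  have "\<exists>\<tau>'\<in>{0<..<\<tau>}. tlog1 R \<tau> - tlog1 R 0 = (\<lambda>h. tlog2 R \<tau>' * h) (\<tau> - 0)"
  proof (rule mvt_simple)
    show "0 < \<tau>" using \<tau> t by simp
    fix u assume u: "0 \<le> u" "u \<le> \<tau>"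
    have "(tlog1 R has_field_derivative tlog2 R u) (at u within {0..\<tau>})"
      by (rule has_field_derivative_subset[OF deriv_tlog1]) (use u \<tau> t in auto)
    then show "(tlog1 R has_derivative (\<lambda>h. tlog2 R u * h)) (at u within {0..\<tau>})"
      by (simp add: has_field_derivative_def)
  qed
  then obtain \<tau>' where \<tau>': "0 < \<tau>'" "\<tau>' < \<tau>" "tlog1 R \<tau> = tlog2 R \<tau>' * \<tau>" by (auto simp: tlog1_zero)
  show ?thesis
    by (rule that[of \<tau> \<tau>']) (use \<tau> \<tau>' in \<open>auto simp: mult_ac\<close>)
qed

end

end

context c2_gauss_prior
begin

section \<open>The limit of the second derivative under growing cubes\<close>

definition \<mu> :: "nat \<Rightarrow> real" where
  "\<mu> i = (\<integral>z. gauss 1 (z::'a) * (1 + norm z) ^ i \<partial>lborel)"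

lemma tmarg_integrand_le:
  assumes T: "2 * T * real DIM('a) * R \<le> r" "\<bar>t\<bar> \<le> T" "z \<in> cube R" "z' \<in> cube R"
    and bnd: "\<And>t v. (t, v) \<in> line_dom \<Longrightarrow> \<bar>p t v\<bar> \<le> K * (1 + norm v) ^ i" and K: "K > 0"
  shows "\<bar>gauss 1 z' * p t (z + z')\<bar> \<le> (K * (1 + norm z) ^ i) * (gauss 1 z' * (1 + norm z') ^ i)"
proof -
  have "\<bar>p t (z + z')\<bar> \<le> K * (1 + norm (z + z')) ^ i" by (rule bnd[OF cube_line_dom[OF T]])
  also have "\<dots> \<le> K * ((1 + norm z) * (1 + norm z')) ^ i"
    using K by (intro mult_left_mono power_mono one_plus_norm_add) auto
  finally have "gauss 1 z' * \<bar>p t (z + z')\<bar> \<le> gauss 1 z' * (K * ((1 + norm z) * (1 + norm z')) ^ i)"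
    by (intro mult_left_mono) auto
  then show ?thesis by (simp add: abs_mult power_mult_distrib mult_ac)
qed

lemma tmarg_abs_le:
  assumes p: "continuous_on line_dom (\<lambda>(t, v). p t v)" and T: "2 * T * real DIM('a) * R \<le> r" "\<bar>t\<bar> \<le> T" "z \<in> cube R"
    and bnd: "\<And>t v. (t, v) \<in> line_dom \<Longrightarrow> \<bar>p t v\<bar> \<le> K * (1 + norm v) ^ i" and K: "K > 0" and i: "i \<le> 2"
  shows "\<bar>tmarg p R t z\<bar> \<le> K * \<mu> i * (1 + norm z) ^ i"
proof -
  let ?f = "\<lambda>z'. indicator (cube R) z' * (gauss 1 z' * p t (z + z'))"
  note int = integral_cube_eq_lebesgue[OF cont_tmarg_integrand[OF p T]]
  have "\<bar>tmarg p R t z\<bar> = \<bar>\<integral>z'. ?f z' \<partial>lborel\<bar>" unfolding tmarg_def int(2) ..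
  also have "\<dots> \<le> (\<integral>z'. \<bar>?f z'\<bar> \<partial>lborel)" by (rule integral_abs_bound)
  also have "\<dots> \<le> (\<integral>z'. (K * (1 + norm z) ^ i) * (gauss 1 z' * (1 + norm z') ^ i) \<partial>(lborel :: 'a measure))"
  proof (rule integral_mono)
    show "integrable lborel (\<lambda>z'. \<bar>?f z'\<bar>)" using int(1) by (rule integrable_abs)
    show "integrable lborel (\<lambda>z'::'a. (K * (1 + norm z) ^ i) * (gauss 1 z' * (1 + norm z') ^ i))"
      by (intro integrable_mult_right integrable_gauss_one_plus_norm i)
    fix z' :: 'a
    show "\<bar>?f z'\<bar> \<le> (K * (1 + norm z) ^ i) * (gauss 1 z' * (1 + norm z') ^ i)"
      using tmarg_integrand_le[OF T _ bnd K, of z'] K by (cases "z' \<in> cube R") simp_all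
  qed
  also have "\<dots> = K * (1 + norm z) ^ i * \<mu> i" by (simp add: \<mu>_def)
  finally show ?thesis by (simp add: mult_ac)
qed

text \<open>A fixed \<open>z\<close> may lie outside the first cubes, where the arguments of
  \<open>p\<close> can leave \<open>line_dom\<close> and no bound is available. The outer indicator
  removes these indices, so that domination holds for all \<open>n\<close>, and it is eventually
  1.\<close>

lemma tmarg_tendsto:
  assumes p: "continuous_on line_dom (\<lambda>(t, v). p t v)"
    and T: "\<And>n. 2 * \<bar>\<tau> n\<bar> * real DIM('a) * R n \<le> r" and R: "filterlim R at_top sequentially" and \<tau>: "\<tau> \<longlonglongrightarrow> 0"
    and bnd: "\<And>t v. (t, v) \<in> line_dom \<Longrightarrow> \<bar>p t v\<bar> \<le> K * (1 + norm v) ^ i" and K: "K > 0" and i: "i \<le> 2"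
    and p0m: "(\<lambda>v. p 0 v) \<in> borel_measurable borel"
  shows "(\<lambda>n. indicator (cube (R n)) z * tmarg p (R n) (\<tau> n) z) \<longlonglongrightarrow> (\<integral>z'. gauss 1 z' * p 0 (z + z') \<partial>lborel)"
proof -
  let ?s = "\<lambda>n z'. indicator (cube (R n)) z * (indicator (cube (R n)) z' * (gauss 1 z' * p (\<tau> n) (z + z')))"
  have int: "integrable lborel (\<lambda>z'. indicator (cube (R n)) z' * (gauss 1 z' * p (\<tau> n) (z + z')))"
    "tmarg p (R n) (\<tau> n) z = (\<integral>z'. indicator (cube (R n)) z' * (gauss 1 z' * p (\<tau> n) (z + z')) \<partial>lborel)"
    if "z \<in> cube (R n)" for n
    using integral_cube_eq_lebesgue[OF cont_tmarg_integrand[OF p T order_refl that]] by (simp_all add: tmarg_def)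
  have eq: "indicator (cube (R n)) z * tmarg p (R n) (\<tau> n) z = (\<integral>z'. ?s n z' \<partial>lborel)" for n
    by (cases "z \<in> cube (R n)") (simp_all add: int)
  have ev: "eventually (\<lambda>n. x \<in> cube (R n)) sequentially" for x :: 'a
    by (rule eventually_mem_cube[OF R])
  show ?thesis unfolding eq
  proof (rule integral_dominated_convergence)
    have [measurable]: "(\<lambda>z'. p 0 (z + z')) \<in> borel_measurable borel"
      using measurable_compose[OF _ p0m, of "\<lambda>z'. z + z'" borel] by simp
    show "(\<lambda>z'. gauss 1 z' * p 0 (z + z')) \<in> borel_measurable lborel" by measurable
    show "?s n \<in> borel_measurable lborel" for n
      using int(1)[of n] by (cases "z \<in> cube (R n)") (auto dest: borel_measurable_integrable)
    show "integrable lborel (\<lambda>z'::'a. (K * (1 + norm z) ^ i) * (gauss 1 z' * (1 + norm z') ^ i))"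
      by (intro integrable_mult_right integrable_gauss_one_plus_norm i)
    show "AE z' in lborel. norm (?s n z') \<le> (K * (1 + norm z) ^ i) * (gauss 1 z' * (1 + norm z') ^ i)" for n
    proof (intro AE_I2)
      fix z' :: 'a
      show "norm (?s n z') \<le> (K * (1 + norm z) ^ i) * (gauss 1 z' * (1 + norm z') ^ i)"
        using tmarg_integrand_le[OF T order_refl _ _ bnd K, of z n z'] K
        by (cases "z \<in> cube (R n)"; cases "z' \<in> cube (R n)") simp_all
    qed
    show "AE z' in lborel. (\<lambda>n. ?s n z') \<longlonglongrightarrow> gauss 1 z' * p 0 (z + z')"
    proof (intro AE_I2)
      fix z' :: 'a
      have dom0: "(0, z + z') \<in> line_dom" using r by (simp add: line_dom_def)
      have "eventually (\<lambda>n. z \<in> cube (R n) \<and> z' \<in> cube (R n)) sequentially"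
        using ev[of z] ev[of z'] by (rule eventually_conj)
      then have evd: "eventually (\<lambda>n. (\<tau> n, z + z') \<in> line_dom) sequentially"
        by eventually_elim (use cube_line_dom[OF T order_refl] in auto)
      have "(\<lambda>n. (\<lambda>(t, v). p t v) (\<tau> n, z + z')) \<longlonglongrightarrow> (\<lambda>(t, v). p t v) (0, z + z')"
        by (rule continuous_on_tendsto_compose[OF p _ dom0 evd]) (intro tendsto_intros \<tau>)
      then have "(\<lambda>n. gauss 1 z' * p (\<tau> n) (z + z')) \<longlonglongrightarrow> gauss 1 z' * p 0 (z + z')"
        by (intro tendsto_intros) simp
      moreover have "eventually (\<lambda>n. gauss 1 z' * p (\<tau> n) (z + z') = ?s n z') sequentially"
        using ev[of z] ev[of z'] by eventually_elim simp
      ultimately show "(\<lambda>n. ?s n z') \<longlonglongrightarrow> gauss 1 z' * p 0 (z + z')"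
        by (rule Lim_transform_eventually)
    qed
  qed
qed

text \<open>Equal to twice the Laplacian of \<open>sqrt q\<close> divided by \<open>sqrt q\<close>,
  at \<open>M\<close>: the quantity whose sign expresses superharmonicity of the root of the
  prior.\<close>

definition risk_coeff :: real where
  "risk_coeff = (\<Sum>b\<in>Basis. H M b \<bullet> b) / q M - (norm (g M))\<^sup>2 / (2 * (q M)\<^sup>2)"

lemma M_mem: "M \<in> cball M r" using r by simp

lemma qM_pos: "q M > 0" using prior_ge[OF M_mem] c by simp

lemma integrable_gauss_linear: "integrable lborel (\<lambda>z::'a. gauss 1 z * (u \<bullet> z))"
proof (rule integrable_gauss_quadratic_bound)
  fix z :: 'a
  have "\<bar>u \<bullet> z\<bar> \<le> norm u * norm z" by (rule Cauchy_Schwarz_ineq2)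
  also have "\<dots> \<le> norm u * (1 + norm z ^ 2)"
  proof (rule mult_left_mono)
    show "norm z \<le> 1 + norm z ^ 2"
      using zero_le_power2[of "norm z - 1/2"] by (simp add: power2_eq_square algebra_simps)
  qed simp
  finally show "\<bar>u \<bullet> z\<bar> \<le> norm u + norm u * norm z ^ 2" by (simp add: algebra_simps)
qed auto

lemma integral_gauss_linear: "(\<integral>z. gauss 1 z * (u \<bullet> (z::'a)) \<partial>lborel) = 0"
  by (rule integral_lborel_odd) simp

lemma bilinear_hess: "bounded_bilinear (\<lambda>x y. H M x \<bullet> y)"
  by (rule bounded_bilinear.comp1[OF bounded_bilinear_inner bounded_linear_H[OF M_mem]])

lemma integral_gauss_p:
  "(\<integral>z'. gauss 1 z' * p0 0 (z + z') \<partial>lborel) = q M"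
  "(\<integral>z'. gauss 1 z' * p1 0 (z + z') \<partial>lborel) = g M \<bullet> z"
  "(\<integral>z'. gauss 1 z' * p2 0 (z + z') \<partial>lborel) = H M z \<bullet> z + (\<Sum>b\<in>Basis. H M b \<bullet> b)"
proof -
  interpret bounded_linear "H M" by (rule bounded_linear_H[OF M_mem])
  note g1 = integrable_gauss[of 1, where 'a='a] integral_gauss[of 1, where 'a='a]
  show "(\<integral>z'. gauss 1 z' * p0 0 (z + z') \<partial>lborel) = q M"
    using g1 by (simp add: p0_def)
  have "(\<integral>z'. gauss 1 z' * p1 0 (z + z') \<partial>lborel) = (\<integral>z'. gauss 1 z' * (g M \<bullet> z) + gauss 1 z' * (g M \<bullet> z') \<partial>lborel)"
    by (simp add: p1_def inner_add_right distrib_left)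
  also have "\<dots> = g M \<bullet> z"
    using g1 integrable_gauss_linear[of "g M"] integral_gauss_linear[of "g M"] by simp
  finally show "(\<integral>z'. gauss 1 z' * p1 0 (z + z') \<partial>lborel) = g M \<bullet> z" .
  \<comment> \<open>The two cross terms of the quadratic form are linear in \<open>z'\<close>; the
    adjoint writes them as one inner product, whose Gaussian mean vanishes, without appeal to
    symmetry of the Hessian.\<close>
  define u where "u = adjoint (H M) z + H M z"
  have u: "u \<bullet> z' = H M z' \<bullet> z + H M z \<bullet> z'" for z'
    using adjoint_works[OF linear_axioms, of z' z] by (simp add: u_def inner_add_left inner_commute[of "adjoint (H M) z"])
  have "(\<integral>z'. gauss 1 z' * p2 0 (z + z') \<partial>lborel)
      = (\<integral>z'. gauss 1 z' * (H M z \<bullet> z) + gauss 1 z' * (u \<bullet> z') + gauss 1 z' * (H M z' \<bullet> z') \<partial>lborel)"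
    by (intro Bochner_Integration.integral_cong refl)
       (simp add: p2_def u add inner_add_left inner_add_right distrib_left)
  also have "\<dots> = H M z \<bullet> z + (\<Sum>b\<in>Basis. H M b \<bullet> b)"
    using g1 integrable_gauss_linear[of u] integral_gauss_linear[of u] integrable_gauss_quadratic[OF bilinear_hess]
    by simp
  finally show "(\<integral>z'. gauss 1 z' * p2 0 (z + z') \<partial>lborel) = H M z \<bullet> z + (\<Sum>b\<in>Basis. H M b \<bullet> b)" .
qed

text \<open>The trace of the Hessian enters twice, once from the inner mean over \<open>z'\<close>
  and once from the outer mean over \<open>z\<close>; the squared gradient enters once, from the
  outer mean. This is why the limit is \<open>2 * risk_coeff\<close>.\<close>

lemma tlog2_tendsto:
  assumes T: "\<And>n. 2 * \<bar>\<tau> n\<bar> * real DIM('a) * R n \<le> r" and R: "filterlim R at_top sequentially"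
    and R1: "\<And>n. 1 \<le> R n" and \<tau>: "\<tau> \<longlonglongrightarrow> 0"
  shows "(\<lambda>n. tlog2 (R n) (\<tau> n)) \<longlonglongrightarrow> 2 * risk_coeff"
proof -
  obtain K where K: "K > 0"
    "\<And>t v. (t, v) \<in> line_dom \<Longrightarrow> \<bar>p0 t v\<bar> \<le> K * (1 + norm v) ^ 0"
    "\<And>t v. (t, v) \<in> line_dom \<Longrightarrow> \<bar>p1 t v\<bar> \<le> K * (1 + norm v) ^ 1"
    "\<And>t v. (t, v) \<in> line_dom \<Longrightarrow> \<bar>p2 t v\<bar> \<le> K * (1 + norm v) ^ 2"
    using p_bounds by blast
  interpret HM: bounded_linear "H M" by (rule bounded_linear_H[OF M_mem])
  have [measurable]: "H M \<in> borel_measurable borel"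
    by (intro borel_measurable_continuous_onI HM.continuous_on continuous_on_id)
  have meas: "(\<lambda>v. p0 0 v) \<in> borel_measurable borel" "(\<lambda>v. p1 0 v) \<in> borel_measurable borel" "(\<lambda>v. p2 0 v) \<in> borel_measurable borel"
    unfolding p0_def p1_def p2_def by simp_all
  define k where "k = c * integral (cube 1) (gauss 1 :: 'a \<Rightarrow> real)"
  have k: "k > 0" unfolding k_def using c gauss_cube_pos by simp
  let ?trH = "\<Sum>b\<in>Basis. H M b \<bullet> b"
  let ?e = "\<lambda>n z. tmarg p2 (R n) (\<tau> n) z / tmarg p0 (R n) (\<tau> n) z - (tmarg p1 (R n) (\<tau> n) z / tmarg p0 (R n) (\<tau> n) z)\<^sup>2"
  let ?s = "\<lambda>n z. indicator (cube (R n)) z * (gauss 1 z * ?e n z)"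
  let ?f = "\<lambda>z. gauss 1 z * ((H M z \<bullet> z + ?trH) / q M - (g M \<bullet> z / q M)\<^sup>2)"
  note int = integral_cube_eq_lebesgue[OF cont_slice(3)[OF T R1 order_refl]]
  define C where "C = K * \<mu> 2 / k + (K * \<mu> 1 / k)\<^sup>2"
  have "(\<lambda>n. \<integral>z. ?s n z \<partial>lborel) \<longlonglongrightarrow> (\<integral>z. ?f z \<partial>lborel)"
  proof (rule integral_dominated_convergence)
    show "?f \<in> borel_measurable lborel" by measurable
    show "?s n \<in> borel_measurable lborel" for n using int(1)[of n] by (rule borel_measurable_integrable)
    show "integrable lborel (\<lambda>z::'a. C * (gauss 1 z * (1 + norm z) ^ 2))"
      by (intro integrable_mult_right integrable_gauss_one_plus_norm) simp
    show "AE z in lborel. norm (?s n z) \<le> C * (gauss 1 z * (1 + norm z) ^ 2)" for n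
    proof (intro AE_I2)
      fix z :: 'a
      have mu: "\<mu> j \<ge> 0" for j unfolding \<mu>_def by (intro integral_nonneg_AE) auto
      have C: "C \<ge> 0" unfolding C_def using K k mu by simp
      show "norm (?s n z) \<le> C * (gauss 1 z * (1 + norm z) ^ 2)"
      proof (cases "z \<in> cube (R n)")
        case True
        let ?F = "\<lambda>p. tmarg p (R n) (\<tau> n) z"
        have F0: "k \<le> ?F p0" unfolding k_def by (rule tmarg_pos_bound[OF T order_refl True R1])
        have F1: "\<bar>?F p1\<bar> \<le> K * \<mu> 1 * (1 + norm z) ^ 1"
          by (rule tmarg_abs_le[OF cont_p1 T order_refl True K(3) K(1)]) simp_all
        have F2: "\<bar>?F p2\<bar> \<le> K * \<mu> 2 * (1 + norm z) ^ 2"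
          by (rule tmarg_abs_le[OF cont_p2 T order_refl True K(4) K(1)]) simp_all
        have "\<bar>?F p2 / ?F p0\<bar> \<le> K * \<mu> 2 * (1 + norm z) ^ 2 / k"
          unfolding abs_divide using F2 F0 k by (intro frac_le) auto
        moreover have "\<bar>?F p1 / ?F p0\<bar> \<le> K * \<mu> 1 * (1 + norm z) / k"
          unfolding abs_divide using F1 F0 k by (intro frac_le) auto
        then have "\<bar>?F p1 / ?F p0\<bar>\<^sup>2 \<le> (K * \<mu> 1 * (1 + norm z) / k)\<^sup>2"
          by (intro power_mono) auto
        ultimately have "\<bar>?e n z\<bar> \<le> K * \<mu> 2 * (1 + norm z) ^ 2 / k + (K * \<mu> 1 * (1 + norm z) / k)\<^sup>2"
          using abs_triangle_ineq4[of "?F p2 / ?F p0" "(?F p1 / ?F p0)\<^sup>2"]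
          unfolding power2_abs abs_power2 by linarith
        also have "\<dots> = C * (1 + norm z) ^ 2"
          by (simp add: C_def power_mult_distrib power_divide distrib_right)
        finally have "gauss 1 z * \<bar>?e n z\<bar> \<le> gauss 1 z * (C * (1 + norm z) ^ 2)" by (intro mult_left_mono) auto
        then show ?thesis using True by (simp add: abs_mult mult_ac)
      next
        case False
        then show ?thesis using C by simp
      qed
    qed
    show "AE z in lborel. (\<lambda>n. ?s n z) \<longlonglongrightarrow> ?f z"
    proof (intro AE_I2)
      fix z :: 'a
      let ?a = "\<lambda>p n. indicator (cube (R n)) z * tmarg p (R n) (\<tau> n) z"
      have "?a p0 \<longlonglongrightarrow> q M" "?a p1 \<longlonglongrightarrow> g M \<bullet> z" "?a p2 \<longlonglongrightarrow> H M z \<bullet> z + ?trH"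
        using tmarg_tendsto[OF cont_p0 T R \<tau> K(2) K(1) _ meas(1), of z] tmarg_tendsto[OF cont_p1 T R \<tau> K(3) K(1) _ meas(2), of z]
          tmarg_tendsto[OF cont_p2 T R \<tau> K(4) K(1) _ meas(3), of z] by (simp_all add: integral_gauss_p)
      then have "(\<lambda>n. gauss 1 z * (?a p2 n / ?a p0 n - (?a p1 n / ?a p0 n)\<^sup>2)) \<longlonglongrightarrow> ?f z"
        using qM_pos by (intro tendsto_intros) auto
      moreover have "eventually (\<lambda>n. gauss 1 z * (?a p2 n / ?a p0 n - (?a p1 n / ?a p0 n)\<^sup>2) = ?s n z) sequentially"
        using eventually_mem_cube[OF R, of z] by eventually_elim simp
      ultimately show "(\<lambda>n. ?s n z) \<longlonglongrightarrow> ?f z" by (rule Lim_transform_eventually)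
    qed
  qed
  moreover have "(\<integral>z. ?s n z \<partial>lborel) = tlog2 (R n) (\<tau> n)" for n
    unfolding tlog2_def int(2) ..
  moreover have "(\<integral>z. ?f z \<partial>lborel) = 2 * risk_coeff"
  proof -
    have bil: "bounded_bilinear (\<lambda>x y. (g M \<bullet> x) * (g M \<bullet> y))"
      by (rule bounded_bilinear.comp[OF bounded_bilinear_mult bounded_linear_inner_right bounded_linear_inner_right])
    have "(\<integral>z. ?f z \<partial>lborel) = (\<integral>z. (1 / q M) * (gauss 1 z * (H M z \<bullet> z)) + (?trH / q M) * gauss 1 z
        - (1 / (q M)\<^sup>2) * (gauss 1 z * ((g M \<bullet> z) * (g M \<bullet> z))) \<partial>lborel)"
      by (intro Bochner_Integration.integral_cong refl)
         (simp add: power_divide power2_eq_square add_divide_distrib algebra_simps)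
    also have "\<dots> = (1 / q M) * ?trH + ?trH / q M - (1 / (q M)\<^sup>2) * (\<Sum>b\<in>Basis. (g M \<bullet> b) * (g M \<bullet> b))"
      using integrable_gauss_quadratic[OF bil] integrable_gauss_quadratic[OF bilinear_hess]
        integrable_gauss[of 1, where 'a='a] integral_gauss[of 1, where 'a='a] by simp
    also have "(\<Sum>b\<in>Basis. (g M \<bullet> b) * (g M \<bullet> b)) = (norm (g M))\<^sup>2"
      by (subst norm_sq_eq_sum_Basis) (simp add: power2_eq_square)
    finally show ?thesis by (simp add: risk_coeff_def)
  qed
  ultimately show ?thesis by simp
qed

section \<open>The truncation error\<close>

lemma marg_scale:
  assumes t: "t > 0"
  shows "marg (t\<^sup>2) y = (\<integral>z'. gauss 1 z' * q (y + t *\<^sub>R z') \<partial>lborel)"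
    and "integrable lborel (\<lambda>z'. gauss 1 z' * q (y + t *\<^sub>R z'))"
proof -
  have eq: "gauss (t\<^sup>2) (y - (y + t *\<^sub>R z')) * q (y + t *\<^sub>R z') = (1 / t ^ DIM('a)) * (gauss 1 z' * q (y + t *\<^sub>R z'))" for z'
    using gauss_scale[OF t, of z'] by simp
  have "marg (t\<^sup>2) y = \<bar>t\<bar> ^ DIM('a) * (\<integral>z'. gauss (t\<^sup>2) (y - (y + t *\<^sub>R z')) * q (y + t *\<^sub>R z') \<partial>lborel)"
    unfolding marg_def using t by (intro integral_lborel_affine) auto
  also have "\<dots> = (\<integral>z'. gauss 1 z' * q (y + t *\<^sub>R z') \<partial>lborel)"
    unfolding eq using t by simp
  finally show "marg (t\<^sup>2) y = (\<integral>z'. gauss 1 z' * q (y + t *\<^sub>R z') \<partial>lborel)" .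
  have "integrable lborel (\<lambda>z'. gauss (t\<^sup>2) (y - (y + t *\<^sub>R z')) * q (y + t *\<^sub>R z'))"
    using integrable_lborel_affine[of t "\<lambda>x. gauss (t\<^sup>2) (y - x) * q x" y] integrable_marg[of "t\<^sup>2" y] t by simp
  then have "integrable lborel (\<lambda>z'. t ^ DIM('a) * (gauss (t\<^sup>2) (y - (y + t *\<^sub>R z')) * q (y + t *\<^sub>R z')))"
    by (rule integrable_mult_right)
  then show "integrable lborel (\<lambda>z'. gauss 1 z' * q (y + t *\<^sub>R z'))"
    unfolding eq using t by simp
qed

lemma elog_marg_scale:
  assumes t: "t > 0"
  shows "elog_marg (t\<^sup>2) = (\<integral>z. gauss 1 z * ln (marg (t\<^sup>2) (M + t *\<^sub>R z)) \<partial>lborel)"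
proof -
  have "elog_marg (t\<^sup>2) = \<bar>t\<bar> ^ DIM('a) * (\<integral>z. gauss (t\<^sup>2) (0 + t *\<^sub>R z) * ln (marg (t\<^sup>2) (M + (0 + t *\<^sub>R z))) \<partial>lborel)"
    unfolding elog_marg_def using t by (intro integral_lborel_affine) auto
  also have "\<dots> = \<bar>t\<bar> ^ DIM('a) * (\<integral>z. (1 / t ^ DIM('a)) * (gauss 1 z * ln (marg (t\<^sup>2) (M + t *\<^sub>R z))) \<partial>lborel)"
    using gauss_scale[OF t, where 'a='a] by simp
  finally show ?thesis using t by simp
qed

text \<open>Outside the cube half of the Gaussian exponent yields \<open>exp (- R^2 / 4)\<close> and
  the other half keeps the prior integrable. Far from \<open>M\<close> only Gaussian integrability
  of the prior is available, so the substitution is undone, at the cost of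
  \<open>1 / t ^ DIM('a)\<close>.\<close>

lemma marg_minus_tmarg:
  obtains D where "D \<ge> 0" "\<And>t R z. 0 < t \<Longrightarrow> t \<le> 1 \<Longrightarrow> 0 \<le> R \<Longrightarrow> 2 * t * real DIM('a) * R \<le> r \<Longrightarrow> z \<in> cube R \<Longrightarrow>
    0 \<le> marg (t\<^sup>2) (M + t *\<^sub>R z) - tmarg p0 R t z \<and>
    marg (t\<^sup>2) (M + t *\<^sub>R z) - tmarg p0 R t z \<le> D * exp (- R\<^sup>2 / 4) / t ^ DIM('a)"
proof -
  define k where "k = (2 * pi * 1) powr (- (real DIM('a) / 2))"
  \<comment> \<open>The rate 1/8 and the factor \<open>E\<close> result from replacing the squared
    norm of \<open>x - y\<close> by half of that of \<open>x\<close> minus that of \<open>y\<close>,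
    at rate 1/4, where \<open>norm y \<le> norm M + r\<close>.\<close>
  define I where "I = (\<integral>x. exp (- (1/8) * norm x ^ 2) * q x \<partial>lborel)"
  define E where "E = exp ((norm M + r)\<^sup>2 / 4)"
  have k: "k > 0" by (simp add: k_def)
  have E: "E > 0" by (simp add: E_def)
  have I: "I \<ge> 0" unfolding I_def using prior_nonneg by (intro integral_nonneg_AE) auto
  show ?thesis
  proof (rule that[of "k * E * I"])
    show "0 \<le> k * E * I" using k E I by simp
    fix t R :: real and z :: 'a
    assume t: "0 < t" "t \<le> 1" and R: "0 \<le> R" "2 * t * real DIM('a) * R \<le> r" and z: "z \<in> cube R"
    define y where "y = M + t *\<^sub>R z"
    have "norm z \<le> real DIM('a) * R" by (rule norm_le_of_mem_cube[OF z])
    then have "t * norm z \<le> t * (real DIM('a) * R)" using t by (intro mult_left_mono) auto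
    moreover have "0 \<le> t * (real DIM('a) * R)" using t R by simp
    moreover have "2 * t * real DIM('a) * R = 2 * (t * (real DIM('a) * R))" by simp
    ultimately have "t * norm z \<le> r" using R by linarith
    then have "norm (t *\<^sub>R z) \<le> r" using t by simp
    then have ny: "norm y \<le> norm M + r" unfolding y_def using norm_triangle_ineq[of M "t *\<^sub>R z"] by simp
    let ?i = "indicator (cube R) :: 'a \<Rightarrow> real"
    have tmarg: "tmarg p0 R t z = (\<integral>z'. ?i z' * (gauss 1 z' * q (y + t *\<^sub>R z')) \<partial>lborel)"
      and itmarg: "integrable lborel (\<lambda>z'. ?i z' * (gauss 1 z' * q (y + t *\<^sub>R z')))"
    proof -
      have eq: "p0 t (z + z') = q (y + t *\<^sub>R z')" for z' by (simp add: p0_def y_def algebra_simps)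
      have "\<bar>t\<bar> \<le> t" using t by simp
      from integral_cube_eq_lebesgue[OF cont_tmarg_integrand[OF cont_p0 R(2) this z]]
      show "tmarg p0 R t z = (\<integral>z'. ?i z' * (gauss 1 z' * q (y + t *\<^sub>R z')) \<partial>lborel)"
        "integrable lborel (\<lambda>z'. ?i z' * (gauss 1 z' * q (y + t *\<^sub>R z')))" by (simp_all add: tmarg_def eq)
    qed
    note marg = marg_scale[OF t(1), of y]
    have diff: "marg (t\<^sup>2) y - tmarg p0 R t z = (\<integral>z'. (1 - ?i z') * (gauss 1 z' * q (y + t *\<^sub>R z')) \<partial>lborel)"
      unfolding marg(1) tmarg by (subst Bochner_Integration.integral_diff[symmetric, OF marg(2) itmarg]) (simp add: algebra_simps)
    have idiff: "integrable lborel (\<lambda>z'. (1 - ?i z') * (gauss 1 z' * q (y + t *\<^sub>R z')))"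
      using Bochner_Integration.integrable_diff[OF marg(2) itmarg] by (simp add: algebra_simps)
    have nonneg: "0 \<le> marg (t\<^sup>2) y - tmarg p0 R t z"
      unfolding diff using prior_nonneg by (intro integral_nonneg_AE) (auto simp: indicator_def)
    let ?\<phi> = "\<lambda>x. exp (- (1/(4 * t\<^sup>2)) * (norm (x - y))\<^sup>2) * q x"
    have \<phi>_le: "?\<phi> x \<le> E * (exp (- (1/8) * norm x ^ 2) * q x)" for x
    proof -
      have "norm x ^ 2 \<le> 2 * (norm (x - y))\<^sup>2 + 2 * norm y ^ 2" using norm_add_sq_le[of "x - y" y] by simp
      moreover have "norm y ^ 2 \<le> (norm M + r)\<^sup>2" using ny by (intro power_mono) auto
      moreover have "1/4 * (norm (x - y))\<^sup>2 \<le> 1/(4 * t\<^sup>2) * (norm (x - y))\<^sup>2"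
        using t by (intro mult_right_mono) (auto simp: field_simps power_le_one)
      ultimately have "- (1/(4 * t\<^sup>2)) * (norm (x - y))\<^sup>2 \<le> (norm M + r)\<^sup>2 / 4 + - (1/8) * norm x ^ 2"
        by argo
      then have "exp (- (1/(4 * t\<^sup>2)) * (norm (x - y))\<^sup>2) \<le> E * exp (- (1/8) * norm x ^ 2)"
        unfolding E_def exp_add[symmetric] by (subst exp_le_cancel_iff)
      then show ?thesis unfolding mult.assoc[symmetric] by (intro mult_right_mono prior_nonneg)
    qed
    have iE: "integrable lborel (\<lambda>x. E * (exp (- (1/8) * norm x ^ 2) * q x))"
      by (intro integrable_mult_right integrable_prior) simp
    have i\<phi>: "integrable lborel ?\<phi>"
    proof (rule Bochner_Integration.integrable_bound[OF iE])
      show "AE x in lborel. norm (?\<phi> x) \<le> norm (E * (exp (- (1/8) * norm x ^ 2) * q x))"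
        using \<phi>_le prior_nonneg by (intro AE_I2) (simp add: abs_mult abs_of_pos[OF E] del: mult_minus_left)
    qed measurable
    have "(\<integral>x. ?\<phi> x \<partial>lborel) \<le> E * I"
      using integral_mono[OF i\<phi> iE \<phi>_le] by (simp add: I_def)
    moreover have "(\<integral>x. ?\<phi> x \<partial>lborel) = \<bar>t\<bar> ^ DIM('a) * (\<integral>z'. ?\<phi> (y + t *\<^sub>R z') \<partial>lborel)"
      using t by (intro integral_lborel_affine) auto
    moreover have \<phi>eq: "?\<phi> (y + t *\<^sub>R z') = exp (- (1/4) * norm z' ^ 2) * q (y + t *\<^sub>R z')" for z'
      using t by (simp add: power_mult_distrib)
    ultimately have J: "(\<integral>z'. exp (- (1/4) * norm z' ^ 2) * q (y + t *\<^sub>R z') \<partial>lborel) \<le> E * I / t ^ DIM('a)"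
      using t by (simp add: field_simps)
    have iJ: "integrable lborel (\<lambda>z'. exp (- (1/4) * norm z' ^ 2) * q (y + t *\<^sub>R z'))"
      using integrable_lborel_affine[of t ?\<phi> y] i\<phi> t unfolding \<phi>eq by simp
    have "marg (t\<^sup>2) y - tmarg p0 R t z \<le> (\<integral>z'. k * exp (- R\<^sup>2 / 4) * (exp (- (1/4) * norm z' ^ 2) * q (y + t *\<^sub>R z')) \<partial>lborel)"
      unfolding diff
    proof (rule integral_mono[OF idiff])
      show "integrable lborel (\<lambda>z'. k * exp (- R\<^sup>2 / 4) * (exp (- (1/4) * norm z' ^ 2) * q (y + t *\<^sub>R z')))"
        by (rule integrable_mult_right[OF iJ])
      fix z' :: 'a
      show "(1 - ?i z') * (gauss 1 z' * q (y + t *\<^sub>R z')) \<le> k * exp (- R\<^sup>2 / 4) * (exp (- (1/4) * norm z' ^ 2) * q (y + t *\<^sub>R z'))"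
      proof (cases "z' \<in> cube R")
        case True
        then show ?thesis using k prior_nonneg by simp
      next
        case False
        have "R\<^sup>2 \<le> norm z' ^ 2" using norm_gt_of_not_mem_cube[OF False] R by (intro power_mono) auto
        then have "- (norm z')\<^sup>2 / (2 * 1) \<le> - R\<^sup>2 / 4 + - (1/4) * norm z' ^ 2" by argo
        then have "exp (- (norm z')\<^sup>2 / (2 * 1)) \<le> exp (- R\<^sup>2 / 4) * exp (- (1/4) * norm z' ^ 2)"
          unfolding exp_add[symmetric] by (subst exp_le_cancel_iff)
        then have "gauss 1 z' \<le> k * exp (- R\<^sup>2 / 4) * exp (- (1/4) * norm z' ^ 2)"
          unfolding gauss_def k_def mult.assoc by (intro mult_left_mono) auto
        then show ?thesis using False unfolding mult.assoc[symmetric]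
          by (intro mult_right_mono prior_nonneg) simp
      qed
    qed
    also have "\<dots> = k * exp (- R\<^sup>2 / 4) * (\<integral>z'. exp (- (1/4) * norm z' ^ 2) * q (y + t *\<^sub>R z') \<partial>lborel)" by simp
    also have "\<dots> \<le> k * exp (- R\<^sup>2 / 4) * (E * I / t ^ DIM('a))" using k by (intro mult_left_mono J) auto
    finally show "0 \<le> marg (t\<^sup>2) (M + t *\<^sub>R z) - tmarg p0 R t z \<and>
      marg (t\<^sup>2) (M + t *\<^sub>R z) - tmarg p0 R t z \<le> k * E * I * exp (- R\<^sup>2 / 4) / t ^ DIM('a)"
      using nonneg by (simp add: y_def mult_ac)
  qed
qed

text \<open>It is applied with \<open>1 / t\<^sup>2\<close> and \<open>R\<^sup>2\<close> of order \<open>N\<close>; the power \<open>8\<close> makes the bound \<open>o(N\<^sup>-\<^sup>2)\<close>.\<close>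

lemma truncation:
  obtains C D where "C \<ge> 0" "D \<ge> 0" "\<And>t R. 0 < t \<Longrightarrow> t \<le> 1 \<Longrightarrow> 1 \<le> R \<Longrightarrow> 2 * t * real DIM('a) * R \<le> r \<Longrightarrow>
    \<bar>elog_marg (t\<^sup>2) - tlog R t\<bar> \<le> C * (1 / t\<^sup>2 + 1) / R ^ 8 + D * exp (- R\<^sup>2 / 4) / t ^ DIM('a)"
proof -
  obtain C0 where C0: "C0 \<ge> 0" "\<And>s y. 0 < s \<Longrightarrow> s \<le> 1 \<Longrightarrow> \<bar>ln (marg s (M + y))\<bar> \<le> C0 / s + C0 / s * norm y ^ 2"
    using ln_marg_bound by blast
  obtain D0 where D0: "D0 \<ge> 0" "\<And>t R z. 0 < t \<Longrightarrow> t \<le> 1 \<Longrightarrow> 0 \<le> R \<Longrightarrow> 2 * t * real DIM('a) * R \<le> r \<Longrightarrow> z \<in> cube R \<Longrightarrow>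
    0 \<le> marg (t\<^sup>2) (M + t *\<^sub>R z) - tmarg p0 R t z \<and>
    marg (t\<^sup>2) (M + t *\<^sub>R z) - tmarg p0 R t z \<le> D0 * exp (- R\<^sup>2 / 4) / t ^ DIM('a)"
    using marg_minus_tmarg by blast
  define k where "k = c * integral (cube 1) (gauss 1 :: 'a \<Rightarrow> real)"
  have k: "k > 0" unfolding k_def using c gauss_cube_pos by simp
  define m where "m j = (\<integral>z. gauss 1 (z::'a) * norm z ^ j \<partial>lborel)" for j
  have m: "m j \<ge> 0" for j unfolding m_def by (intro integral_nonneg_AE) auto
  show ?thesis
  proof (rule that[of "C0 * (m 8 + m 10)" "D0 / k"])
    show "0 \<le> C0 * (m 8 + m 10)" using C0 m[of 8] m[of 10] by simp
    show "0 \<le> D0 / k" using D0 k by simp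
    fix t R :: real assume t: "0 < t" "t \<le> 1" and R: "1 \<le> R" "2 * t * real DIM('a) * R \<le> r"
    let ?i = "indicator (cube R) :: 'a \<Rightarrow> real"
    let ?f = "\<lambda>z. ln (marg (t\<^sup>2) (M + t *\<^sub>R z))"
    \<comment> \<open>Bound for the error inside the cube: the increment of the logarithm is at most
      the increment of the marginal divided by its lower bound \<open>k\<close>.\<close>
    define \<delta> where "\<delta> = D0 / k * exp (- R\<^sup>2 / 4) / t ^ DIM('a)"
    have \<delta>: "\<delta> \<ge> 0" unfolding \<delta>_def using D0 k t by simp
    have abst: "\<bar>t\<bar> \<le> t" using t by simp
    have t2: "0 < t\<^sup>2" "t\<^sup>2 \<le> 1" using t by (auto simp: power_le_one)
    have f_le: "\<bar>?f z\<bar> \<le> C0 / t\<^sup>2 + C0 * norm z ^ 2" for z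
      using C0(2)[OF t2, of "t *\<^sub>R z"] t by (simp add: power_mult_distrib)
    have int_f: "integrable lborel (\<lambda>z. gauss 1 z * ?f z)"
      by (rule integrable_gauss_quadratic_bound[OF _ _ f_le]) auto
    note tlog_int = integral_cube_eq_lebesgue[OF cont_slice(1)[OF R(2,1) abst]]
    have "elog_marg (t\<^sup>2) - tlog R t = (\<integral>z. gauss 1 z * ?f z - ?i z * (gauss 1 z * ln (tmarg p0 R t z)) \<partial>lborel)"
      unfolding elog_marg_scale[OF t(1)] tlog_def tlog_int(2) by (rule Bochner_Integration.integral_diff[symmetric, OF int_f tlog_int(1)])
    then have "\<bar>elog_marg (t\<^sup>2) - tlog R t\<bar> \<le> (\<integral>z. \<bar>gauss 1 z * ?f z - ?i z * (gauss 1 z * ln (tmarg p0 R t z))\<bar> \<partial>lborel)"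
      by simp
    also have "\<dots> \<le> (\<integral>z. \<delta> * gauss 1 z + (C0 / t\<^sup>2 / R ^ 8 * (gauss 1 z * norm z ^ 8) + C0 / R ^ 8 * (gauss 1 z * norm z ^ 10)) \<partial>(lborel :: 'a measure))"
    proof (rule integral_mono)
      show "integrable lborel (\<lambda>z. \<bar>gauss 1 z * ?f z - ?i z * (gauss 1 z * ln (tmarg p0 R t z))\<bar>)"
        by (intro integrable_abs Bochner_Integration.integrable_diff int_f tlog_int(1))
      show "integrable lborel (\<lambda>z::'a. \<delta> * gauss 1 z + (C0 / t\<^sup>2 / R ^ 8 * (gauss 1 z * norm z ^ 8) + C0 / R ^ 8 * (gauss 1 z * norm z ^ 10)))"
        by (intro Bochner_Integration.integrable_add integrable_mult_right integrable_gauss integrable_gauss_norm_power) auto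
      fix z :: 'a
      have nn: "0 \<le> C0 / t\<^sup>2 / R ^ 8 * norm z ^ 8 + C0 / R ^ 8 * norm z ^ 10"
        using C0 R by (intro add_nonneg_nonneg mult_nonneg_nonneg divide_nonneg_nonneg) auto
      have "\<bar>?f z - ?i z * ln (tmarg p0 R t z)\<bar> \<le> \<delta> + (C0 / t\<^sup>2 / R ^ 8 * norm z ^ 8 + C0 / R ^ 8 * norm z ^ 10)"
      proof (cases "z \<in> cube R")
        case True
        have Fk: "k \<le> tmarg p0 R t z" unfolding k_def by (rule tmarg_pos_bound[OF R(2) abst True R(1)])
        then have Fp: "0 < tmarg p0 R t z" using k by simp
        have R0: "0 \<le> R" using R by simp
        note d = D0(2)[OF t R0 R(2) True]
        have mp: "0 < marg (t\<^sup>2) (M + t *\<^sub>R z)" using marg_pos[OF t2(1)] .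
        have "0 \<le> ?f z - ln (tmarg p0 R t z)" using d Fp mp by simp
        moreover have "?f z - ln (tmarg p0 R t z) \<le> \<delta>"
        proof -
          have "?f z - ln (tmarg p0 R t z) = ln (marg (t\<^sup>2) (M + t *\<^sub>R z) / tmarg p0 R t z)" using Fp mp by (simp add: ln_div)
          also have "\<dots> \<le> marg (t\<^sup>2) (M + t *\<^sub>R z) / tmarg p0 R t z - 1" using Fp mp by (intro ln_le_minus_one) simp
          also have "\<dots> = (marg (t\<^sup>2) (M + t *\<^sub>R z) - tmarg p0 R t z) / tmarg p0 R t z" using Fp by (simp add: field_simps)
          also have "\<dots> \<le> (D0 * exp (- R\<^sup>2 / 4) / t ^ DIM('a)) / k" using d Fk k by (intro frac_le) auto
          also have "\<dots> = \<delta>" by (simp add: \<delta>_def)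
          finally show ?thesis .
        qed
        ultimately show ?thesis using True nn by simp
      next
        case False
        have "R < norm z" by (rule norm_gt_of_not_mem_cube[OF False])
        then have "R ^ 8 \<le> norm z ^ 8" using R by (intro power_mono) auto
        \<comment> \<open>A Markov-type step: outside the cube this ratio may be inserted as a
          factor, which converts the tail into Gaussian moments of orders 8 and 10.\<close>
        then have one: "1 \<le> norm z ^ 8 / R ^ 8" using R by simp
        have "\<bar>?f z\<bar> \<le> (C0 / t\<^sup>2 + C0 * norm z ^ 2) * 1" using f_le by simp
        also have "\<dots> \<le> (C0 / t\<^sup>2 + C0 * norm z ^ 2) * (norm z ^ 8 / R ^ 8)"
          using C0 by (intro mult_left_mono one) auto
        also have "\<dots> = C0 / t\<^sup>2 / R ^ 8 * norm z ^ 8 + C0 / R ^ 8 * norm z ^ 10"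
        proof -
          have "norm z ^ 10 = norm z ^ 2 * norm z ^ 8" by (simp add: power_add[symmetric])
          then show ?thesis by (simp add: distrib_right add_divide_distrib)
        qed
        finally show ?thesis using False \<delta> by simp
      qed
      then have "gauss 1 z * \<bar>?f z - ?i z * ln (tmarg p0 R t z)\<bar> \<le> gauss 1 z * (\<delta> + (C0 / t\<^sup>2 / R ^ 8 * norm z ^ 8 + C0 / R ^ 8 * norm z ^ 10))"
        by (intro mult_left_mono) auto
      moreover have "\<bar>gauss 1 z * ?f z - ?i z * (gauss 1 z * ln (tmarg p0 R t z))\<bar> = gauss 1 z * \<bar>?f z - ?i z * ln (tmarg p0 R t z)\<bar>"
      proof -
        have "gauss 1 z * ?f z - ?i z * (gauss 1 z * ln (tmarg p0 R t z)) = gauss 1 z * (?f z - ?i z * ln (tmarg p0 R t z))"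
          by (simp only: right_diff_distrib mult_ac)
        then show ?thesis by (simp only: abs_mult abs_of_nonneg[OF gauss_nonneg])
      qed
      ultimately show "\<bar>gauss 1 z * ?f z - ?i z * (gauss 1 z * ln (tmarg p0 R t z))\<bar>
          \<le> \<delta> * gauss 1 z + (C0 / t\<^sup>2 / R ^ 8 * (gauss 1 z * norm z ^ 8) + C0 / R ^ 8 * (gauss 1 z * norm z ^ 10))"
        by (simp only: distrib_left mult_ac)
    qed
    also have "\<dots> = \<delta> + (C0 / t\<^sup>2 / R ^ 8 * m 8 + C0 / R ^ 8 * m 10)"
      using integral_gauss[of 1, where 'a='a] integrable_gauss[of 1, where 'a='a]
        integrable_gauss_norm_power[of 1, where 'a='a and k=8] integrable_gauss_norm_power[of 1, where 'a='a and k=10]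
      by (simp add: m_def)
    also have "\<dots> \<le> \<delta> + C0 * (m 8 + m 10) * (1 / t\<^sup>2 + 1) / R ^ 8"
    proof -
      have "C0 * (m 8 + m 10) * (1 / t\<^sup>2 + 1) / R ^ 8 - (C0 / t\<^sup>2 / R ^ 8 * m 8 + C0 / R ^ 8 * m 10)
        = C0 / R ^ 8 * m 8 + C0 / t\<^sup>2 / R ^ 8 * m 10"
        by (simp add: add_divide_distrib algebra_simps)
      also have "\<dots> \<ge> 0" using C0 R m by (intro add_nonneg_nonneg mult_nonneg_nonneg divide_nonneg_nonneg) auto
      finally show ?thesis by linarith
    qed
    finally show "\<bar>elog_marg (t\<^sup>2) - tlog R t\<bar> \<le> C0 * (m 8 + m 10) * (1 / t\<^sup>2 + 1) / R ^ 8 + D0 / k * exp (- R\<^sup>2 / 4) / t ^ DIM('a)"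
      by (simp add: \<delta>_def)
  qed
qed

theorem elog_marg_asymptotics: "((\<lambda>N. N\<^sup>2 * (elog_marg (1/N) - elog_marg (1/(N+1)))) \<longlongrightarrow> risk_coeff) at_top"
proof -
  define d where "d = DIM('a)"
  have d: "d > 0" by (simp add: d_def)
  \<comment> \<open>Chosen so that \<open>2 * t1 N * DIM('a) * R N\<close> equals \<open>r\<close>
    exactly, the largest cube allowed at scale \<open>t1 N\<close>.\<close>
  define \<rho> where "\<rho> = r / (2 * real d)"
  have \<rho>: "\<rho> > 0" using r d by (simp add: \<rho>_def)
  define R where "R N = \<rho> * sqrt N" for N
  define t1 where "t1 N = 1 / sqrt N" for N
  define t0 where "t0 N = 1 / sqrt (N + 1)" for N
  \<comment> \<open>The first entry ensures \<open>t1 N \<le> 1\<close>, the second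
    \<open>1 \<le> R N\<close>.\<close>
  define N0 where "N0 = max 1 (1 / \<rho>\<^sup>2)"
  obtain C D where CD: "C \<ge> 0" "D \<ge> 0" "\<And>t R. 0 < t \<Longrightarrow> t \<le> 1 \<Longrightarrow> 1 \<le> R \<Longrightarrow> 2 * t * real DIM('a) * R \<le> r \<Longrightarrow>
    \<bar>elog_marg (t\<^sup>2) - tlog R t\<bar> \<le> C * (1 / t\<^sup>2 + 1) / R ^ 8 + D * exp (- R\<^sup>2 / 4) / t ^ DIM('a)"
    using truncation by blast
  have basic: "1 \<le> N" "1 \<le> R N" "0 < t0 N" "t0 N < t1 N" "t1 N \<le> 1" "2 * t1 N * real DIM('a) * R N \<le> r"
    "2 * t0 N * real DIM('a) * R N \<le> r" if N: "N \<ge> N0" for N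
  proof -
    show N1: "1 \<le> N" using N by (simp add: N0_def)
    have "1 / \<rho>\<^sup>2 \<le> N" using N by (simp add: N0_def)
    then have "1 \<le> \<rho>\<^sup>2 * N" using \<rho> by (simp add: field_simps)
    then have "sqrt 1 \<le> sqrt (\<rho>\<^sup>2 * N)" by (rule real_sqrt_le_mono)
    then show R1: "1 \<le> R N" using \<rho> by (simp add: R_def real_sqrt_mult)
    show "0 < t0 N" "t0 N < t1 N" "t1 N \<le> 1" using N1 by (auto simp: t0_def t1_def field_simps)
    show t1r: "2 * t1 N * real DIM('a) * R N \<le> r"
      using N1 d by (simp add: t1_def R_def \<rho>_def d_def[symmetric])
    have "2 * t0 N * real DIM('a) * R N \<le> 2 * t1 N * real DIM('a) * R N"
      using \<open>t0 N < t1 N\<close> R1 by (intro mult_right_mono) auto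
    then show "2 * t0 N * real DIM('a) * R N \<le> r" using t1r by (rule order_trans)
  qed
  have "\<exists>\<tau> \<tau>'. t0 N < \<tau> \<and> \<tau> < t1 N \<and> 0 < \<tau>' \<and> \<tau>' < t1 N \<and> tlog (R N) (t1 N) - tlog (R N) (t0 N) = (t1 N - t0 N) * \<tau> * tlog2 (R N) \<tau>'"
    if "N \<ge> N0" for N
    using tlog_diff[OF basic(6,2)[OF that] basic(3,4)[OF that] order_refl] by metis
  then obtain \<tau> \<tau>' where \<tau>: "\<And>N. N \<ge> N0 \<Longrightarrow> t0 N < \<tau> N" "\<And>N. N \<ge> N0 \<Longrightarrow> \<tau> N < t1 N"
    "\<And>N. N \<ge> N0 \<Longrightarrow> 0 < \<tau>' N" "\<And>N. N \<ge> N0 \<Longrightarrow> \<tau>' N < t1 N"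
    "\<And>N. N \<ge> N0 \<Longrightarrow> tlog (R N) (t1 N) - tlog (R N) (t0 N) = (t1 N - t0 N) * \<tau> N * tlog2 (R N) (\<tau>' N)"
    by metis
  have ev: "eventually (\<lambda>N. N \<ge> N0) at_top" by (rule eventually_ge_at_top)
  have Rlim: "filterlim R at_top at_top" unfolding R_def using \<rho> by real_asymp
  have t1lim: "(t1 \<longlongrightarrow> 0) at_top" unfolding t1_def by real_asymp
  have lim_tlog2: "((\<lambda>N. tlog2 (R N) (\<tau>' N)) \<longlongrightarrow> 2 * risk_coeff) at_top"
  \<comment> \<open>Dominated convergence was proved along sequences. An arbitrary sequence is
    shifted by \<open>k\<close> so that the bounds valid for \<open>N \<ge> N0\<close> hold at every
    index.\<close>
  proof (rule tendsto_at_topI_sequentially)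
    fix X :: "nat \<Rightarrow> real" assume X: "filterlim X at_top sequentially"
    then have "eventually (\<lambda>n. X n \<ge> N0) sequentially" by (simp add: filterlim_at_top)
    then obtain k where k: "\<And>n. n \<ge> k \<Longrightarrow> X n \<ge> N0" by (auto simp: eventually_sequentially)
    have Xk: "X (n + k) \<ge> N0" for n by (rule k) simp
    have X': "filterlim (\<lambda>n. X (n + k)) at_top sequentially"
      by (rule filterlim_compose[OF X]) (rule filterlim_add_const_nat_at_top)
    have "(\<lambda>n. tlog2 (R (X (n + k))) (\<tau>' (X (n + k)))) \<longlonglongrightarrow> 2 * risk_coeff"
    proof (rule tlog2_tendsto)
      fix n
      have "2 * \<bar>\<tau>' (X (n + k))\<bar> * real DIM('a) * R (X (n + k)) \<le> 2 * t1 (X (n + k)) * real DIM('a) * R (X (n + k))"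
        using \<tau>(3,4)[OF Xk[of n]] basic(2)[OF Xk[of n]] by (intro mult_right_mono) auto
      then show "2 * \<bar>\<tau>' (X (n + k))\<bar> * real DIM('a) * R (X (n + k)) \<le> r" using basic(6)[OF Xk[of n]] by (rule order_trans)
      show "1 \<le> R (X (n + k))" by (rule basic(2)[OF Xk])
    next
      show "filterlim (\<lambda>n. R (X (n + k))) at_top sequentially" by (rule filterlim_compose[OF Rlim X'])
      show "(\<lambda>n. \<tau>' (X (n + k))) \<longlonglongrightarrow> 0"
      proof (rule tendsto_sandwich[OF _ _ tendsto_const filterlim_compose[OF t1lim X']])
        show "eventually (\<lambda>n. 0 \<le> \<tau>' (X (n + k))) sequentially" using \<tau>(3)[OF Xk] by (intro always_eventually allI less_imp_le) 
        show "eventually (\<lambda>n. \<tau>' (X (n + k)) \<le> t1 (X (n + k))) sequentially" using \<tau>(4)[OF Xk] by (intro always_eventually allI less_imp_le)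
      qed
    qed
    then show "(\<lambda>n. tlog2 (R (X n)) (\<tau>' (X n))) \<longlonglongrightarrow> 2 * risk_coeff" by (rule LIMSEQ_offset)
  qed
  \<comment> \<open>Since \<open>t1 N - t0 N\<close> is about half of \<open>N powr (-3/2)\<close>,
    replacing \<open>\<tau> N\<close> by either endpoint gives the limit 1/2; this cancels the 2 in
    \<open>2 * risk_coeff\<close>.\<close>
  have lim_fac: "((\<lambda>N. N\<^sup>2 * (t1 N - t0 N) * \<tau> N) \<longlongrightarrow> 1/2) at_top"
  proof (rule tendsto_sandwich)
    show "eventually (\<lambda>N. N\<^sup>2 * (t1 N - t0 N) * t0 N \<le> N\<^sup>2 * (t1 N - t0 N) * \<tau> N) at_top"
      using ev by eventually_elim (use \<tau>(1) basic(4) in \<open>auto intro!: mult_left_mono simp: less_imp_le\<close>)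
    show "eventually (\<lambda>N. N\<^sup>2 * (t1 N - t0 N) * \<tau> N \<le> N\<^sup>2 * (t1 N - t0 N) * t1 N) at_top"
      using ev by eventually_elim (use \<tau>(2) basic(4) in \<open>auto intro!: mult_left_mono simp: less_imp_le\<close>)
    show "((\<lambda>N. N\<^sup>2 * (t1 N - t0 N) * t0 N) \<longlongrightarrow> 1/2) at_top" unfolding t0_def t1_def by real_asymp
    show "((\<lambda>N. N\<^sup>2 * (t1 N - t0 N) * t1 N) \<longlongrightarrow> 1/2) at_top" unfolding t0_def t1_def by real_asymp
  qed
  have main: "((\<lambda>N. N\<^sup>2 * (tlog (R N) (t1 N) - tlog (R N) (t0 N))) \<longlongrightarrow> risk_coeff) at_top"
  proof (rule Lim_transform_eventually)
    show "((\<lambda>N. (N\<^sup>2 * (t1 N - t0 N) * \<tau> N) * tlog2 (R N) (\<tau>' N)) \<longlongrightarrow> risk_coeff) at_top"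
      using tendsto_mult[OF lim_fac lim_tlog2] by simp
    show "eventually (\<lambda>N. (N\<^sup>2 * (t1 N - t0 N) * \<tau> N) * tlog2 (R N) (\<tau>' N) = N\<^sup>2 * (tlog (R N) (t1 N) - tlog (R N) (t0 N))) at_top"
      using ev by eventually_elim (simp add: \<tau>(5))
  qed
  \<comment> \<open>A common majorant of the truncation error at both scales, with the larger
    precision \<open>N + 1\<close> in the numerators. As \<open>R N ^ 8\<close> is of order
    \<open>N^4\<close>, the first term is of order \<open>1 / N\<close>.\<close>
  define e where "e N = N\<^sup>2 * (C * (N + 2) / (\<rho> ^ 8 * N ^ 4) + D * exp (- (\<rho>\<^sup>2 / 4) * N) * (N + 1) powr (real d / 2))" for N
  have e_lim: "(e \<longlongrightarrow> 0) at_top"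
  proof -
    define a where "a = \<rho>\<^sup>2 / 4"
    define b where "b = real d / 2"
    have a: "a > 0" using \<rho> by (simp add: a_def)
    have 1: "((\<lambda>N::real. N\<^sup>2 * ((N + 2) / N ^ 4)) \<longlongrightarrow> 0) at_top" by real_asymp
    have 2: "((\<lambda>N::real. N\<^sup>2 * (exp (- a * N) * (N + 1) powr b)) \<longlongrightarrow> 0) at_top" using a by real_asymp
    have "((\<lambda>N. C / \<rho> ^ 8 * (N\<^sup>2 * ((N + 2) / N ^ 4)) + D * (N\<^sup>2 * (exp (- a * N) * (N + 1) powr b))) \<longlongrightarrow> 0) at_top"
      using tendsto_add[OF tendsto_mult[OF tendsto_const 1, of "C / \<rho> ^ 8"] tendsto_mult[OF tendsto_const 2, of D]] by simp
    moreover have "e = (\<lambda>N. C / \<rho> ^ 8 * (N\<^sup>2 * ((N + 2) / N ^ 4)) + D * (N\<^sup>2 * (exp (- a * N) * (N + 1) powr b)))"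
    proof
      fix N
      have "C * (N + 2) / (\<rho> ^ 8 * N ^ 4) = C / \<rho> ^ 8 * ((N + 2) / N ^ 4)" by simp
      then show "e N = C / \<rho> ^ 8 * (N\<^sup>2 * ((N + 2) / N ^ 4)) + D * (N\<^sup>2 * (exp (- a * N) * (N + 1) powr b))"
        unfolding e_def a_def b_def by (simp only: distrib_left mult_ac)
    qed
    ultimately show ?thesis by simp
  qed
  have err: "N\<^sup>2 * \<bar>elog_marg (t\<^sup>2) - tlog (R N) t\<bar> \<le> e N"
    if N: "N \<ge> N0" and t: "t = 1 / sqrt u" and u: "N \<le> u" "u \<le> N + 1" for N t u
  proof -
    have N1: "1 \<le> N" by (rule basic(1)[OF N])
    have u0: "u > 0" using u N1 by simp
    have tt: "0 < t" "t \<le> 1" using u N1 by (auto simp: t)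
    have "t \<le> t1 N" using u N1 by (simp add: t t1_def frac_le)
    then have "2 * t * real DIM('a) * R N \<le> 2 * t1 N * real DIM('a) * R N"
      using basic(2)[OF N] by (intro mult_right_mono) auto
    then have tr: "2 * t * real DIM('a) * R N \<le> r" using basic(6)[OF N] by (rule order_trans)
    have t2: "1 / t\<^sup>2 = u" using u0 by (simp add: t power_divide)
    have R8: "R N ^ 8 = \<rho> ^ 8 * N ^ 4"
    proof -
      have "sqrt N ^ 8 = ((sqrt N)\<^sup>2) ^ 4" by (simp only: power_mult[symmetric]) simp
      then show ?thesis using N1 by (simp add: R_def power_mult_distrib)
    qed
    have R2: "- (R N)\<^sup>2 / 4 = - (\<rho>\<^sup>2 / 4) * N" using N1 by (simp add: R_def power_mult_distrib)
    have td: "1 / t ^ DIM('a) \<le> (N + 1) powr (real d / 2)"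
    proof -
      have "1 / t ^ DIM('a) = (u powr (1/2)) ^ d" using u0 by (simp add: t d_def power_one_over powr_half_sqrt)
      also have "\<dots> = u powr (real d / 2)" using u0 by (subst powr_power) auto
      also have "\<dots> \<le> (N + 1) powr (real d / 2)" using u u0 by (intro powr_mono2) auto
      finally show ?thesis .
    qed
    have "\<bar>elog_marg (t\<^sup>2) - tlog (R N) t\<bar> \<le> C * (1 / t\<^sup>2 + 1) / R N ^ 8 + D * exp (- (R N)\<^sup>2 / 4) / t ^ DIM('a)"
      by (rule CD(3)[OF tt basic(2)[OF N] tr])
    also have "\<dots> = C * (u + 1) / (\<rho> ^ 8 * N ^ 4) + D * exp (- (\<rho>\<^sup>2 / 4) * N) * (1 / t ^ DIM('a))"
      unfolding t2 R8 R2 by simp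
    also have "\<dots> \<le> C * (N + 2) / (\<rho> ^ 8 * N ^ 4) + D * exp (- (\<rho>\<^sup>2 / 4) * N) * (N + 1) powr (real d / 2)"
    proof (rule add_mono)
      have "u + 1 \<le> N + 2" using u by simp
      then show "C * (u + 1) / (\<rho> ^ 8 * N ^ 4) \<le> C * (N + 2) / (\<rho> ^ 8 * N ^ 4)"
        using CD(1) \<rho> N1 by (intro divide_right_mono mult_left_mono) auto
    qed (use CD(2) td in \<open>intro mult_left_mono; auto\<close>)
    finally show ?thesis unfolding e_def by (intro mult_left_mono) auto
  qed
  have err1: "((\<lambda>N. N\<^sup>2 * (elog_marg (1/N) - tlog (R N) (t1 N))) \<longlongrightarrow> 0) at_top"
  proof (rule Lim_null_comparison[OF _ e_lim])
    show "eventually (\<lambda>N. norm (N\<^sup>2 * (elog_marg (1/N) - tlog (R N) (t1 N))) \<le> e N) at_top"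
      using ev
    proof eventually_elim
      case (elim N)
      have "(t1 N)\<^sup>2 = 1 / N" using basic(1)[OF elim] by (simp add: t1_def power_divide)
      then show ?case using err[OF elim, of "t1 N" N] by (simp add: t1_def abs_mult)
    qed
  qed
  have err0: "((\<lambda>N. N\<^sup>2 * (elog_marg (1/(N+1)) - tlog (R N) (t0 N))) \<longlongrightarrow> 0) at_top"
  proof (rule Lim_null_comparison[OF _ e_lim])
    show "eventually (\<lambda>N. norm (N\<^sup>2 * (elog_marg (1/(N+1)) - tlog (R N) (t0 N))) \<le> e N) at_top"
      using ev
    proof eventually_elim
      case (elim N)
      have "(t0 N)\<^sup>2 = 1 / (N + 1)" using basic(1)[OF elim] by (simp add: t0_def power_divide)
      then show ?case using err[OF elim, of "t0 N" "N + 1"] by (simp add: t0_def abs_mult)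
    qed
  qed
  have "((\<lambda>N. N\<^sup>2 * (tlog (R N) (t1 N) - tlog (R N) (t0 N)) + (N\<^sup>2 * (elog_marg (1/N) - tlog (R N) (t1 N)) - N\<^sup>2 * (elog_marg (1/(N+1)) - tlog (R N) (t0 N)))) \<longlongrightarrow> risk_coeff + (0 - 0)) at_top"
    by (intro tendsto_add tendsto_diff main err1 err0)
  then show ?thesis by (simp add: algebra_simps)
qed

end

section \<open>Integrability of the priors\<close>

text \<open>Averaging over a random shift takes the place of a Fubini decomposition of the space.\<close>

lemma nn_integral_resample:
  fixes f :: "'a::euclidean_space \<Rightarrow> ennreal" and \<iota> :: "'b::euclidean_space \<Rightarrow> 'a"
  assumes [measurable]: "f \<in> borel_measurable borel" "\<iota> \<in> borel_measurable borel" and s: "s > 0"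
  shows "(\<integral>\<^sup>+y. f y \<partial>lborel) = (\<integral>\<^sup>+y. \<integral>\<^sup>+t. ennreal (gauss s t) * f (y + \<iota> t) \<partial>lborel \<partial>lborel)"
proof -
  have "(\<integral>\<^sup>+y. f y \<partial>lborel) = (\<integral>\<^sup>+t. ennreal (gauss s (t::'b)) \<partial>lborel) * (\<integral>\<^sup>+y. f y \<partial>lborel)"
    using s integrable_gauss[OF s, where 'a='b] integral_gauss[OF s, where 'a='b]
    by (subst nn_integral_eq_integral) auto
  also have "\<dots> = (\<integral>\<^sup>+t. ennreal (gauss s (t::'b)) * (\<integral>\<^sup>+y. f y \<partial>lborel) \<partial>lborel)"
    by (simp add: nn_integral_multc)
  also have "\<dots> = (\<integral>\<^sup>+t. \<integral>\<^sup>+y. ennreal (gauss s (t::'b)) * f (y + \<iota> t) \<partial>lborel \<partial>lborel)"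
  proof (rule nn_integral_cong)
    fix t :: 'b
    have "(\<integral>\<^sup>+y. f y \<partial>lborel) = (\<integral>\<^sup>+y. f (y + \<iota> t) \<partial>lborel)"
      using nn_integral_lborel_affine[of f 1 "\<iota> t"] by (simp add: add.commute)
    then show "ennreal (gauss s t) * (\<integral>\<^sup>+y. f y \<partial>lborel) = (\<integral>\<^sup>+y. ennreal (gauss s t) * f (y + \<iota> t) \<partial>lborel)"
      by (simp add: nn_integral_cmult)
  qed
  also have "\<dots> = (\<integral>\<^sup>+y. \<integral>\<^sup>+t. ennreal (gauss s t) * f (y + \<iota> t) \<partial>lborel \<partial>lborel)"
    by (rule lborel_pair.Fubini') measurable
  finally show ?thesis .
qed

text \<open>The part of the variable displaced by \<open>\<iota>\<close> is integrated out first.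
  For this inner integral only decay in the observed part \<open>\<rho>\<close> is kept; the
  remaining decay in \<open>y\<close> stays available for a further application.\<close>

lemma nn_integral_resample_le:
  fixes h F :: "'a::euclidean_space \<Rightarrow> ennreal" and \<iota> :: "'b::euclidean_space \<Rightarrow> 'a" and \<rho> :: "'a \<Rightarrow> 'b"
  assumes [measurable]: "h \<in> borel_measurable borel" "F \<in> borel_measurable borel"
      "\<iota> \<in> borel_measurable borel" "\<rho> \<in> borel_measurable borel"
    and a: "a > 0" and \<iota>: "\<And>t. norm (\<iota> t) \<le> norm t" and \<rho>: "\<And>y. norm (\<rho> y) \<le> norm y"
    and le: "\<And>y. (\<integral>\<^sup>+t. ennreal (exp (- (a/2) * (norm (\<rho> (y + \<iota> t)))\<^sup>2)) * h (y + \<iota> t) \<partial>lborel) \<le> K * F y"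
  shows "(\<integral>\<^sup>+y. ennreal (exp (- a * norm y ^ 2)) * h y \<partial>lborel)
    \<le> ennreal ((2 * pi * (1 / (2 * a))) powr (- (real DIM('b) / 2))) * K * (\<integral>\<^sup>+y. ennreal (exp (- (a/4) * norm y ^ 2)) * F y \<partial>lborel)"
proof -
  let ?C = "(2 * pi * (1 / (2 * a))) powr (- (real DIM('b) / 2))"
  have s: "1 / (2 * a) > 0" using a by simp
  \<comment> \<open>The variance \<open>1 / (2 * a)\<close> gives the random shift the exponent
    \<open>- a * norm t ^ 2\<close>. Together with half of
    \<open>a * (norm (y + \<iota> t))^2\<close> it dominates \<open>(a/4) * norm y ^ 2\<close>; the
    other half is passed on to \<open>\<rho>\<close>.\<close>
  have bnd: "gauss (1 / (2 * a)) t * exp (- a * (norm (y + \<iota> t))\<^sup>2)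
      \<le> ?C * exp (- (a/4) * norm y ^ 2) * exp (- (a/2) * (norm (\<rho> (y + \<iota> t)))\<^sup>2)" for t y
  proof -
    have "norm y \<le> norm (y + \<iota> t) + norm t"
      using norm_triangle_ineq4[of "y + \<iota> t" "\<iota> t"] \<iota>[of t] by simp
    then have "norm y ^ 2 \<le> (norm (y + \<iota> t) + norm t)\<^sup>2" by (intro power_mono) auto
    also have "\<dots> \<le> 2 * (norm (y + \<iota> t))\<^sup>2 + 2 * norm t ^ 2"
      using zero_le_power2[of "norm (y + \<iota> t) - norm t"] by (simp add: power2_eq_square algebra_simps)
    finally have 1: "(a/4) * norm y ^ 2 \<le> (a/4) * (2 * (norm (y + \<iota> t))\<^sup>2 + 2 * norm t ^ 2)"
      using a by (intro mult_left_mono) auto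
    have "(norm (\<rho> (y + \<iota> t)))\<^sup>2 \<le> (norm (y + \<iota> t))\<^sup>2" using \<rho> by (intro power_mono) auto
    then have "(a/2) * (norm (\<rho> (y + \<iota> t)))\<^sup>2 \<le> (a/2) * (norm (y + \<iota> t))\<^sup>2"
      using a by (intro mult_left_mono) auto
    moreover have "0 \<le> a * norm t ^ 2" using a by simp
    ultimately have "- a * norm t ^ 2 + - a * (norm (y + \<iota> t))\<^sup>2
        \<le> - (a/4) * norm y ^ 2 + - (a/2) * (norm (\<rho> (y + \<iota> t)))\<^sup>2"
      using 1 by (simp add: algebra_simps)
    then have "exp (- a * norm t ^ 2) * exp (- a * (norm (y + \<iota> t))\<^sup>2)
        \<le> exp (- (a/4) * norm y ^ 2) * exp (- (a/2) * (norm (\<rho> (y + \<iota> t)))\<^sup>2)"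
      unfolding exp_add[symmetric] by simp
    moreover have "gauss (1 / (2 * a)) t = ?C * exp (- a * norm t ^ 2)"
      using a by (simp add: gauss_def field_simps)
    ultimately show ?thesis unfolding mult.assoc by (simp only: mult.assoc) (intro mult_left_mono; simp)
  qed
  have "(\<integral>\<^sup>+y. ennreal (exp (- a * norm y ^ 2)) * h y \<partial>lborel)
     = (\<integral>\<^sup>+y. \<integral>\<^sup>+t. ennreal (gauss (1 / (2 * a)) t) * (ennreal (exp (- a * (norm (y + \<iota> t))\<^sup>2)) * h (y + \<iota> t)) \<partial>lborel \<partial>lborel)"
    using s by (subst nn_integral_resample[where \<iota>=\<iota>]) auto
  also have "\<dots> \<le> (\<integral>\<^sup>+y. \<integral>\<^sup>+t. ennreal (?C * exp (- (a/4) * norm y ^ 2)) * (ennreal (exp (- (a/2) * (norm (\<rho> (y + \<iota> t)))\<^sup>2)) * h (y + \<iota> t)) \<partial>lborel \<partial>lborel)"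
    unfolding mult.assoc[symmetric]
    by (intro nn_integral_mono mult_right_mono)
       (use bnd in \<open>auto simp: ennreal_mult[symmetric] intro!: ennreal_leI\<close>)
  also have "\<dots> = (\<integral>\<^sup>+y. ennreal (?C * exp (- (a/4) * norm y ^ 2)) * (\<integral>\<^sup>+t. (ennreal (exp (- (a/2) * (norm (\<rho> (y + \<iota> t)))\<^sup>2)) * h (y + \<iota> t)) \<partial>lborel) \<partial>lborel)"
    by (intro nn_integral_cong nn_integral_cmult) measurable
  also have "\<dots> \<le> (\<integral>\<^sup>+y. ennreal (?C * exp (- (a/4) * norm y ^ 2)) * (K * F y) \<partial>lborel)"
    by (intro nn_integral_mono mult_left_mono le) auto
  also have "\<dots> = (\<integral>\<^sup>+y. ennreal ?C * K * (ennreal (exp (- (a/4) * norm y ^ 2)) * F y) \<partial>lborel)"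
    by (intro nn_integral_cong) (simp add: ennreal_mult mult_ac)
  also have "\<dots> = ennreal ?C * K * (\<integral>\<^sup>+y. ennreal (exp (- (a/4) * norm y ^ 2)) * F y \<partial>lborel)"
    by (intro nn_integral_cmult) measurable
  finally show ?thesis .
qed

text \<open>Infinite at \<open>0\<close>, in contrast to \<open>0 powr (- \<theta>) = 0\<close>, so that pointwise bounds also hold on the
  singular set.\<close>

definition inv_powr :: "real \<Rightarrow> real \<Rightarrow> ennreal" where
  "inv_powr \<theta> t = (if t = 0 then top else ennreal (\<bar>t\<bar> powr (- \<theta>)))"

lemma measurable_inv_powr [measurable]: "inv_powr \<theta> \<in> borel_measurable borel"
  unfolding inv_powr_def[abs_def] by measurable

lemma nn_integral_exp_inv_powr_finite:
  assumes a: "a > 0" and \<theta>: "0 \<le> \<theta>" "\<theta> < 1"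
  shows "(\<integral>\<^sup>+t. ennreal (exp (- a * t\<^sup>2)) * inv_powr \<theta> t \<partial>lborel) < top"
proof -
  let ?f = "\<lambda>t::real. ennreal (indicator {0..1} t * t powr (- \<theta>))"
  have [measurable]: "?f \<in> borel_measurable borel" by measurable
  have int: "(\<integral>\<^sup>+t. ?f t \<partial>lborel) = ennreal (1 / (1 - \<theta>))"
  proof -
    have "((\<lambda>t. t powr (- \<theta>)) has_integral (1 powr (- \<theta> + 1) / (- \<theta> + 1))) {0..1}"
      by (rule has_integral_powr_from_0) (use \<theta> in auto)
    then have "((\<lambda>t. if t \<in> {0..1} then t powr (- \<theta>) else 0) has_integral (1 / (1 - \<theta>))) UNIV"
      by (subst has_integral_restrict_UNIV) simp
    moreover have "(\<lambda>t. if t \<in> {0..1} then t powr (- \<theta>) else 0) = (\<lambda>t::real. indicator {0..1} t * t powr (- \<theta>))"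
      by (auto simp: indicator_def)
    ultimately show ?thesis
      by (intro nn_integral_has_integral_lborel) auto
  qed
  have "(\<integral>\<^sup>+t. ennreal (exp (- a * t\<^sup>2)) * inv_powr \<theta> t \<partial>lborel)
      \<le> (\<integral>\<^sup>+t. ennreal (exp (- a * t\<^sup>2)) + (?f t + ?f (- t)) \<partial>lborel)"
  proof (rule nn_integral_mono_AE)
    have "AE t in lborel. t \<noteq> (0::real)" by (rule AE_lborel_singleton)
    then show "AE t in lborel. ennreal (exp (- a * t\<^sup>2)) * inv_powr \<theta> t \<le> ennreal (exp (- a * t\<^sup>2)) + (?f t + ?f (- t))"
    proof eventually_elim
      case (elim t)
      show ?case
      proof (cases "\<bar>t\<bar> \<le> 1")
        case True
        have "exp (- a * t\<^sup>2) * \<bar>t\<bar> powr (- \<theta>) \<le> 1 * \<bar>t\<bar> powr (- \<theta>)"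
          using a by (intro mult_right_mono) auto
        also have "ennreal \<dots> \<le> ?f t + ?f (- t)"
          using True elim by (cases "t > 0") auto
        finally show ?thesis using elim
          by (auto simp: inv_powr_def ennreal_mult[symmetric] ennreal_leI intro: order_trans add_increasing)
      next
        case False
        have "\<bar>t\<bar> powr (- \<theta>) \<le> \<bar>t\<bar> powr 0" using False \<theta> by (intro powr_mono) auto
        then have "\<bar>t\<bar> powr (- \<theta>) \<le> 1" using elim by simp
        then have "exp (- a * t\<^sup>2) * \<bar>t\<bar> powr (- \<theta>) \<le> exp (- a * t\<^sup>2) * 1"
          by (intro mult_left_mono) auto
        then have "ennreal (exp (- a * t\<^sup>2) * \<bar>t\<bar> powr (- \<theta>)) \<le> ennreal (exp (- a * t\<^sup>2))"
          by (intro ennreal_leI) simp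
        then show ?thesis using elim
          by (auto simp: inv_powr_def ennreal_mult[symmetric] intro: add_increasing2)
      qed
    qed
  qed
  also have "\<dots> = (\<integral>\<^sup>+t. ennreal (exp (- a * t\<^sup>2)) \<partial>lborel) + ((\<integral>\<^sup>+t. ?f t \<partial>lborel) + (\<integral>\<^sup>+t. ?f (- t) \<partial>lborel))"
    by (subst nn_integral_add; (subst nn_integral_add)?) auto
  also have "(\<integral>\<^sup>+t. ?f (- t) \<partial>lborel) = (\<integral>\<^sup>+t. ?f t \<partial>lborel)"
    using nn_integral_real_affine[of ?f "-1" 0] by simp
  also have "(\<integral>\<^sup>+t. ennreal (exp (- a * t\<^sup>2)) \<partial>lborel) + ((\<integral>\<^sup>+t. ?f t \<partial>lborel) + (\<integral>\<^sup>+t. ?f t \<partial>lborel)) < top"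
    using integrable_exp_norm_sq[OF a, where 'a=real] unfolding int integrable_iff_bounded
    by simp
  finally show ?thesis .
qed

text \<open>Shifting along one vector of \<open>W\<close> leaves the inner products with the others
  unchanged, so one factor is integrated out at a time. The bound is uniform in \<open>W\<close>
  because later the orthonormal set depends on the columns that are held fixed.\<close>

lemma orthonormal_inv_powr_integral_bounded:
  assumes \<theta>: "0 \<le> \<theta>" "\<theta> < 1" and "a > 0"
  shows "\<exists>K<top. \<forall>W::'a::euclidean_space set. finite W \<and> card W = m \<and> pairwise orthogonal W \<and> (\<forall>w\<in>W. norm w = 1) \<longrightarrow>
    (\<integral>\<^sup>+x. ennreal (exp (- a * norm x ^ 2)) * (\<Prod>w\<in>W. inv_powr \<theta> (w \<bullet> x)) \<partial>lborel) \<le> K"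
  using \<open>a > 0\<close>
proof (induction m arbitrary: a)
  case 0
  show ?case
    using integrable_exp_norm_sq[OF 0, where 'a='a] unfolding integrable_iff_bounded
    by (intro exI[of _ "\<integral>\<^sup>+x. ennreal (exp (- a * (norm (x::'a))\<^sup>2)) \<partial>lborel"]) auto
next
  case (Suc m)
  have "a/4 > 0" using Suc by simp
  from Suc.IH[OF this] obtain K where K: "K < top" "\<And>W::'a set. finite W \<Longrightarrow> card W = m \<Longrightarrow> pairwise orthogonal W \<Longrightarrow> (\<forall>w\<in>W. norm w = 1) \<Longrightarrow>
    (\<integral>\<^sup>+x. ennreal (exp (- (a/4) * norm x ^ 2)) * (\<Prod>w\<in>W. inv_powr \<theta> (w \<bullet> x)) \<partial>lborel) \<le> K" by blast
  define K1 where "K1 = (\<integral>\<^sup>+t. ennreal (exp (- (a/2) * t\<^sup>2)) * inv_powr \<theta> t \<partial>lborel)"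
  have K1: "K1 < top" unfolding K1_def using Suc.prems \<theta> by (intro nn_integral_exp_inv_powr_finite) auto
  let ?C = "ennreal ((2 * pi * (1 / (2 * a))) powr (- (real DIM(real) / 2)))"
  show ?case
  proof (intro exI[of _ "?C * K1 * K"] conjI allI impI)
    show "?C * K1 * K < top" using K K1 by (simp add: ennreal_mult_less_top)
    fix W' :: "'a set" assume W': "finite W' \<and> card W' = Suc m \<and> pairwise orthogonal W' \<and> (\<forall>w\<in>W'. norm w = 1)"
    then obtain v W where W: "W' = insert v W" "v \<notin> W" "card W = m" "finite W"
      by (metis card_Suc_eq finite_insert)
    have v: "norm v = 1" using W W' by auto
    have orth: "w \<bullet> v = 0" if "w \<in> W" for w
      using W W' that by (auto simp: pairwise_def orthogonal_def)
    let ?F = "\<lambda>x. \<Prod>w\<in>W. inv_powr \<theta> (w \<bullet> x)"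
    have "(\<integral>\<^sup>+x. ennreal (exp (- a * norm x ^ 2)) * (inv_powr \<theta> (v \<bullet> x) * ?F x) \<partial>lborel)
        \<le> ?C * K1 * (\<integral>\<^sup>+y. ennreal (exp (- (a/4) * norm y ^ 2)) * ?F y \<partial>lborel)"
    proof (rule nn_integral_resample_le[where \<iota> = "\<lambda>t. t *\<^sub>R v" and \<rho> = "\<lambda>y. v \<bullet> y"])
      show "norm (v \<bullet> y) \<le> norm y" for y using Cauchy_Schwarz_ineq2[of v y] v by simp
      fix y
      have "(\<integral>\<^sup>+t. ennreal (exp (- (a/2) * (norm (v \<bullet> (y + t *\<^sub>R v)))\<^sup>2)) * (inv_powr \<theta> (v \<bullet> (y + t *\<^sub>R v)) * ?F (y + t *\<^sub>R v)) \<partial>lborel)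
          = (\<integral>\<^sup>+t. (\<lambda>t. ennreal (exp (- (a/2) * t\<^sup>2)) * inv_powr \<theta> t) (v \<bullet> y + 1 * t) * ?F y \<partial>lborel)"
        using v by (intro nn_integral_cong) (simp add: inner_add_right orth mult.assoc power2_norm_eq_inner[symmetric])
      also have "\<dots> = (\<integral>\<^sup>+t. (\<lambda>t. ennreal (exp (- (a/2) * t\<^sup>2)) * inv_powr \<theta> t) (v \<bullet> y + 1 * t) \<partial>lborel) * ?F y"
        by (intro nn_integral_multc) measurable
      also have "\<dots> = K1 * ?F y"
        unfolding K1_def by (subst nn_integral_real_affine[of _ 1 "v \<bullet> y"]) auto
      finally show "(\<integral>\<^sup>+t. ennreal (exp (- (a/2) * (norm (v \<bullet> (y + t *\<^sub>R v)))\<^sup>2)) * (inv_powr \<theta> (v \<bullet> (y + t *\<^sub>R v)) * ?F (y + t *\<^sub>R v)) \<partial>lborel) \<le> K1 * ?F y"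
        by simp
    qed (use Suc.prems v in \<open>auto\<close>)
    also have "\<dots> \<le> ?C * K1 * K"
      using W W' by (intro mult_left_mono K(2)) (auto simp: pairwise_insert)
    finally show "(\<integral>\<^sup>+x. ennreal (exp (- a * norm x ^ 2)) * (\<Prod>w\<in>W'. inv_powr \<theta> (w \<bullet> x)) \<partial>lborel) \<le> ?C * K1 * K"
      using W by simp
  qed
qed

text \<open>The entries outside \<open>S \<times> S\<close> are those of the identity matrix, so the determinant is that of the
  Gram matrix of the columns in \<open>S\<close>.\<close>

definition gram_mat :: "'p set \<Rightarrow> real^'p^'n \<Rightarrow> real^'p^'p" where
  "gram_mat S x = (\<chi> i j. if i \<in> S \<and> j \<in> S then column i x \<bullet> column j x else if i = j then 1 else 0)"

lemma gram_mat_UNIV: "gram_mat UNIV x = transpose x ** x"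
  by (simp add: gram_mat_def vec_eq_iff matrix_matrix_mult_def transpose_def column_def inner_vec_def)

lemma gram_mat_empty: "gram_mat {} x = mat 1"
  by (simp add: gram_mat_def mat_def vec_eq_iff)

lemma measurable_det:
  fixes f :: "'a \<Rightarrow> real^'p^'p"
  assumes "\<And>i j. (\<lambda>x. f x $ i $ j) \<in> borel_measurable N"
  shows "(\<lambda>x. det (f x)) \<in> borel_measurable N"
  unfolding det_def using assms by measurable

lemma measurable_gram_det [measurable]: "(\<lambda>x::real^'p^'n. det (gram_mat S x)) \<in> borel_measurable borel"
proof (rule measurable_det)
  fix i j :: 'p
  have "continuous_on UNIV (\<lambda>x::real^'p^'n. column i x \<bullet> column j x)"
    unfolding column_def by (intro continuous_intros)
  then have "(\<lambda>x::real^'p^'n. column i x \<bullet> column j x) \<in> borel_measurable borel"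
    by (rule borel_measurable_continuous_onI)
  then show "(\<lambda>x::real^'p^'n. gram_mat S x $ i $ j) \<in> borel_measurable borel"
    by (simp add: gram_mat_def)
qed

text \<open>Row operations turn row \<open>k\<close> of the bordered Gram matrix into a multiple of the unit
  vector; the same elimination on the transpose clears column \<open>k\<close>.\<close>

lemma det_gram_mat_insert:
  fixes x :: "real^'p^'n"
  assumes k: "k \<notin> S"
    and v: "v \<in> span ((\<lambda>j. column j x) ` S)"
    and w: "\<And>u. u \<in> span ((\<lambda>j. column j x) ` S) \<Longrightarrow> w \<bullet> u = 0"
    and kv: "column k x = v + w"
  shows "det (gram_mat (insert k S) x) = norm w ^ 2 * det (gram_mat S x)"
proof -
  let ?c = "\<lambda>j. column j x"
  have wc: "w \<bullet> ?c j = 0" "?c j \<bullet> w = 0" if "j \<in> S" for j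
    using w[of "?c j"] that by (auto intro: span_base simp: inner_commute)
  have wv: "w \<bullet> v = 0" using w v by blast
  define A where "A = gram_mat (insert k S) x"
  \<comment> \<open>\<open>L\<close> maps column \<open>j\<close> to row \<open>j\<close> of
    \<open>A\<close> for \<open>j\<close> in \<open>S\<close>. As \<open>v\<close> is a combination
    of these columns, \<open>L v\<close> is the same combination of rows, and subtracting it from
    row \<open>k\<close> preserves the determinant.\<close>
  define L where "L u = (\<chi> j. if j \<in> insert k S then u \<bullet> ?c j else 0)" for u
  have linL: "linear L"
    by (rule linearI) (auto simp: L_def vec_eq_iff inner_add_left)
  have LA: "L (?c j) = row j A" if "j \<in> S" for j
    using that k by (auto simp: L_def A_def gram_mat_def row_def vec_eq_iff)
  have in1: "- L v \<in> span {row j A |j. j \<noteq> k}"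
  proof -
    have "L v \<in> L ` span (?c ` S)" using v by blast
    also have "\<dots> = span (L ` ?c ` S)" by (rule linear_span_image[OF linL, symmetric])
    also have "\<dots> \<subseteq> span {row j A |j. j \<noteq> k}"
    proof (intro span_mono subsetI)
      fix u assume "u \<in> L ` ?c ` S"
      then obtain j where "j \<in> S" "u = L (?c j)" by blast
      then show "u \<in> {row j A |j. j \<noteq> k}" using LA k by blast
    qed
    finally show ?thesis by (rule span_neg)
  qed
  define D :: "real^'p^'p" where "D = (\<chi> i. if i = k then axis k 1 else row i A)"
  have "det A = det (\<chi> i. if i = k then row k A + - L v else row i A)"
    using det_row_span[where x = "- L v" and i = k and A = A] in1 by (simp add: span_vec_eq)
  also have "(\<chi> i. if i = k then row k A + - L v else row i A) = (\<chi> i. if i = k then norm w ^ 2 *s axis k 1 else row i A)"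
  proof -
    have "row k A + - L v = norm w ^ 2 *s axis k 1"
      using k wc wv by (auto simp: vec_eq_iff row_def A_def gram_mat_def L_def axis_def kv inner_add_left inner_add_right
          power2_norm_eq_inner inner_commute[of v w])
    then show ?thesis by (simp only:)
  qed
  also have "det \<dots> = norm w ^ 2 * det D"
    unfolding D_def by (rule det_row_mul)
  finally have 1: "det A = norm w ^ 2 * det D" .
  define Bm where "Bm = transpose D"
  \<comment> \<open>After the first elimination the rows of \<open>Bm\<close> with index in
    \<open>S\<close> have entry 0 at position \<open>k\<close>, hence the smaller index set than in
    \<open>L\<close>.\<close>
  define L' where "L' u = (\<chi> j. if j \<in> S then u \<bullet> ?c j else 0)" for u
  have linL': "linear L'"
    by (rule linearI) (auto simp: L'_def vec_eq_iff inner_add_left)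
  have Bm: "Bm $ i $ j = (if j = k then (if i = k then 1 else 0) else A $ j $ i)" for i j
    by (auto simp: Bm_def D_def transpose_def row_def axis_def)
  have LB: "L' (?c j) = row j Bm" if "j \<in> S" for j
    using that k by (auto simp: L'_def Bm A_def gram_mat_def row_def vec_eq_iff inner_commute)
  have in2: "- L' v \<in> span {row j Bm |j. j \<noteq> k}"
  proof -
    have "L' v \<in> L' ` span (?c ` S)" using v by blast
    also have "\<dots> = span (L' ` ?c ` S)" by (rule linear_span_image[OF linL', symmetric])
    also have "\<dots> \<subseteq> span {row j Bm |j. j \<noteq> k}"
    proof (intro span_mono subsetI)
      fix u assume "u \<in> L' ` ?c ` S"
      then obtain j where "j \<in> S" "u = L' (?c j)" by blast
      then show "u \<in> {row j Bm |j. j \<noteq> k}" using LB k by blast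
    qed
    finally show ?thesis by (rule span_neg)
  qed
  have "det Bm = det (\<chi> i. if i = k then row k Bm + - L' v else row i Bm)"
    using det_row_span[where x = "- L' v" and i = k and A = Bm] in2 by (simp add: span_vec_eq)
  also have "(\<chi> i. if i = k then row k Bm + - L' v else row i Bm) = gram_mat S x"
  proof -
    have "row k Bm + - L' v = row k (gram_mat S x)"
      using k wc by (auto simp: vec_eq_iff row_def Bm A_def gram_mat_def L'_def kv inner_add_left inner_add_right inner_commute)
    moreover have "row i Bm = row i (gram_mat S x)" if "i \<noteq> k" for i
      using k that by (auto simp: vec_eq_iff row_def Bm A_def gram_mat_def inner_commute)
    ultimately show ?thesis by (auto simp: vec_eq_iff row_def)
  qed
  finally have "det D = det (gram_mat S x)" by (simp add: Bm_def)
  then show ?thesis using 1 by (simp add: A_def)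
qed

text \<open>Adjoining a column multiplies the determinant by its squared distance to the span of the
  others, starting from the identity matrix.\<close>

lemma det_gram_mat_nonneg: "0 \<le> det (gram_mat S (x::real^'p^'n))"
proof -
  have "finite S" by simp
  then show ?thesis
  proof (induction S)
    case empty
    then show ?case by (simp add: gram_mat_empty)
  next
    case (insert k S)
    obtain v w where "v \<in> span ((\<lambda>j. column j x) ` S)"
      "\<And>u. u \<in> span ((\<lambda>j. column j x) ` S) \<Longrightarrow> orthogonal w u" "column k x = v + w"
      using orthogonal_subspace_decomp_exists[of "(\<lambda>j. column j x) ` S" "column k x"] by metis
    then have "det (gram_mat (insert k S) x) = norm w ^ 2 * det (gram_mat S x)"
      using insert by (intro det_gram_mat_insert) (auto simp: orthogonal_def)
    then show ?case using insert by simp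
  qed
qed

lemma inv_powr_mult: "inv_powr \<theta> (s * t) = inv_powr \<theta> s * inv_powr \<theta> t"
  by (auto simp: inv_powr_def abs_mult powr_mult ennreal_mult ennreal_mult_top ennreal_top_mult)

lemma ex_orthonormal_complement:
  fixes B :: "'a::euclidean_space set"
  assumes "finite B" "card B + m \<le> DIM('a)"
  obtains W where "finite W" "card W = m" "pairwise orthogonal W" "\<And>w. w \<in> W \<Longrightarrow> norm w = 1"
    "\<And>w u. w \<in> W \<Longrightarrow> u \<in> span B \<Longrightarrow> w \<bullet> u = 0"
proof -
  let ?V = "{y \<in> (UNIV::'a set). \<forall>x\<in>span B. orthogonal x y}"
  have "dim ?V + dim (span B) = dim (UNIV :: 'a set)"
    by (rule dim_subspace_orthogonal_to_vectors) auto
  moreover have "dim (span B) \<le> card B" using dim_le_card[of B B] assms by (simp add: span_superset)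
  ultimately have dim: "m \<le> dim ?V" using assms by simp
  have sub: "subspace ?V"
    by (rule subspaceI) (auto simp: orthogonal_def inner_add_right)
  obtain B' where B': "B' \<subseteq> ?V" "pairwise orthogonal B'" "\<And>x. x \<in> B' \<Longrightarrow> norm x = 1" "independent B'" "card B' = dim ?V" "span B' = ?V"
    using orthonormal_basis_subspace[OF sub] by blast
  obtain W where W: "W \<subseteq> B'" "card W = m" "finite W"
    using obtain_subset_with_card_n[of m B'] dim B' by (metis finiteI_independent finite_subset)
  show ?thesis
  proof
    show "pairwise orthogonal W" using B' W pairwise_mono by blast
    show "w \<bullet> u = 0" if "w \<in> W" "u \<in> span B" for w u
      using W B' that by (auto simp: orthogonal_def inner_commute)
  qed (use W B' in auto)
qed

lemma prod_mono_ennreal: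
  fixes f g :: "'a \<Rightarrow> ennreal"
  assumes "\<And>i. i \<in> A \<Longrightarrow> f i \<le> g i"
  shows "prod f A \<le> prod g A"
  using assms by (induction A rule: infinite_finite_induct) (auto intro: mult_mono)

text \<open>The singularity of order \<open>q\<close> in the distance of a column to the span of the
  others is spread over \<open>m\<close> orthonormal directions perpendicular to that span. Each
  inner product is at most the distance in modulus, so the distance to the power \<open>- q\<close>
  is at most the product of their powers \<open>- q / m\<close>, each locally integrable as
  \<open>q < m\<close>.\<close>

lemma gram_integral_finite:
  fixes q :: real
  assumes q: "0 \<le> q" "q < real m" and m: "CARD('p) - 1 + m \<le> CARD('n)" and "a > 0"
  shows "(\<integral>\<^sup>+x. ennreal (exp (- a * norm x ^ 2)) * inv_powr (q/2) (det (gram_mat S (x::real^'p^'n))) \<partial>lborel) < top"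
proof -
  have "finite S" by simp
  then show ?thesis using \<open>a > 0\<close>
  proof (induction S arbitrary: a)
    case empty
    show ?case
      using integrable_exp_norm_sq[OF empty, where 'a="real^'p^'n"] unfolding integrable_iff_bounded
      by (simp add: gram_mat_empty inv_powr_def)
  next
    case (insert k S)
    have m0: "m > 0" using q by (cases m) auto
    define \<theta> where "\<theta> = q / real m"
    have \<theta>: "0 \<le> \<theta>" "\<theta> < 1" using q by (auto simp: \<theta>_def)
    have "a/2 > 0" using insert by simp
    from orthonormal_inv_powr_integral_bounded[OF \<theta> this, where m=m and 'a="real^'n"]
    obtain K where K: "K < top" "\<And>W::(real^'n) set. finite W \<Longrightarrow> card W = m \<Longrightarrow> pairwise orthogonal W \<Longrightarrow> (\<forall>w\<in>W. norm w = 1) \<Longrightarrow>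
      (\<integral>\<^sup>+x. ennreal (exp (- (a/2) * norm x ^ 2)) * (\<Prod>w\<in>W. inv_powr \<theta> (w \<bullet> x)) \<partial>lborel) \<le> K" by blast
    \<comment> \<open>Embeds a vector as column \<open>k\<close>, so that resampling moves this
      column and leaves those in \<open>S\<close> fixed.\<close>
    define \<iota> :: "real^'n \<Rightarrow> real^'p^'n" where "\<iota> c = (\<chi> i j. if j = k then c $ i else 0)" for c
    have norm_col: "norm (column k y) \<le> norm y" for y :: "real^'p^'n"
    proof -
      have "(norm (column k y))\<^sup>2 = (\<Sum>i\<in>UNIV. (y $ i $ k)\<^sup>2)"
        unfolding power2_norm_eq_inner by (simp add: inner_vec_def column_def power2_eq_square)
      also have "\<dots> \<le> (\<Sum>i\<in>UNIV. \<Sum>j\<in>UNIV. (y $ i $ j)\<^sup>2)"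
        by (intro sum_mono member_le_sum) auto
      also have "\<dots> = norm y ^ 2"
        unfolding power2_norm_eq_inner by (simp add: inner_vec_def power2_eq_square)
      finally show ?thesis by (rule power2_le_imp_le) simp
    qed
    have norm_\<iota>: "norm (\<iota> c) \<le> norm c" for c
      by (simp add: norm_eq_sqrt_inner inner_vec_def \<iota>_def if_distrib cong: if_cong)
    have col_same: "column j (y + \<iota> c) = column j y" if "j \<noteq> k" for j y c
      using that by (auto simp: column_def \<iota>_def vec_eq_iff)
    have col_k: "column k (y + \<iota> c) = column k y + c" for y c
      by (auto simp: column_def \<iota>_def vec_eq_iff)
    have gram_same: "gram_mat S (y + \<iota> c) = gram_mat S y" for y c
    proof -
      have "column j (y + \<iota> c) = column j y" if "j \<in> S" for j
        using that insert(2) by (intro col_same) auto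
      then have "gram_mat S (y + \<iota> c) $ i $ j = gram_mat S y $ i $ j" for i j
        by (simp add: gram_mat_def)
      then show ?thesis by (simp add: vec_eq_iff)
    qed
    have [measurable]: "\<iota> \<in> borel_measurable borel"
    proof -
      have "continuous_on UNIV (\<lambda>c::real^'n. if j = k then c $ i else 0)" for i j
        by (cases "j = k") (auto intro: continuous_intros)
      then show ?thesis
        unfolding \<iota>_def by (intro borel_measurable_continuous_onI continuous_on_vec_lambda)
    qed
    have [measurable]: "column k \<in> borel_measurable (borel :: (real^'p^'n) measure)"
      unfolding column_def by (intro borel_measurable_continuous_onI continuous_intros)
    let ?h = "\<lambda>x::real^'p^'n. inv_powr (q/2) (det (gram_mat (insert k S) x))"
    let ?F = "\<lambda>x::real^'p^'n. inv_powr (q/2) (det (gram_mat S x))"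
    have "(\<integral>\<^sup>+x. ennreal (exp (- a * norm x ^ 2)) * ?h x \<partial>lborel)
      \<le> ennreal ((2 * pi * (1 / (2 * a))) powr (- (real DIM(real^'n) / 2))) * K * (\<integral>\<^sup>+y. ennreal (exp (- (a/4) * norm y ^ 2)) * ?F y \<partial>lborel)"
    proof (rule nn_integral_resample_le[where \<iota> = \<iota> and \<rho> = "column k"])
      fix y :: "real^'p^'n"
      let ?B = "(\<lambda>j. column j y) ` S"
      have "card S < CARD('p)" using insert(2) by (intro psubset_card_mono) auto
      then have "card ?B + m \<le> DIM(real^'n)" using m card_image_le[of S "\<lambda>j. column j y"] insert(1) by simp
      then obtain W where W: "finite W" "card W = m" "pairwise orthogonal W" "\<And>w. w \<in> W \<Longrightarrow> norm w = 1"
        "\<And>w u. w \<in> W \<Longrightarrow> u \<in> span ?B \<Longrightarrow> w \<bullet> u = 0"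
        using ex_orthonormal_complement[of ?B m] insert(1) by blast
      have h: "?h (y + \<iota> c) \<le> (\<Prod>w\<in>W. inv_powr \<theta> (w \<bullet> (column k y + c))) * ?F y" for c
      proof -
        obtain v w where vw: "v \<in> span ?B" "\<And>u. u \<in> span ?B \<Longrightarrow> orthogonal w u" "column k y + c = v + w"
          using orthogonal_subspace_decomp_exists[of ?B "column k y + c"] by metis
        have img: "(\<lambda>j. column j (y + \<iota> c)) ` S = ?B"
          using insert(2) by (intro image_cong refl col_same) auto
        have "det (gram_mat (insert k S) (y + \<iota> c)) = norm w ^ 2 * det (gram_mat S (y + \<iota> c))"
          using vw insert(2) by (intro det_gram_mat_insert[where v=v]) (auto simp: img col_k orthogonal_def)
        then have "?h (y + \<iota> c) = inv_powr (q/2) (norm w ^ 2) * ?F y"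
          by (simp add: inv_powr_mult gram_same)
        also have "inv_powr (q/2) (norm w ^ 2) \<le> (\<Prod>u\<in>W. inv_powr \<theta> (u \<bullet> (column k y + c)))"
        proof -
          \<comment> \<open>The directions in \<open>W\<close> annihilate the span, hence they see
            the moving column only through its perpendicular part.\<close>
          have uw: "u \<bullet> (column k y + c) = u \<bullet> w" if "u \<in> W" for u
            using W(5)[OF that vw(1)] by (simp add: vw(3) inner_add_right)
          have "inv_powr (q/2) (norm w ^ 2) = (\<Prod>u\<in>W. inv_powr \<theta> (norm w))"
          proof (cases "w = 0")
            case True
            moreover have "(top::ennreal) ^ m = top" using m0 by (simp add: power_eq_top_ennreal)
            ultimately show ?thesis using W by (simp add: inv_powr_def)
          next
            case False
            have "(\<Prod>u\<in>W. inv_powr \<theta> (norm w)) = ennreal ((norm w powr (- \<theta>)) ^ m)"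
              using False W by (simp add: inv_powr_def ennreal_power)
            also have "(norm w powr (- \<theta>)) ^ m = norm w powr (- q)"
              using False m0 by (subst powr_power) (auto simp: \<theta>_def)
            also have "\<dots> = (norm w ^ 2) powr (- (q/2))"
            proof -
              have "norm w ^ 2 = norm w powr 2" using False by simp
              then show ?thesis by (simp only: powr_powr) simp
            qed
            finally show ?thesis using False by (simp add: inv_powr_def)
          qed
          also have "\<dots> \<le> (\<Prod>u\<in>W. inv_powr \<theta> (u \<bullet> w))"
          proof (rule prod_mono_ennreal)
            fix u assume u: "u \<in> W"
            have "\<bar>u \<bullet> w\<bar> \<le> norm w" using Cauchy_Schwarz_ineq2[of u w] W(4)[OF u] by simp
            then show "inv_powr \<theta> (norm w) \<le> inv_powr \<theta> (u \<bullet> w)"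
              using \<theta> by (auto simp: inv_powr_def intro!: ennreal_leI powr_mono2')
          qed
          also have "\<dots> = (\<Prod>u\<in>W. inv_powr \<theta> (u \<bullet> (column k y + c)))" by (intro prod.cong) (auto simp: uw)
          finally show ?thesis .
        qed
        finally show ?thesis by (simp add: mult_right_mono)
      qed
      let ?g = "\<lambda>x::real^'n. ennreal (exp (- (a/2) * norm x ^ 2)) * (\<Prod>w\<in>W. inv_powr \<theta> (w \<bullet> x))"
      have "(\<integral>\<^sup>+c. ennreal (exp (- (a/2) * (norm (column k (y + \<iota> c)))\<^sup>2)) * ?h (y + \<iota> c) \<partial>lborel)
        \<le> (\<integral>\<^sup>+c. ?g (column k y + 1 *\<^sub>R c) * ?F y \<partial>lborel)"
        using h by (intro nn_integral_mono) (auto simp: col_k mult.assoc intro!: mult_left_mono)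
      also have "\<dots> = (\<integral>\<^sup>+c. ?g (column k y + 1 *\<^sub>R c) \<partial>lborel) * ?F y"
        by (intro nn_integral_multc) measurable
      also have "\<dots> = (\<integral>\<^sup>+c. ?g c \<partial>lborel) * ?F y"
        by (subst (2) nn_integral_lborel_affine[of _ 1 "column k y"]) auto
      also have "\<dots> \<le> K * ?F y"
        using W by (intro mult_right_mono K(2)) auto
      finally show "(\<integral>\<^sup>+c. ennreal (exp (- (a/2) * (norm (column k (y + \<iota> c)))\<^sup>2)) * ?h (y + \<iota> c) \<partial>lborel) \<le> K * ?F y" .
    qed (use insert norm_col norm_\<iota> in auto)
    also have "\<dots> < top"
      using K insert.IH[of "a/4"] insert.prems by (simp add: ennreal_mult_less_top)
    finally show ?case .
  qed
qed

section \<open>The additional singularity at the origin: homogeneity and dyadic balls\<close>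

lemma det_gram_mat_scaleR:
  "det (gram_mat UNIV (t *\<^sub>R (x::real^'p^'n))) = t ^ (2 * CARD('p)) * det (gram_mat UNIV x)"
proof -
  have "gram_mat UNIV (t *\<^sub>R x) = (\<chi> i. t\<^sup>2 *s (gram_mat UNIV x $ i))"
    by (simp add: gram_mat_def vec_eq_iff column_def inner_vec_def sum_distrib_left power2_eq_square mult_ac)
  also have "det \<dots> = (\<Prod>i\<in>(UNIV::'p set). t\<^sup>2) * det (\<chi> i. gram_mat UNIV x $ i)"
    by (rule det_rows_mul)
  finally show ?thesis by (simp add: power_mult)
qed

lemma ennreal_le_suminf: "f k \<le> suminf (f :: nat \<Rightarrow> ennreal)"
  using sum_le_suminf[of f "{k}"] by (simp add: summableI)

text \<open>For \<open>0 < norm x \<le> 1\<close> one term of the series suffices, that of the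
  dyadic shell containing \<open>x\<close>; whole balls replace shells because they scale. The
  origin is treated with the large norms, since \<open>0 powr (- \<gamma>) = 0\<close>.\<close>

lemma norm_powr_le_dyadic:
  fixes x :: "'a::real_normed_vector"
  assumes "\<gamma> \<ge> 0"
  shows "ennreal (norm x powr (- \<gamma>)) \<le> 1 + (\<Sum>k. ennreal (2 powr (\<gamma> * (real k + 1))) * indicator (cball 0 ((1/2)^k)) x)"
proof (cases "x = 0 \<or> norm x > 1")
  case True
  then have "norm x powr (- \<gamma>) \<le> 1"
  proof
    assume "norm x > 1"
    then have "norm x powr (- \<gamma>) \<le> norm x powr 0" using assms by (intro powr_mono) auto
    then show ?thesis by (simp split: if_splits)
  qed simp
  then have "ennreal (norm x powr (- \<gamma>)) \<le> 1" by simp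
  then show ?thesis by (rule add_increasing2[rotated]) simp
next
  case False
  then have x: "norm x > 0" "norm x \<le> 1" by auto
  obtain m where m: "(1/2) ^ m < norm x" using real_arch_pow_inv[OF x(1), of "1/2"] by auto
  define n0 where "n0 = (LEAST n. (1/2) ^ n < norm x)"
  have n0: "(1/2) ^ n0 < norm x" unfolding n0_def by (rule LeastI[where P = "\<lambda>n. (1/2) ^ n < norm x", OF m])
  have "n0 \<noteq> 0" using n0 x by (intro notI) simp
  then obtain k where k: "n0 = Suc k" using not0_implies_Suc by blast
  have k2: "norm x \<le> (1/2) ^ k"
    using not_less_Least[of k "\<lambda>n. (1/2) ^ n < norm x"] k n0_def by simp
  have "norm x powr (- \<gamma>) \<le> ((1/2) ^ n0) powr (- \<gamma>)"
    using n0 assms by (intro powr_mono2') auto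
  also have "((1/2) ^ n0) powr (- \<gamma>) = 2 powr (\<gamma> * (real k + 1))"
  proof -
    have "((1/2) ^ n0 :: real) = 2 powr (- (real k + 1))"
      using powr_realpow[of 2 n0] by (simp only: powr_minus_divide) (simp add: k power_one_over add.commute)
    then show ?thesis by (simp add: powr_powr algebra_simps)
  qed
  finally have "ennreal (norm x powr (- \<gamma>)) \<le> ennreal (2 powr (\<gamma> * (real k + 1)))" by (rule ennreal_leI)
  also have "\<dots> = ennreal (2 powr (\<gamma> * (real k + 1))) * indicator (cball 0 ((1/2)^k)) x"
    using k2 by simp
  also have "\<dots> \<le> (\<Sum>k. ennreal (2 powr (\<gamma> * (real k + 1))) * indicator (cball 0 ((1/2)^k)) x)"
    by (rule ennreal_le_suminf)
  finally show ?thesis by (rule add_increasing[rotated]) simp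
qed

text \<open>By homogeneity the Gram factor has integral proportional to a power of the radius over
  balls about 0. Against the dyadic weights this gives a geometric series of ratio
  \<open>2 powr (\<gamma> - e0)\<close>, which is less than 1.\<close>

lemma gram_norm_integral_finite:
  fixes q \<gamma> :: real
  assumes q: "0 \<le> q" "q < real m" and m: "CARD('p) - 1 + m \<le> CARD('n)" and a: "a > 0"
    and \<gamma>: "0 \<le> \<gamma>" "\<gamma> < real CARD('p) * (real CARD('n) - q)"
  shows "(\<integral>\<^sup>+x. ennreal (exp (- a * norm x ^ 2)) * (inv_powr (q/2) (det (gram_mat UNIV (x::real^'p^'n))) * ennreal (norm x powr (- \<gamma>))) \<partial>lborel) < top"
proof -
  let ?P = "\<lambda>x::real^'p^'n. inv_powr (q/2) (det (gram_mat UNIV x))"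
  let ?e = "\<lambda>x::real^'p^'n. ennreal (exp (- a * norm x ^ 2))"
  have [measurable]: "cball (0::real^'p^'n) \<rho> \<in> sets borel" for \<rho> by simp
  \<comment> \<open>The dimension \<open>n p\<close> of the space less the order \<open>p q\<close>
    of the Gram factor, whose determinant has degree \<open>2 p\<close>.\<close>
  define e0 where "e0 = real CARD('p) * (real CARD('n) - q)"
  define J where "J = (\<integral>\<^sup>+x. ?P x * indicator (cball 0 1) x \<partial>lborel)"
  have fin: "(\<integral>\<^sup>+x. ?e x * ?P x \<partial>lborel) < top" by (rule gram_integral_finite[OF q m a])
  have J: "J < top"
  proof -
    have "J \<le> (\<integral>\<^sup>+x. ennreal (exp a) * (?e x * ?P x) \<partial>lborel)"
      unfolding J_def
    proof (rule nn_integral_mono)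
      fix x :: "real^'p^'n"
      show "?P x * indicator (cball 0 1) x \<le> ennreal (exp a) * (?e x * ?P x)"
      proof (cases "x \<in> cball 0 1")
        case True
        then have "norm x ^ 2 \<le> 1" by (simp add: power_le_one)
        then have "a * norm x ^ 2 \<le> a" using a by (simp add: mult_left_le)
        then have "1 \<le> exp a * exp (- a * norm x ^ 2)" by (simp add: exp_add[symmetric])
        then have "1 \<le> ennreal (exp a) * ?e x" by (simp add: ennreal_mult[symmetric] del: mult_minus_left)
        then have "1 * ?P x \<le> (ennreal (exp a) * ?e x) * ?P x" by (rule mult_right_mono) simp
        then show ?thesis using True by (simp add: mult.assoc)
      qed simp
    qed
    also have "\<dots> = ennreal (exp a) * (\<integral>\<^sup>+x. ?e x * ?P x \<partial>lborel)" by (rule nn_integral_cmult) measurable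
    also have "\<dots> < top" using fin by (simp add: ennreal_mult_less_top)
    finally show ?thesis .
  qed
  have scale: "(\<integral>\<^sup>+x. ?P x * indicator (cball 0 \<rho>) x \<partial>lborel) = ennreal (\<rho> powr e0) * J" if \<rho>: "\<rho> > 0" for \<rho>
  proof -
    have "(\<integral>\<^sup>+x. ?P x * indicator (cball 0 \<rho>) x \<partial>lborel)
       = ennreal (\<bar>\<rho>\<bar> ^ DIM(real^'p^'n)) * (\<integral>\<^sup>+x. ?P (0 + \<rho> *\<^sub>R x) * indicator (cball 0 \<rho>) (0 + \<rho> *\<^sub>R x) \<partial>lborel)"
    proof (rule nn_integral_lborel_affine)
      show "(\<lambda>x. ?P x * indicator (cball 0 \<rho>) x) \<in> borel_measurable borel" by measurable
    qed (use \<rho> in simp)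
    also have "(\<integral>\<^sup>+x. ?P (0 + \<rho> *\<^sub>R x) * indicator (cball 0 \<rho>) (0 + \<rho> *\<^sub>R x) \<partial>lborel)
       = (\<integral>\<^sup>+x. ennreal ((\<rho> ^ (2 * CARD('p))) powr (- (q/2))) * (?P x * indicator (cball 0 1) x) \<partial>lborel)"
    proof (rule nn_integral_cong)
      fix x :: "real^'p^'n"
      have "?P (\<rho> *\<^sub>R x) = inv_powr (q/2) (\<rho> ^ (2 * CARD('p))) * ?P x"
        by (simp add: det_gram_mat_scaleR inv_powr_mult)
      moreover have "inv_powr (q/2) (\<rho> ^ (2 * CARD('p))) = ennreal ((\<rho> ^ (2 * CARD('p))) powr (- (q/2)))"
        using \<rho> by (simp add: inv_powr_def)
      moreover have "indicator (cball 0 \<rho>) (\<rho> *\<^sub>R x) = (indicator (cball 0 1) x :: ennreal)"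
        using \<rho> by (simp add: indicator_def)
      ultimately show "?P (0 + \<rho> *\<^sub>R x) * indicator (cball 0 \<rho>) (0 + \<rho> *\<^sub>R x) = ennreal ((\<rho> ^ (2 * CARD('p))) powr (- (q/2))) * (?P x * indicator (cball 0 1) x)"
        by (simp add: mult.assoc)
    qed
    also have "\<dots> = ennreal ((\<rho> ^ (2 * CARD('p))) powr (- (q/2))) * J"
      unfolding J_def by (rule nn_integral_cmult) measurable
    also have "(\<rho> ^ (2 * CARD('p))) powr (- (q/2)) = \<rho> powr (- (real CARD('p) * q))"
      using \<rho> by (simp add: powr_realpow[symmetric] powr_powr)
    also have "ennreal (\<bar>\<rho>\<bar> ^ DIM(real^'p^'n)) * (ennreal (\<rho> powr (- (real CARD('p) * q))) * J)
       = ennreal (\<rho> powr (real (CARD('n) * CARD('p))) * \<rho> powr (- (real CARD('p) * q))) * J"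
      using \<rho> by (simp add: ennreal_mult powr_realpow mult.assoc del: of_nat_mult)
    also have "\<rho> powr (real (CARD('n) * CARD('p))) * \<rho> powr (- (real CARD('p) * q)) = \<rho> powr e0"
      unfolding powr_add[symmetric] by (simp add: e0_def algebra_simps)
    finally show ?thesis .
  qed
  let ?c = "\<lambda>k. ennreal (2 powr (\<gamma> * (real k + 1)))"
  have "(\<integral>\<^sup>+x. ?e x * (?P x * ennreal (norm x powr (- \<gamma>))) \<partial>lborel)
     \<le> (\<integral>\<^sup>+x. ?e x * ?P x + (\<Sum>k. ?c k * (?P x * indicator (cball 0 ((1/2)^k)) x)) \<partial>lborel)"
  proof (rule nn_integral_mono)
    fix x :: "real^'p^'n"
    have e1: "?e x \<le> 1" using a by simp
    have "?e x * (?P x * ennreal (norm x powr (- \<gamma>)))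
        \<le> ?e x * (?P x * (1 + (\<Sum>k. ?c k * indicator (cball 0 ((1/2)^k)) x)))"
      by (intro mult_left_mono norm_powr_le_dyadic \<gamma>) auto
    also have "\<dots> = ?e x * ?P x + ?e x * (\<Sum>k. ?P x * (?c k * indicator (cball 0 ((1/2)^k)) x))"
      by (simp add: distrib_left)
    also have "\<dots> \<le> ?e x * ?P x + 1 * (\<Sum>k. ?P x * (?c k * indicator (cball 0 ((1/2)^k)) x))"
      by (intro add_left_mono mult_right_mono e1) auto
    finally show "?e x * (?P x * ennreal (norm x powr (- \<gamma>))) \<le> ?e x * ?P x + (\<Sum>k. ?c k * (?P x * indicator (cball 0 ((1/2)^k)) x))"
      by (simp add: mult_ac)
  qed
  also have "\<dots> = (\<integral>\<^sup>+x. ?e x * ?P x \<partial>lborel) + (\<integral>\<^sup>+x. (\<Sum>k. ?c k * (?P x * indicator (cball 0 ((1/2)^k)) x)) \<partial>lborel)"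
    by (rule nn_integral_add) measurable
  also have "(\<integral>\<^sup>+x. (\<Sum>k. ?c k * (?P x * indicator (cball 0 ((1/2)^k)) x)) \<partial>lborel)
      = (\<Sum>k. \<integral>\<^sup>+x. ?c k * (?P x * indicator (cball 0 ((1/2)^k)) x) \<partial>lborel)"
    by (rule nn_integral_suminf) measurable
  also have "\<dots> = (\<Sum>k. ?c k * (\<integral>\<^sup>+x. ?P x * indicator (cball 0 ((1/2)^k)) x \<partial>lborel))"
    by (intro suminf_cong nn_integral_cmult) measurable
  also have "\<dots> = (\<Sum>k. ennreal (2 powr \<gamma> * (2 powr (\<gamma> - e0)) ^ k) * J)"
  proof (rule suminf_cong)
    fix k
    have "2 powr (\<gamma> * (real k + 1)) * ((1/2) ^ k) powr e0 = 2 powr \<gamma> * (2 powr (\<gamma> - e0)) ^ k"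
    proof -
      have "((1/2) ^ k :: real) = 2 powr (- real k)" using powr_realpow[of 2 k] by (simp add: powr_minus_divide power_one_over)
      then have "((1/2) ^ k) powr e0 = 2 powr (- real k * e0)" by (simp add: powr_powr)
      moreover have "(2 powr (\<gamma> - e0)) ^ k = 2 powr ((\<gamma> - e0) * real k)" by (subst powr_power) (auto simp: mult.commute)
      ultimately show ?thesis by (simp add: powr_add[symmetric] algebra_simps)
    qed
    then show "?c k * (\<integral>\<^sup>+x. ?P x * indicator (cball 0 ((1/2)^k)) x \<partial>lborel) = ennreal (2 powr \<gamma> * (2 powr (\<gamma> - e0)) ^ k) * J"
      by (subst scale) (simp_all add: mult.assoc[symmetric] ennreal_mult[symmetric])
  qed
  also have "\<dots> = (\<Sum>k. ennreal (2 powr \<gamma> * (2 powr (\<gamma> - e0)) ^ k)) * J"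
    by (rule ennreal_suminf_multc)
  also have "(\<Sum>k. ennreal (2 powr \<gamma> * (2 powr (\<gamma> - e0)) ^ k)) = ennreal (\<Sum>k. 2 powr \<gamma> * (2 powr (\<gamma> - e0)) ^ k)"
  proof (rule suminf_ennreal2)
    have "2 powr (\<gamma> - e0) < 2 powr 0" using \<gamma> by (intro powr_less_mono) (auto simp: e0_def)
    then show "summable (\<lambda>k. 2 powr \<gamma> * (2 powr (\<gamma> - e0)) ^ k)"
      by (intro summable_mult summable_geometric) simp
  qed simp
  also have "(\<integral>\<^sup>+x. ?e x * ?P x \<partial>lborel) + ennreal (\<Sum>k. 2 powr \<gamma> * (2 powr (\<gamma> - e0)) ^ k) * J < top"
    using fin J by (simp add: ennreal_mult_less_top)
  finally show ?thesis .
qed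

section \<open>Integrability of the two matrix priors against Gaussians\<close>

lemma norm_matrix_sq: "(norm (x::real^'p^'n))\<^sup>2 = (\<Sum>i\<in>UNIV. \<Sum>j\<in>UNIV. (x$i$j)\<^sup>2)"
  unfolding power2_norm_eq_inner by (simp add: inner_vec_def power2_eq_square)

lemma frob_eq_norm: "frob x = norm x"
  unfolding frob_def norm_matrix_sq[symmetric] by simp

lemma prior_SVS_gram: "prior_SVS (x::real^'p^'n) = det (gram_mat UNIV x) powr (- ((real CARD('n) - real CARD('p) - 1) / 2))"
  by (simp only: prior_SVS_def gram_mat_UNIV minus_divide_left)

lemma measurable_prior_SVS [measurable]: "prior_SVS \<in> borel_measurable (borel :: (real^'p^'n) measure)"
  unfolding prior_SVS_gram[abs_def] by measurable

lemma measurable_prior_MSVS1 [measurable]: "prior_MSVS1 \<gamma> \<in> borel_measurable (borel :: (real^'p^'n) measure)"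
  unfolding prior_MSVS1_def[abs_def] frob_eq_norm by measurable

lemma prior_SVS_nonneg: "0 \<le> prior_SVS x"
  by (simp add: prior_SVS_def)

lemma prior_MSVS1_nonneg: "0 \<le> prior_MSVS1 \<gamma> x"
  by (simp add: prior_MSVS1_def prior_SVS_nonneg)

lemma prior_SVS_le_inv_powr:
  "ennreal (prior_SVS (x::real^'p^'n)) \<le> inv_powr ((real CARD('n) - real CARD('p) - 1) / 2) (det (gram_mat UNIV x))"
  using det_gram_mat_nonneg[of UNIV x] by (simp add: inv_powr_def prior_SVS_gram)

text \<open>At most \<open>p - 1\<close> other columns leave \<open>m = n - p + 1\<close> free
  directions, two more than the order \<open>n - p - 1\<close> of the singularity.\<close>

lemma integrable_prior_SVS:
  assumes np: "CARD('n) > CARD('p) + 1" and "a > 0"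
  shows "integrable lborel (\<lambda>x::real^'p^'n. exp (- a * norm x ^ 2) * prior_SVS x)"
proof (rule integrableI_nonneg)
  let ?q = "real CARD('n) - real CARD('p) - 1"
  have "(\<integral>\<^sup>+x. ennreal (exp (- a * norm x ^ 2) * prior_SVS x) \<partial>(lborel :: (real^'p^'n) measure))
    \<le> (\<integral>\<^sup>+x. ennreal (exp (- a * norm x ^ 2)) * inv_powr (?q/2) (det (gram_mat UNIV (x::real^'p^'n))) \<partial>lborel)"
    by (intro nn_integral_mono) (auto simp: ennreal_mult prior_SVS_nonneg intro!: mult_left_mono prior_SVS_le_inv_powr)
  also have "\<dots> < top"
    by (rule gram_integral_finite[where m = "CARD('n) - CARD('p) + 1"]) (use np assms in auto)
  finally show "(\<integral>\<^sup>+x. ennreal (exp (- a * norm x ^ 2) * prior_SVS x) \<partial>(lborel :: (real^'p^'n) measure)) < \<infinity>" by simp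
qed (auto simp: prior_SVS_nonneg)

text \<open>With \<open>q = n - p - 1\<close> the critical exponent \<open>p (n - q)\<close> becomes
  \<open>p (p + 1)\<close>, the stated bound on \<open>\<gamma>\<close>.\<close>

lemma integrable_prior_MSVS1:
  assumes np: "CARD('n) > CARD('p) + 1" and "a > 0" "0 \<le> \<gamma>" "\<gamma> < real CARD('p) ^ 2 + real CARD('p)"
  shows "integrable lborel (\<lambda>x::real^'p^'n. exp (- a * norm x ^ 2) * prior_MSVS1 \<gamma> x)"
proof (rule integrableI_nonneg)
  let ?q = "real CARD('n) - real CARD('p) - 1"
  have "(\<integral>\<^sup>+x. ennreal (exp (- a * norm x ^ 2) * prior_MSVS1 \<gamma> x) \<partial>(lborel :: (real^'p^'n) measure))
    \<le> (\<integral>\<^sup>+x. ennreal (exp (- a * norm x ^ 2)) * (inv_powr (?q/2) (det (gram_mat UNIV (x::real^'p^'n))) * ennreal (norm x powr (- \<gamma>))) \<partial>lborel)"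
    by (intro nn_integral_mono)
       (auto simp: ennreal_mult prior_MSVS1_def frob_eq_norm prior_SVS_nonneg intro!: mult_left_mono mult_right_mono prior_SVS_le_inv_powr)
  also have "\<dots> < top"
    by (rule gram_norm_integral_finite[where m = "CARD('n) - CARD('p) + 1"])
       (use np assms in \<open>auto simp: power2_eq_square algebra_simps\<close>)
  finally show "(\<integral>\<^sup>+x. ennreal (exp (- a * norm x ^ 2) * prior_MSVS1 \<gamma> x) \<partial>(lborel :: (real^'p^'n) measure)) < \<infinity>" by simp
qed (auto simp: prior_MSVS1_nonneg)

section \<open>Twice differentiable functions and the final computation\<close>

text \<open>The three clauses are the differentiability assumptions of
  \<open>c2_gauss_prior\<close>, on an arbitrary set.\<close>

definition c2_with :: "'a::euclidean_space set \<Rightarrow> ('a \<Rightarrow> real) \<Rightarrow> ('a \<Rightarrow> 'a) \<Rightarrow> ('a \<Rightarrow> 'a \<Rightarrow> 'a) \<Rightarrow> bool" where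
  "c2_with S f g H \<longleftrightarrow> (\<forall>x\<in>S. (f has_derivative (\<lambda>h. g x \<bullet> h)) (at x)) \<and>
     (\<forall>x\<in>S. (g has_derivative H x) (at x)) \<and> (\<forall>v. continuous_on S (\<lambda>x. H x v))"

text \<open>Hides the derivatives. This is enough for the Gram determinant, whose gradient and
  Hessian are never computed.\<close>

definition c2_on :: "'a::euclidean_space set \<Rightarrow> ('a \<Rightarrow> real) \<Rightarrow> bool" where
  "c2_on S f \<longleftrightarrow> (\<exists>g H. c2_with S f g H)"

lemma c2_withD:
  assumes "c2_with S f g H"
  shows "\<And>x. x \<in> S \<Longrightarrow> (f has_derivative (\<lambda>h. g x \<bullet> h)) (at x)"
    and "\<And>x. x \<in> S \<Longrightarrow> (g has_derivative H x) (at x)"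
    and "\<And>v. continuous_on S (\<lambda>x. H x v)"
    and "continuous_on S f" and "continuous_on S g"
proof -
  show 1: "\<And>x. x \<in> S \<Longrightarrow> (f has_derivative (\<lambda>h. g x \<bullet> h)) (at x)"
    and 2: "\<And>x. x \<in> S \<Longrightarrow> (g has_derivative H x) (at x)"
    and "\<And>v. continuous_on S (\<lambda>x. H x v)"
    using assms by (auto simp: c2_with_def)
  show "continuous_on S f" "continuous_on S g"
    by (rule continuous_at_imp_continuous_on; use 1 2 has_derivative_continuous in blast)+
qed

lemma c2_with_mult:
  assumes f: "c2_with S f g H" and f': "c2_with S f' g' H'"
  shows "c2_with S (\<lambda>x. f x * f' x) (\<lambda>x. f x *\<^sub>R g' x + f' x *\<^sub>R g x)
    (\<lambda>x v. (f x *\<^sub>R H' x v + (g x \<bullet> v) *\<^sub>R g' x) + (f' x *\<^sub>R H x v + (g' x \<bullet> v) *\<^sub>R g x))"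
  unfolding c2_with_def
proof (intro conjI ballI allI)
  note d = c2_withD[OF f] and d' = c2_withD[OF f']
  fix x assume x: "x \<in> S"
  show "((\<lambda>x. f x * f' x) has_derivative (\<lambda>h. (f x *\<^sub>R g' x + f' x *\<^sub>R g x) \<bullet> h)) (at x)"
    using has_derivative_mult[OF d(1)[OF x] d'(1)[OF x]] by (simp add: inner_add_left mult.commute)
  show "((\<lambda>x. f x *\<^sub>R g' x + f' x *\<^sub>R g x) has_derivative
      (\<lambda>v. (f x *\<^sub>R H' x v + (g x \<bullet> v) *\<^sub>R g' x) + (f' x *\<^sub>R H x v + (g' x \<bullet> v) *\<^sub>R g x))) (at x)"
    by (rule has_derivative_add[OF has_derivative_scaleR[OF d(1)[OF x] d'(2)[OF x]] has_derivative_scaleR[OF d'(1)[OF x] d(2)[OF x]]])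
next
  note d = c2_withD[OF f] and d' = c2_withD[OF f']
  fix v
  show "continuous_on S (\<lambda>x. (f x *\<^sub>R H' x v + (g x \<bullet> v) *\<^sub>R g' x) + (f' x *\<^sub>R H x v + (g' x \<bullet> v) *\<^sub>R g x))"
    by (intro continuous_intros d(3,4,5) d'(3,4,5))
qed

lemma c2_with_powr:
  assumes f: "c2_with S f g H" and pos: "\<And>x. x \<in> S \<Longrightarrow> f x > 0"
  shows "c2_with S (\<lambda>x. f x powr a) (\<lambda>x. (a * f x powr (a - 1)) *\<^sub>R g x)
    (\<lambda>x v. (a * f x powr (a - 1)) *\<^sub>R H x v + (a * ((a - 1) * f x powr (a - 2) * (g x \<bullet> v))) *\<^sub>R g x)"
  unfolding c2_with_def
proof (intro conjI ballI allI)
  note d = c2_withD[OF f]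
  have pw: "((\<lambda>x. f x powr b) has_derivative (\<lambda>h. (b * f x powr (b - 1)) * (g x \<bullet> h))) (at x)" if x: "x \<in> S" for x b
  proof -
    have "((\<lambda>u. u powr b) has_field_derivative b * f x powr (b - 1)) (at (f x))"
      by (rule has_real_derivative_powr[OF pos[OF x]])
    from has_derivative_compose[OF d(1)[OF x] this[unfolded has_field_derivative_def]] show ?thesis by simp
  qed
  fix x assume x: "x \<in> S"
  show "((\<lambda>x. f x powr a) has_derivative (\<lambda>h. ((a * f x powr (a - 1)) *\<^sub>R g x) \<bullet> h)) (at x)"
    using pw[OF x] by simp
  have "((\<lambda>x. a * f x powr (a - 1)) has_derivative (\<lambda>h. a * ((a - 1) * f x powr (a - 2) * (g x \<bullet> h)))) (at x)"
    using has_derivative_mult_right[OF pw[OF x, of "a - 1"], of a] by simp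
  from has_derivative_scaleR[OF this d(2)[OF x]]
  show "((\<lambda>x. (a * f x powr (a - 1)) *\<^sub>R g x) has_derivative
      (\<lambda>v. (a * f x powr (a - 1)) *\<^sub>R H x v + (a * ((a - 1) * f x powr (a - 2) * (g x \<bullet> v))) *\<^sub>R g x)) (at x)" .
next
  note d = c2_withD[OF f]
  have nz: "\<forall>x\<in>S. f x \<noteq> 0" using pos by force
  fix v
  show "continuous_on S (\<lambda>x. (a * f x powr (a - 1)) *\<^sub>R H x v + (a * ((a - 1) * f x powr (a - 2) * (g x \<bullet> v))) *\<^sub>R g x)"
    using nz by (intro continuous_intros d(3,4,5)) auto
qed

lemma c2_with_subset: "c2_with T f g H \<Longrightarrow> S \<subseteq> T \<Longrightarrow> c2_with S f g H"
  unfolding c2_with_def by (meson continuous_on_subset subsetD)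

lemma c2_on_const: "c2_on S (\<lambda>x. k)"
proof -
  have "c2_with S (\<lambda>x. k) (\<lambda>x. 0) (\<lambda>x v. 0)"
    unfolding c2_with_def inner_zero_left by auto
  then show ?thesis by (auto simp: c2_on_def)
qed

lemma c2_on_inner: "c2_on S (\<lambda>x. u \<bullet> x)"
  unfolding c2_on_def c2_with_def
  by (rule exI[of _ "\<lambda>x. u"], rule exI[of _ "\<lambda>x v. 0"]) (auto intro!: derivative_eq_intros)

lemma c2_on_add:
  assumes "c2_on S f" "c2_on S f'"
  shows "c2_on S (\<lambda>x. f x + f' x)"
proof -
  obtain g H where f: "c2_with S f g H" using assms by (auto simp: c2_on_def)
  obtain g' H' where f': "c2_with S f' g' H'" using assms by (auto simp: c2_on_def)
  have "c2_with S (\<lambda>x. f x + f' x) (\<lambda>x. g x + g' x) (\<lambda>x v. H x v + H' x v)"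
    unfolding c2_with_def inner_add_left
    by (intro conjI ballI allI has_derivative_add continuous_on_add c2_withD(1-3)[OF f] c2_withD(1-3)[OF f'])
  then show ?thesis by (auto simp: c2_on_def)
qed

lemma c2_on_mult: "c2_on S f \<Longrightarrow> c2_on S f' \<Longrightarrow> c2_on S (\<lambda>x. f x * f' x)"
  unfolding c2_on_def using c2_with_mult by blast

lemma c2_on_sum: "(\<And>i. i \<in> I \<Longrightarrow> c2_on S (f i)) \<Longrightarrow> c2_on S (\<lambda>x. \<Sum>i\<in>I. f i x)"
  by (induction I rule: infinite_finite_induct) (auto intro: c2_on_const c2_on_add)

lemma c2_on_prod: "(\<And>i. i \<in> I \<Longrightarrow> c2_on S (f i)) \<Longrightarrow> c2_on S (\<lambda>x. \<Prod>i\<in>I. f i x)"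
  by (induction I rule: infinite_finite_induct) (auto intro: c2_on_const c2_on_mult)

text \<open>The permutation expansion makes the determinant a polynomial in the entries, which are
  inner products with matrix units.\<close>

lemma c2_on_det_gram: "c2_on S (\<lambda>x::real^'p^'n. det (transpose x ** x))"
proof -
  have entry: "c2_on S (\<lambda>x::real^'p^'n. x $ i $ j)" for i j
    using c2_on_inner[of S "axis i (axis j 1) :: real^'p^'n"] by (simp add: inner_axis' inner_axis)
  show ?thesis
    unfolding det_def matrix_matrix_mult_def transpose_def
    by (simp, intro c2_on_sum c2_on_mult c2_on_const c2_on_prod entry)
qed

text \<open>The derivatives are left in the form in which \<open>c2_with_powr\<close> produces them for \<open>x \<bullet> x\<close>.\<close>

lemma c2_with_norm_powr:
  "c2_with (- {0}) (\<lambda>x::'a::euclidean_space. norm x powr (- \<gamma>))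
    (\<lambda>x. ((- \<gamma> / 2) * (x \<bullet> x) powr (- \<gamma> / 2 - 1)) *\<^sub>R (2 *\<^sub>R x))
    (\<lambda>x v. ((- \<gamma> / 2) * (x \<bullet> x) powr (- \<gamma> / 2 - 1)) *\<^sub>R (2 *\<^sub>R v)
       + ((- \<gamma> / 2) * ((- \<gamma> / 2 - 1) * (x \<bullet> x) powr (- \<gamma> / 2 - 2) * ((2 *\<^sub>R x) \<bullet> v))) *\<^sub>R (2 *\<^sub>R x))"
proof -
  have "c2_with (- {0}) (\<lambda>x::'a. x \<bullet> x) (\<lambda>x. 2 *\<^sub>R x) (\<lambda>x v. 2 *\<^sub>R v)"
    unfolding c2_with_def by (auto intro!: derivative_eq_intros continuous_intros simp: inner_commute)
  note * = c2_with_powr[OF this, of "- \<gamma> / 2"]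
  have "(x \<bullet> x) powr (- \<gamma> / 2) = norm x powr (- \<gamma>)" for x :: 'a
  proof (cases "x = 0")
    case False
    have "x \<bullet> x = norm x powr 2" using False by (simp add: power2_norm_eq_inner[symmetric])
    then show ?thesis by (simp only: powr_powr) simp
  qed simp
  with * show ?thesis by simp
qed

section \<open>Specialisation to matrices and the limit coefficient\<close>

lemma matnorm_dens_eq_gauss: "matnorm_dens s M (X::real^'p^'n) = gauss s (X - M)"
proof -
  have "(norm (X - M))\<^sup>2 = (\<Sum>i\<in>UNIV. \<Sum>j\<in>UNIV. (X $ i $ j - M $ i $ j)\<^sup>2)"
    by (simp add: norm_matrix_sq)
  then show ?thesis by (simp add: matnorm_dens_def gauss_def)
qed

lemma mat_trace_gram: "mat_trace (transpose M ** M) = (norm (M::real^'p^'n))\<^sup>2"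
  unfolding norm_matrix_sq mat_trace_def matrix_matrix_mult_def transpose_def
  by (subst sum.swap) (simp add: power2_eq_square)


lemma KL_risk_eq:
  fixes M :: "real^'p^'n"
  assumes "gauss_prior q M r c" "N \<ge> 1"
  shows "KL_risk q N M = base_risk TYPE(real^'p^'n) N + gauss_prior.elog_marg q M (1/N) - gauss_prior.elog_marg q M (1/(N+1))"
proof -
  interpret gauss_prior q M r c by fact
  have "bayes_pred q N Y = pred N Y" for Y
    by (simp add: fun_eq_iff bayes_pred_def pred_def matnorm_dens_eq_gauss)
  then show ?thesis using risk_eq[OF assms(2)] unfolding KL_risk_def KL_loss_def matnorm_dens_eq_gauss by simp
qed

lemma prior_SVS_scaleR:
  assumes "t > 0"
  shows "prior_SVS (t *\<^sub>R (x::real^'p^'n)) = t powr (- (real CARD('p) * (real CARD('n) - real CARD('p) - 1))) * prior_SVS x"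
proof -
  let ?q = "real CARD('n) - real CARD('p) - 1"
  have "(t ^ (2 * CARD('p))) powr (- (?q / 2)) = t powr (- (real CARD('p) * ?q))"
    using assms by (simp add: powr_realpow[symmetric] powr_powr)
  then show ?thesis unfolding prior_SVS_gram det_gram_mat_scaleR
    using assms det_gram_mat_nonneg[of UNIV x] by (simp add: powr_mult)
qed

text \<open>Euler's relation for a homogeneous function: the map taking \<open>t\<close> to the
  prior at \<open>t *\<^sub>R M\<close> is differentiated at 1 by the chain rule and as a power of
  \<open>t\<close>.\<close>

lemma prior_SVS_euler:
  fixes M :: "real^'p^'n"
  assumes "(prior_SVS has_derivative (\<lambda>h. u \<bullet> h)) (at M)"
  shows "u \<bullet> M = - (real CARD('p) * (real CARD('n) - real CARD('p) - 1)) * prior_SVS M"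
proof -
  let ?e = "- (real CARD('p) * (real CARD('n) - real CARD('p) - 1))"
  have "((\<lambda>t::real. t *\<^sub>R M) has_derivative (\<lambda>h. h *\<^sub>R M)) (at 1)" by (auto intro!: derivative_eq_intros)
  moreover have "(prior_SVS has_derivative (\<lambda>h. u \<bullet> h)) (at (1 *\<^sub>R M))" using assms by simp
  ultimately have "((\<lambda>t. prior_SVS (t *\<^sub>R M)) has_derivative (\<lambda>h. u \<bullet> (h *\<^sub>R M))) (at 1)"
    by (rule has_derivative_compose)
  then have 1: "((\<lambda>t. prior_SVS (t *\<^sub>R M)) has_field_derivative u \<bullet> M) (at 1)"
    by (simp add: has_field_derivative_def mult_commute_abs)
  have "((\<lambda>t. t powr ?e * prior_SVS M) has_field_derivative (?e * 1 powr (?e - 1)) * prior_SVS M) (at 1)"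
    by (intro DERIV_cmult_right has_real_derivative_powr) simp
  then have "((\<lambda>t. prior_SVS (t *\<^sub>R M)) has_field_derivative (?e * 1 powr (?e - 1)) * prior_SVS M) (at 1)"
  \<comment> \<open>Radius 1 keeps \<open>t\<close> positive, where homogeneity is
    available.\<close>
  proof (rule has_field_derivative_transform_within[where d = 1])
    show "t powr ?e * prior_SVS M = prior_SVS (t *\<^sub>R M)" if "dist t 1 < 1" for t
      using that by (subst prior_SVS_scaleR) (auto simp: dist_real_def)
  qed auto
  from DERIV_unique[OF 1 this] show ?thesis by simp
qed

theorem theorem8:
  fixes M :: "real^'p^'n" and \<gamma> :: real
  assumes "CARD('n) > CARD('p) + 1"
    and "0 \<le> \<gamma>" and "\<gamma> < real CARD('p) ^ 2 + real CARD('p)"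
    and "det (transpose M ** M) \<noteq> 0"
  shows "((\<lambda>N. N^2 * (KL_risk (prior_MSVS1 \<gamma>) N M - KL_risk prior_SVS N M))
           \<longlongrightarrow> \<gamma> * (\<gamma> - 2 * real CARD('p) ^ 2 - 2 * real CARD('p) + 4)
                 / (2 * mat_trace (transpose M ** M))) at_top
       \<and> (2 \<le> CARD('p) \<and> 0 < \<gamma> \<longrightarrow>
           \<gamma> * (\<gamma> - 2 * real CARD('p) ^ 2 - 2 * real CARD('p) + 4)
                 / (2 * mat_trace (transpose M ** M)) < 0)"
proof
  let ?n = "real CARD('n)" and ?p = "real CARD('p)"
  let ?det = "\<lambda>x::real^'p^'n. det (transpose x ** x)"
  have detM: "?det M > 0" using det_gram_mat_nonneg[of UNIV M] assms(4) by (simp add: gram_mat_UNIV)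
  have det0: "x \<noteq> 0" if "?det x > 0" for x :: "real^'p^'n"
  proof
    assume "x = 0"
    then have "x = 0 *\<^sub>R x" by simp
    then have "?det x = 0 ^ (2 * CARD('p)) * ?det x"
      by (metis det_gram_mat_scaleR gram_mat_UNIV)
    moreover have "(0::real) ^ (2 * CARD('p)) = 0" by (rule zero_power) simp
    ultimately show False using that by simp
  qed
  have M0: "M \<noteq> 0" by (rule det0[OF detM])
  have nM: "norm M ^ 2 > 0" using M0 by simp
  show "2 \<le> CARD('p) \<and> 0 < \<gamma> \<longrightarrow>
     \<gamma> * (\<gamma> - 2 * ?p ^ 2 - 2 * ?p + 4) / (2 * mat_trace (transpose M ** M)) < 0"
  proof (intro impI, elim conjE)
    assume p: "2 \<le> CARD('p)" and \<gamma>: "0 < \<gamma>"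
    \<comment> \<open>Since \<open>\<gamma> < p^2 + p\<close>, the bracket is below
      \<open>4 - p^2 - p\<close>, which is negative because \<open>p^2 \<ge> 4\<close>.\<close>
    have "2 \<le> ?p" using p by simp
    then have "2 * 2 \<le> ?p * ?p" by (intro mult_mono) auto
    then have "\<gamma> - 2 * ?p ^ 2 - 2 * ?p + 4 < 0" using assms(3) \<open>2 \<le> ?p\<close> by (simp add: power2_eq_square)
    then show "\<gamma> * (\<gamma> - 2 * ?p ^ 2 - 2 * ?p + 4) / (2 * mat_trace (transpose M ** M)) < 0"
      using \<gamma> nM by (intro divide_neg_pos mult_pos_neg) (auto simp: mat_trace_gram)
  qed
  \<comment> \<open>Full rank is an open condition, so a closed ball about \<open>M\<close> avoids
    the singular set of both priors.\<close>
  have "continuous_on UNIV ?det" using c2_on_det_gram[of UNIV] c2_withD(4) by (auto simp: c2_on_def)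
  then have "open {x. 0 < ?det x}" by (intro open_Collect_less continuous_on_const)
  then obtain r where r: "r > 0" "cball M r \<subseteq> {x. 0 < ?det x}"
    using detM by (auto simp: open_contains_cball)
  have det_pos: "?det x > 0" if "x \<in> cball M r" for x using r that by auto
  have nz: "x \<noteq> 0" if "x \<in> cball M r" for x using det0 det_pos that by blast
  obtain gd Hd where gd: "c2_with (cball M r) ?det gd Hd" using c2_on_det_gram[of "cball M r"] by (auto simp: c2_on_def)
  obtain g0 H0 where c0: "c2_with (cball M r) (prior_SVS :: real^'p^'n \<Rightarrow> real) g0 H0"
    using c2_with_powr[OF gd det_pos] unfolding prior_SVS_def[abs_def] by blast
  define \<rho> :: "real^'p^'n \<Rightarrow> real" where "\<rho> x = norm x powr (- \<gamma>)" for x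
  define g\<rho> where "g\<rho> x = ((- \<gamma> / 2) * (x \<bullet> x) powr (- \<gamma> / 2 - 1)) *\<^sub>R (2 *\<^sub>R x)" for x :: "real^'p^'n"
  define H\<rho> where "H\<rho> x v = ((- \<gamma> / 2) * (x \<bullet> x) powr (- \<gamma> / 2 - 1)) *\<^sub>R (2 *\<^sub>R v)
       + ((- \<gamma> / 2) * ((- \<gamma> / 2 - 1) * (x \<bullet> x) powr (- \<gamma> / 2 - 2) * ((2 *\<^sub>R x) \<bullet> v))) *\<^sub>R (2 *\<^sub>R x)" for x v :: "real^'p^'n"
  have c\<rho>: "c2_with (cball M r) \<rho> g\<rho> H\<rho>"
    unfolding \<rho>_def g\<rho>_def H\<rho>_def
    by (rule c2_with_subset[OF c2_with_norm_powr]) (use nz in blast)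
  define g1 where "g1 x = prior_SVS x *\<^sub>R g\<rho> x + \<rho> x *\<^sub>R g0 x" for x
  define H1 where "H1 x v = (prior_SVS x *\<^sub>R H\<rho> x v + (g0 x \<bullet> v) *\<^sub>R g\<rho> x) + (\<rho> x *\<^sub>R H0 x v + (g\<rho> x \<bullet> v) *\<^sub>R g0 x)" for x v
  have c1: "c2_with (cball M r) (prior_MSVS1 \<gamma>) g1 H1"
    using c2_with_mult[OF c0 c\<rho>] unfolding g1_def H1_def \<rho>_def prior_MSVS1_def[abs_def] frob_eq_norm .
  have pos0: "prior_SVS x > 0" if "x \<in> cball M r" for x using det_pos[OF that] by (simp add: prior_SVS_def)
  have pos\<rho>: "\<rho> x > 0" if "x \<in> cball M r" for x using nz[OF that] by (simp add: \<rho>_def)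
  have pos1: "prior_MSVS1 \<gamma> x > 0" if "x \<in> cball M r" for x
    using pos0[OF that] pos\<rho>[OF that] by (simp add: prior_MSVS1_def \<rho>_def frob_eq_norm)
  have lower: "\<exists>c>0. \<forall>x\<in>cball M r. c \<le> f x" if "continuous_on (cball M r) f" "\<And>x. x \<in> cball M r \<Longrightarrow> f x > 0" for f :: "real^'p^'n \<Rightarrow> real"
    using continuous_attains_inf[OF compact_cball _ that(1)] that(2) r(1) by (metis cball_eq_empty not_less_iff_gr_or_eq)
  obtain k0 where k0: "k0 > 0" "\<And>x. x \<in> cball M r \<Longrightarrow> k0 \<le> prior_SVS x"
    using lower[OF c2_withD(4)[OF c0] pos0] by blast
  obtain k1 where k1: "k1 > 0" "\<And>x. x \<in> cball M r \<Longrightarrow> k1 \<le> prior_MSVS1 \<gamma> x"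
    using lower[OF c2_withD(4)[OF c1] pos1] by blast
  have gp0: "gauss_prior prior_SVS M r k0"
    by unfold_locales (use r k0 integrable_prior_SVS[OF assms(1)] in \<open>auto simp: prior_SVS_nonneg\<close>)
  have gp1: "gauss_prior (prior_MSVS1 \<gamma>) M r k1"
    by unfold_locales (use r k1 integrable_prior_MSVS1[OF assms(1) _ assms(2,3)] in \<open>auto simp: prior_MSVS1_nonneg\<close>)
  interpret P0: c2_gauss_prior prior_SVS M r k0 g0 H0
    by (intro c2_gauss_prior.intro gp0 c2_gauss_prior_axioms.intro c2_withD(1-3)[OF c0])
  interpret P1: c2_gauss_prior "prior_MSVS1 \<gamma>" M r k1 g1 H1
    by (intro c2_gauss_prior.intro gp1 c2_gauss_prior_axioms.intro c2_withD(1-3)[OF c1])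
  have MM: "M \<in> cball M r" using r by simp
  let ?S = "norm M ^ 2"
  have \<rho>M: "\<rho> M > 0" and q0: "prior_SVS M > 0" using pos\<rho>[OF MM] pos0[OF MM] by auto
  have S: "M \<bullet> M = ?S" by (simp add: power2_norm_eq_inner)
  have \<rho>S: "(M \<bullet> M) powr (- \<gamma> / 2) = \<rho> M"
  proof -
    have "M \<bullet> M = norm M powr 2" using M0 by (simp add: S)
    then show ?thesis by (simp only: powr_powr \<rho>_def) simp
  qed
  have pw1: "(M \<bullet> M) powr (- \<gamma> / 2 - 1) = \<rho> M / ?S"
    using nM \<rho>S by (simp add: powr_diff S)
  have pw2: "(M \<bullet> M) powr (- \<gamma> / 2 - 2) = \<rho> M / ?S\<^sup>2"
    using nM \<rho>S by (simp add: powr_diff S powr_numeral)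
  have g\<rho>M: "g\<rho> M = (- \<gamma> * \<rho> M / ?S) *\<^sub>R M"
    unfolding g\<rho>_def pw1 by simp
  have euler: "g0 M \<bullet> M = - (?p * (?n - ?p - 1)) * prior_SVS M"
    by (rule prior_SVS_euler[OF c2_withD(1)[OF c0 MM]])
  have norm_g\<rho>: "(norm (g\<rho> M))\<^sup>2 = \<gamma>\<^sup>2 * (\<rho> M)\<^sup>2 / ?S"
    unfolding g\<rho>M power2_norm_eq_inner using nM by (simp add: S power2_eq_square)
  have inner_g: "g0 M \<bullet> g\<rho> M = \<gamma> * \<rho> M / ?S * (?p * (?n - ?p - 1)) * prior_SVS M"
    unfolding g\<rho>M by (simp add: euler)
  \<comment> \<open>The Laplacian of a power of the norm in dimension \<open>n p\<close>: each
    coordinate contributes the constant term, and the radial second-order terms add up to one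
    squared norm.\<close>
  have trH\<rho>: "(\<Sum>b\<in>Basis. H\<rho> M b \<bullet> b) = \<gamma> * (\<gamma> + 2 - ?n * ?p) * \<rho> M / ?S"
  proof -
    have "H\<rho> M b \<bullet> b = - \<gamma> * \<rho> M / ?S + (\<gamma> * (\<gamma> + 2) * \<rho> M / ?S\<^sup>2) * (M \<bullet> b)\<^sup>2" if "b \<in> Basis" for b
    proof -
      have alg: "(- \<gamma> / 2 * u) * (2 * 1) + (- \<gamma> / 2 * ((- \<gamma> / 2 - 1) * w * (2 * x))) * (2 * x)
          = - \<gamma> * u + \<gamma> * (\<gamma> + 2) * w * x\<^sup>2" for u w x
        by (simp add: power2_eq_square algebra_simps)
      have "b \<bullet> b = 1" using that by (simp add: inner_Basis)
      then show ?thesis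
        using alg[of "\<rho> M / ?S" "\<rho> M / ?S\<^sup>2" "M \<bullet> b"]
        unfolding H\<rho>_def pw1 pw2 inner_add_left inner_scaleR_left by simp
    qed
    then have "(\<Sum>b\<in>Basis. H\<rho> M b \<bullet> b) = (\<Sum>b\<in>(Basis::(real^'p^'n) set). - \<gamma> * \<rho> M / ?S + (\<gamma> * (\<gamma> + 2) * \<rho> M / ?S\<^sup>2) * (M \<bullet> b)\<^sup>2)"
      by simp
    also have "\<dots> = real DIM(real^'p^'n) * (- \<gamma> * \<rho> M / ?S) + (\<gamma> * (\<gamma> + 2) * \<rho> M / ?S\<^sup>2) * ?S"
      unfolding sum.distrib sum_distrib_left[symmetric] norm_sq_eq_sum_Basis[symmetric] by simp
    also have "\<dots> = \<gamma> * (\<gamma> + 2 - ?n * ?p) * \<rho> M / ?S"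
    proof -
      have "k * (- \<gamma> * u / s) + (\<gamma> * (\<gamma> + 2) * u / s\<^sup>2) * s = \<gamma> * (\<gamma> + 2 - k) * u / s" if "s > 0" for k u s
        using that by (simp add: field_simps power2_eq_square)
      from this[OF nM] show ?thesis by simp
    qed
    finally show ?thesis .
  qed
  have trH1: "(\<Sum>b\<in>Basis. H1 M b \<bullet> b) = prior_SVS M * (\<Sum>b\<in>Basis. H\<rho> M b \<bullet> b) + 2 * (g0 M \<bullet> g\<rho> M) + \<rho> M * (\<Sum>b\<in>Basis. H0 M b \<bullet> b)"
  proof -
    have "H1 M b \<bullet> b = prior_SVS M * (H\<rho> M b \<bullet> b) + 2 * ((g0 M \<bullet> b) * (g\<rho> M \<bullet> b)) + \<rho> M * (H0 M b \<bullet> b)" for b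
      by (simp add: H1_def inner_add_left)
    then show ?thesis
      by (simp add: sum.distrib sum_distrib_left[symmetric] euclidean_inner[of "g0 M" "g\<rho> M"])
  qed
  have norm_g1: "(norm (g1 M))\<^sup>2 = (prior_SVS M)\<^sup>2 * (norm (g\<rho> M))\<^sup>2 + 2 * prior_SVS M * \<rho> M * (g0 M \<bullet> g\<rho> M) + (\<rho> M)\<^sup>2 * (norm (g0 M))\<^sup>2"
    unfolding power2_norm_eq_inner g1_def
    by (simp add: inner_add_left inner_add_right inner_commute power2_eq_square algebra_simps)
  have q1: "prior_MSVS1 \<gamma> M = prior_SVS M * \<rho> M" by (simp add: prior_MSVS1_def \<rho>_def frob_eq_norm)
  have diff: "P1.risk_coeff - P0.risk_coeff = \<gamma> * (\<gamma> - 2 * ?p ^ 2 - 2 * ?p + 4) / (2 * mat_trace (transpose M ** M))"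
  proof -
    define a b i where "a = prior_SVS M" and "b = \<rho> M" and "i = g0 M \<bullet> g\<rho> M"
    define t0 n0 where "t0 = (\<Sum>b\<in>Basis. H0 M b \<bullet> b)" and "n0 = (norm (g0 M))\<^sup>2"
    define t n where "t = (\<Sum>b\<in>Basis. H\<rho> M b \<bullet> b)" and "n = (norm (g\<rho> M))\<^sup>2"
    have ab: "a > 0" "b > 0" using q0 \<rho>M by (auto simp: a_def b_def)
    have "P1.risk_coeff - P0.risk_coeff = (a * t + 2 * i + b * t0) / (a * b) - (a\<^sup>2 * n + 2 * a * b * i + b\<^sup>2 * n0) / (2 * (a * b)\<^sup>2) - (t0 / a - n0 / (2 * a\<^sup>2))"
      unfolding P1.risk_coeff_def P0.risk_coeff_def trH1 norm_g1 q1 a_def b_def i_def t0_def n0_def t_def n_def ..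
    \<comment> \<open>The Laplacian and squared gradient of the SVS prior cancel. The mixed term
      enters with factor 2 from the Laplacian and factor 1 from the squared gradient, so one copy is
      left.\<close>
    also have "\<dots> = t / b + i / (a * b) - n / (2 * b\<^sup>2)"
      using ab by (simp add: field_simps power2_eq_square)
    also have "i / (a * b) = \<gamma> * (?p * (?n - ?p - 1)) / ?S"
      unfolding i_def inner_g using ab by (simp add: a_def b_def)
    also have "t / b = \<gamma> * (\<gamma> + 2 - ?n * ?p) / ?S"
      unfolding t_def trH\<rho> using ab by (simp add: b_def)
    also have "n / (2 * b\<^sup>2) = \<gamma>\<^sup>2 / (2 * ?S)"
      unfolding n_def norm_g\<rho> using ab by (simp add: b_def)
    \<comment> \<open>The dimension cancels here: \<open>\<gamma> + 2 - n p + p (n - p - 1)\<close>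
      equals \<open>\<gamma> + 2 - p^2 - p\<close>, and the last term subtracts
      \<open>\<gamma> / 2\<close> from it.\<close>
    also have "\<gamma> * (\<gamma> + 2 - ?n * ?p) / ?S + \<gamma> * (?p * (?n - ?p - 1)) / ?S - \<gamma>\<^sup>2 / (2 * ?S)
        = \<gamma> * (\<gamma> - 2 * ?p ^ 2 - 2 * ?p + 4) / (2 * ?S)"
    proof -
      have "\<gamma> * (\<gamma> + 2 - ?n * ?p) / s + \<gamma> * (?p * (?n - ?p - 1)) / s - \<gamma>\<^sup>2 / (2 * s)
        = \<gamma> * (\<gamma> - 2 * ?p ^ 2 - 2 * ?p + 4) / (2 * s)" if "s > 0" for s
        using that by (simp add: field_simps power2_eq_square)
      from this[OF nM] show ?thesis .
    qed
    finally show ?thesis by (simp add: mat_trace_gram)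
  qed
  have "((\<lambda>N. N\<^sup>2 * (P1.elog_marg (1/N) - P1.elog_marg (1/(N+1))) - N\<^sup>2 * (P0.elog_marg (1/N) - P0.elog_marg (1/(N+1)))) \<longlongrightarrow> P1.risk_coeff - P0.risk_coeff) at_top"
    by (intro tendsto_diff P1.elog_marg_asymptotics P0.elog_marg_asymptotics)
  then show "((\<lambda>N. N^2 * (KL_risk (prior_MSVS1 \<gamma>) N M - KL_risk prior_SVS N M))
     \<longlongrightarrow> \<gamma> * (\<gamma> - 2 * ?p ^ 2 - 2 * ?p + 4) / (2 * mat_trace (transpose M ** M))) at_top"
    unfolding diff
  proof (rule Lim_transform_eventually)
    show "eventually (\<lambda>N. N\<^sup>2 * (P1.elog_marg (1/N) - P1.elog_marg (1/(N+1))) - N\<^sup>2 * (P0.elog_marg (1/N) - P0.elog_marg (1/(N+1)))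
       = N^2 * (KL_risk (prior_MSVS1 \<gamma>) N M - KL_risk prior_SVS N M)) at_top"
      using eventually_ge_at_top[of 1]
    proof eventually_elim
      case (elim N)
      show ?case unfolding KL_risk_eq[OF gp1 elim] KL_risk_eq[OF gp0 elim] by (simp add: algebra_simps)
    qed
  qed
qed

end
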